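(* Let $\mathsf H$ be a quaternionic Hilbert space and let $T:D(T)\to\mathsf H$ be a closed normal operator with dense domain. Then there exist three operators $A:D(A)\to\mathsf H$, $B:D(B)\to\mathsf H$ and $J\in\mathfrak B(\mathsf H)$ such that: (1) $T=A+JB$; (2) $A$ is self-adjoint and $B$ is positive and self-adjoint; (3) $J$ is anti self-adjoint and unitary; (4) $\overline{AB}=\overline{BA}$, $AJ=JA$ and $BJ=JB$. The operators $A$ and $B$ are uniquely determined by $T$ via the formulas $A=\overline{(T+T^* )\frac12}$ and $B=\big|\,\overline{(T-T^* )\frac12}\,\big|$. The operator $J$ is uniquely determined by $T$ on $\mathrm{Ker}(\overline{T-T^*})^\perp$. (That is, if $A',B',J'$ also satisfy (1)-(4), then $A'=A$, $B'=B$ and $J'u=Ju$ for all $u\in\mathrm{Ker}(\overline{T-T^*})^\perp$.)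
   Context: $\mathbb H$ denotes the quaternions. A quaternionic Hilbert space $\mathsf H$ is a non-zero right $\mathbb H$-module with an additive $\mathbb H$-valued product satisfying $\langle u|vp+wq\rangle=\langle u|v\rangle p+\langle u|w\rangle q$, $\langle u|v\rangle=\overline{\langle v|u\rangle}$, $\langle u|u\rangle\ge0$, such that $\|u\|=\sqrt{\langle u|u\rangle}$ is a complete norm. An operator $T:D(T)\to\mathsf H$ is a right $\mathbb H$-linear map on a right $\mathbb H$-linear subspace $D(T)$; sums and compositions have natural domains ($D(T+S)=D(T)\cap D(S)$, $D(TS)=S^{-1}(D(T))$), and equality of operators includes equality of domains. For $r\in\mathbb R$, $(Tr)(u)=T(u)r$. $\overline T$ is the closure and $T^*$ the adjoint of a densely defined $T$. $T$ is normal if $TT^*=T^*T$, self-adjoint if $T^*=T$, anti self-adjoint if $T^*=-T$, unitary if $D(T)=\mathsf H$ and $TT^*=T^*T=I$, positive if $\langle u|Tu\rangle\in[0,\infty)$ for all $u\in D(T)$. $\mathfrak B(\mathsf H)$ is the set of bounded operators $\mathsf H\to\mathsf H$. For a closed normal densely defined operator $S$, $|S|$ denotes the unique positive self-adjoint densely defined operator with $|S|^2=S^*S$. *)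

theory Defs
  imports "HOL-Analysis.Analysis"
begin

section \<open>Quaternions\<close>

datatype quat = Quat (qRe: real) (qIm1: real) (qIm2: real) (qIm3: real)

lemma quat_eq_iff:
  "p = q \<longleftrightarrow> qRe p = qRe q \<and> qIm1 p = qIm1 q \<and> qIm2 p = qIm2 q \<and> qIm3 p = qIm3 q"
  by (cases p; cases q) auto

instantiation quat :: real_algebra_1
begin

definition zero_quat where "0 = Quat 0 0 0 0"
definition one_quat where "1 = Quat 1 0 0 0"
definition plus_quat where
  "p + q = Quat (qRe p + qRe q) (qIm1 p + qIm1 q) (qIm2 p + qIm2 q) (qIm3 p + qIm3 q)"
definition minus_quat where
  "p - q = Quat (qRe p - qRe q) (qIm1 p - qIm1 q) (qIm2 p - qIm2 q) (qIm3 p - qIm3 q)"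
definition uminus_quat where
  "- q = Quat (- qRe q) (- qIm1 q) (- qIm2 q) (- qIm3 q)"
definition scaleR_quat where
  "r *\<^sub>R q = Quat (r * qRe q) (r * qIm1 q) (r * qIm2 q) (r * qIm3 q)"
definition times_quat where
  "p * q = Quat
     (qRe p * qRe q - qIm1 p * qIm1 q - qIm2 p * qIm2 q - qIm3 p * qIm3 q)
     (qRe p * qIm1 q + qIm1 p * qRe q + qIm2 p * qIm3 q - qIm3 p * qIm2 q)
     (qRe p * qIm2 q - qIm1 p * qIm3 q + qIm2 p * qRe q + qIm3 p * qIm1 q)
     (qRe p * qIm3 q + qIm1 p * qIm2 q - qIm2 p * qIm1 q + qIm3 p * qRe q)"

instance
  by standard
    (auto simp: quat_eq_iff zero_quat_def one_quat_def plus_quat_def minus_quat_def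
      uminus_quat_def scaleR_quat_def times_quat_def algebra_simps)

end

definition qcnj :: "quat \<Rightarrow> quat" where
  "qcnj q = Quat (qRe q) (- qIm1 q) (- qIm2 q) (- qIm3 q)"

lemma of_real_quat: "of_real r = Quat r 0 0 0"
  by (simp add: of_real_def scaleR_quat_def one_quat_def)


section \<open>Quaternionic Hilbert spaces\<close>

text \<open>
  The real scalar multiplication underlying \<^class>\<open>banach\<close> is the restriction of the right
  quaternionic one, and the norm of \<^class>\<open>banach\<close> is the one induced by the inner product.
  \<open>of_real ` {0..}\<close> is the half-line $[0,\infty)$ inside the quaternions.
\<close>

class quaternionic_hilbert_space = banach +
  fixes scaleQ :: "'a \<Rightarrow> quat \<Rightarrow> 'a" (infixl "*\<^sub>Q" 75)
    and qinner :: "'a \<Rightarrow> 'a \<Rightarrow> quat"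
  assumes scaleQ_add_left: "(u + v) *\<^sub>Q p = u *\<^sub>Q p + v *\<^sub>Q p"
    and scaleQ_add_right: "u *\<^sub>Q (p + q) = u *\<^sub>Q p + u *\<^sub>Q q"
    and scaleQ_scaleQ: "(u *\<^sub>Q p) *\<^sub>Q q = u *\<^sub>Q (p * q)"
    and scaleQ_one: "u *\<^sub>Q 1 = u"
    and scaleR_scaleQ: "r *\<^sub>R u = u *\<^sub>Q of_real r"
    and qinner_right: "qinner u (v *\<^sub>Q p + w *\<^sub>Q q) = qinner u v * p + qinner u w * q"
    and qinner_commute: "qinner u v = qcnj (qinner v u)"
    and qinner_self_nonneg: "qinner u u \<in> of_real ` {0..}"
    and norm_eq_sqrt_qinner: "norm u = sqrt (qRe (qinner u u))"
    and ex_nonzero: "\<exists>u. u \<noteq> 0"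


section \<open>Operators\<close>

text \<open>
  Operators are partial maps, so that equality includes equality of the domains \<^term>\<open>dom T\<close>.
  The composition $TS$ is \<^term>\<open>T \<circ>\<^sub>m S\<close> and the identity operator is \<^const>\<open>Some\<close>.
\<close>

type_synonym 'a oper = "'a \<rightharpoonup> 'a"

definition qsubspace :: "'a::quaternionic_hilbert_space set \<Rightarrow> bool" where
  "qsubspace S \<longleftrightarrow>
     0 \<in> S \<and> (\<forall>u\<in>S. \<forall>v\<in>S. u + v \<in> S) \<and> (\<forall>u\<in>S. \<forall>q. u *\<^sub>Q q \<in> S)"

definition qlinear_oper :: "'a::quaternionic_hilbert_space oper \<Rightarrow> bool" where
  "qlinear_oper T \<longleftrightarrow> qsubspace (dom T) \<and>
     (\<forall>u\<in>dom T. \<forall>v\<in>dom T. the (T (u + v)) = the (T u) + the (T v)) \<and>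
     (\<forall>u\<in>dom T. \<forall>q. the (T (u *\<^sub>Q q)) = the (T u) *\<^sub>Q q)"

definition oper_add :: "'a::quaternionic_hilbert_space oper \<Rightarrow> 'a oper \<Rightarrow> 'a oper"
    (infixl "+\<^sub>o" 65) where
  "T +\<^sub>o S = (\<lambda>u. if u \<in> dom T \<inter> dom S then Some (the (T u) + the (S u)) else None)"

definition oper_diff :: "'a::quaternionic_hilbert_space oper \<Rightarrow> 'a oper \<Rightarrow> 'a oper"
    (infixl "-\<^sub>o" 65) where
  "T -\<^sub>o S = (\<lambda>u. if u \<in> dom T \<inter> dom S then Some (the (T u) - the (S u)) else None)"

definition oper_uminus :: "'a::quaternionic_hilbert_space oper \<Rightarrow> 'a oper"
    ("-\<^sub>o _" [81] 80) where
  "-\<^sub>o T = (\<lambda>u. map_option uminus (T u))"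

definition oper_scale :: "'a::quaternionic_hilbert_space oper \<Rightarrow> real \<Rightarrow> 'a oper"
    (infixl "*\<^sub>o" 70) where
  "T *\<^sub>o r = (\<lambda>u. map_option (\<lambda>x. x *\<^sub>Q of_real r) (T u))"

definition densely_defined :: "'a::quaternionic_hilbert_space oper \<Rightarrow> bool" where
  "densely_defined T \<longleftrightarrow> closure (dom T) = UNIV"

definition closed_oper :: "'a::quaternionic_hilbert_space oper \<Rightarrow> bool" where
  "closed_oper T \<longleftrightarrow> closed (Map.graph T)"

definition closable_oper :: "'a::quaternionic_hilbert_space oper \<Rightarrow> bool" where
  "closable_oper T \<longleftrightarrow> (\<exists>S. Map.graph S = closure (Map.graph T))"

text \<open>Meaningful only if \<^term>\<open>closable_oper T\<close>.\<close>

definition oper_closure :: "'a::quaternionic_hilbert_space oper \<Rightarrow> 'a oper" where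
  "oper_closure T = (THE S. Map.graph S = closure (Map.graph T))"

text \<open>Meaningful only if \<^term>\<open>densely_defined T\<close>, which makes the vector \<open>w\<close> unique.\<close>

definition oper_adjoint :: "'a::quaternionic_hilbert_space oper \<Rightarrow> 'a oper"
    ("_\<^sup>\<star>" [1000] 999) where
  "T\<^sup>\<star> = (\<lambda>u. if \<exists>w. \<forall>v\<in>dom T. qinner u (the (T v)) = qinner w v
             then Some (THE w. \<forall>v\<in>dom T. qinner u (the (T v)) = qinner w v)
             else None)"

definition bounded_oper :: "'a::quaternionic_hilbert_space oper \<Rightarrow> bool" where
  "bounded_oper T \<longleftrightarrow> qlinear_oper T \<and> dom T = UNIV \<and>
     (\<exists>K. \<forall>u. norm (the (T u)) \<le> K * norm u)"

definition normal_oper :: "'a::quaternionic_hilbert_space oper \<Rightarrow> bool" where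
  "normal_oper T \<longleftrightarrow> densely_defined T \<and> T \<circ>\<^sub>m T\<^sup>\<star> = T\<^sup>\<star> \<circ>\<^sub>m T"

definition self_adjoint_oper :: "'a::quaternionic_hilbert_space oper \<Rightarrow> bool" where
  "self_adjoint_oper T \<longleftrightarrow> densely_defined T \<and> T\<^sup>\<star> = T"

definition anti_self_adjoint_oper :: "'a::quaternionic_hilbert_space oper \<Rightarrow> bool" where
  "anti_self_adjoint_oper T \<longleftrightarrow> densely_defined T \<and> T\<^sup>\<star> = -\<^sub>o T"

definition unitary_oper :: "'a::quaternionic_hilbert_space oper \<Rightarrow> bool" where
  "unitary_oper T \<longleftrightarrow> dom T = UNIV \<and> T \<circ>\<^sub>m T\<^sup>\<star> = Some \<and> T\<^sup>\<star> \<circ>\<^sub>m T = Some"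

definition positive_oper :: "'a::quaternionic_hilbert_space oper \<Rightarrow> bool" where
  "positive_oper T \<longleftrightarrow> (\<forall>u\<in>dom T. qinner u (the (T u)) \<in> of_real ` {0..})"

text \<open>Meaningful for closed normal densely defined \<open>S\<close>, where \<open>P\<close> exists and is unique.\<close>

definition oper_abs :: "'a::quaternionic_hilbert_space oper \<Rightarrow> 'a oper" where
  "oper_abs S = (THE P. qlinear_oper P \<and> densely_defined P \<and> positive_oper P \<and>
     self_adjoint_oper P \<and> P \<circ>\<^sub>m P = S\<^sup>\<star> \<circ>\<^sub>m S)"

definition oper_kernel :: "'a::quaternionic_hilbert_space oper \<Rightarrow> 'a set" where
  "oper_kernel T = {u. T u = Some 0}"

definition qorthogonal_complement :: "'a::quaternionic_hilbert_space set \<Rightarrow> 'a set" where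
  "qorthogonal_complement M = {u. \<forall>v\<in>M. qinner u v = 0}"

text \<open>
  Writing $\overline{AB}=\overline{BA}$ presupposes that both products are closable; this is made
  explicit below.
\<close>

definition cartesian_decomposition ::
  "'a::quaternionic_hilbert_space oper \<Rightarrow> 'a oper \<Rightarrow> 'a oper \<Rightarrow> 'a oper \<Rightarrow> bool" where
  "cartesian_decomposition T A B J \<longleftrightarrow>
     qlinear_oper A \<and> qlinear_oper B \<and> bounded_oper J \<and>
     T = A +\<^sub>o (J \<circ>\<^sub>m B) \<and>
     self_adjoint_oper A \<and> positive_oper B \<and> self_adjoint_oper B \<and>
     anti_self_adjoint_oper J \<and> unitary_oper J \<and>
     closable_oper (A \<circ>\<^sub>m B) \<and> closable_oper (B \<circ>\<^sub>m A) \<and>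
     oper_closure (A \<circ>\<^sub>m B) = oper_closure (B \<circ>\<^sub>m A) \<and>
     A \<circ>\<^sub>m J = J \<circ>\<^sub>m A \<and> B \<circ>\<^sub>m J = J \<circ>\<^sub>m B"


section \<open>The quaternions as a one-dimensional quaternionic Hilbert space\<close>

instantiation quat :: real_inner
begin

definition inner_quat where
  "inner p q = qRe p * qRe q + qIm1 p * qIm1 q + qIm2 p * qIm2 q + qIm3 p * qIm3 q"
definition norm_quat where "norm (q::quat) = sqrt (inner q q)"
definition sgn_quat where "sgn (q::quat) = q /\<^sub>R norm q"
definition dist_quat where "dist (p::quat) q = norm (p - q)"
definition uniformity_quat where
  "(uniformity :: (quat \<times> quat) filter) = (INF e\<in>{0 <..}. principal {(x, y). dist x y < e})"
definition open_quat where
  "open (U :: quat set) \<longleftrightarrow> (\<forall>x\<in>U. eventually (\<lambda>(x', y). x' = x \<longrightarrow> y \<in> U) uniformity)"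

instance
proof
  fix p q r :: quat and a :: real
  show "0 \<le> inner p p"
    by (simp add: inner_quat_def)
  show "inner p p = 0 \<longleftrightarrow> p = 0"
  proof
    assume "inner p p = 0"
    then have "(qRe p)\<^sup>2 + (qIm1 p)\<^sup>2 + (qIm2 p)\<^sup>2 + (qIm3 p)\<^sup>2 = 0"
      by (simp add: inner_quat_def power2_eq_square)
    then have "(qRe p)\<^sup>2 = 0" "(qIm1 p)\<^sup>2 = 0" "(qIm2 p)\<^sup>2 = 0" "(qIm3 p)\<^sup>2 = 0"
      using zero_le_power2[of "qRe p"] zero_le_power2[of "qIm1 p"]
        zero_le_power2[of "qIm2 p"] zero_le_power2[of "qIm3 p"] by linarith+
    then show "p = 0"
      by (simp add: quat_eq_iff zero_quat_def)
  qed (simp add: inner_quat_def zero_quat_def)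
qed (auto simp: inner_quat_def sgn_quat_def dist_quat_def norm_quat_def uniformity_quat_def
    open_quat_def plus_quat_def scaleR_quat_def algebra_simps)

end

lemma bounded_linear_quat_components:
  "bounded_linear qRe" "bounded_linear qIm1" "bounded_linear qIm2" "bounded_linear qIm3"
proof -
  have *: "\<bar>t\<bar> \<le> sqrt (t * t + x)" if "0 \<le> x" for t x :: real
    using that real_sqrt_le_mono[of "t\<^sup>2" "t * t + x"] by (simp add: power2_eq_square)
  show "bounded_linear qRe"
    using *[of "qIm1 p * qIm1 p + qIm2 p * qIm2 p + qIm3 p * qIm3 p" "qRe p" for p]
    by (intro bounded_linear_intro[of _ 1])
      (auto simp: plus_quat_def scaleR_quat_def norm_quat_def inner_quat_def add_ac)
  show "bounded_linear qIm1"
    using *[of "qRe p * qRe p + qIm2 p * qIm2 p + qIm3 p * qIm3 p" "qIm1 p" for p]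
    by (intro bounded_linear_intro[of _ 1])
      (auto simp: plus_quat_def scaleR_quat_def norm_quat_def inner_quat_def add_ac)
  show "bounded_linear qIm2"
    using *[of "qRe p * qRe p + qIm1 p * qIm1 p + qIm3 p * qIm3 p" "qIm2 p" for p]
    by (intro bounded_linear_intro[of _ 1])
      (auto simp: plus_quat_def scaleR_quat_def norm_quat_def inner_quat_def add_ac)
  show "bounded_linear qIm3"
    using *[of "qRe p * qRe p + qIm1 p * qIm1 p + qIm2 p * qIm2 p" "qIm3 p" for p]
    by (intro bounded_linear_intro[of _ 1])
      (auto simp: plus_quat_def scaleR_quat_def norm_quat_def inner_quat_def add_ac)
qed

instance quat :: banach
proof
  fix X :: "nat \<Rightarrow> quat"
  assume X: "Cauchy X"
  have expand: "q = qRe q *\<^sub>R Quat 1 0 0 0 + qIm1 q *\<^sub>R Quat 0 1 0 0 +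
      qIm2 q *\<^sub>R Quat 0 0 1 0 + qIm3 q *\<^sub>R Quat 0 0 0 1" for q
    by (simp add: quat_eq_iff plus_quat_def scaleR_quat_def)
  note c = bounded_linear_quat_components[THEN bounded_linear.Cauchy, OF X]
  obtain a b c d where "(\<lambda>n. qRe (X n)) \<longlonglongrightarrow> a" "(\<lambda>n. qIm1 (X n)) \<longlonglongrightarrow> b"
    "(\<lambda>n. qIm2 (X n)) \<longlonglongrightarrow> c" "(\<lambda>n. qIm3 (X n)) \<longlonglongrightarrow> d"
    using c[THEN Cauchy_convergent] unfolding convergent_def by blast
  then have "(\<lambda>n. qRe (X n) *\<^sub>R Quat 1 0 0 0 + qIm1 (X n) *\<^sub>R Quat 0 1 0 0 +
      qIm2 (X n) *\<^sub>R Quat 0 0 1 0 + qIm3 (X n) *\<^sub>R Quat 0 0 0 1)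
    \<longlonglongrightarrow> a *\<^sub>R Quat 1 0 0 0 + b *\<^sub>R Quat 0 1 0 0 + c *\<^sub>R Quat 0 0 1 0 + d *\<^sub>R Quat 0 0 0 1"
    by (intro tendsto_intros)
  then show "convergent X"
    unfolding convergent_def expand[symmetric] by blast
qed

instantiation quat :: quaternionic_hilbert_space
begin

definition scaleQ_quat where "scaleQ (u::quat) p = u * p"
definition qinner_quat where "qinner (u::quat) v = qcnj u * v"

instance
proof
  fix u :: quat
  have "qinner u u = of_real (inner u u)"
    by (simp add: quat_eq_iff qinner_quat_def qcnj_def times_quat_def of_real_quat inner_quat_def)
  then show "qinner u u \<in> of_real ` {0..}" "norm u = sqrt (qRe (qinner u u))"
    by (auto simp: norm_quat_def of_real_quat)
  show "\<exists>u::quat. u \<noteq> 0"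
    by (rule exI[of _ 1]) simp
qed (auto simp: quat_eq_iff scaleQ_quat_def qinner_quat_def qcnj_def times_quat_def
    plus_quat_def of_real_quat scaleR_quat_def one_quat_def algebra_simps)

end

end

(* With R = (1 + T*T)^-1, the operators R, N = TR and N' = T*R are bounded and commute, and T is
   R^-1 N and T* is R^-1 N' with their natural domains. Such quotients inherit everything from
   their numerators, because the polynomials R (1 + C + ... + C^(2n-1)) with C = 1 - R tend strongly
   to the identity; in particular they are self-adjoint if N is symmetric. So A = R^-1 a and
   B = R^-1 b, where a = (N + N')/2 and j b is the polar decomposition of (N - N')/2. On the kernel
   of b, the unit j is the left multiplication by i belonging to a maximal real subspace that is
   invariant under R and a and on which the inner product is real.
   For uniqueness, any decomposition satisfies T* = A' - J'B' on D(T), which gives A' = A and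
   J'B' = JB, hence B'B' = BB, and positive square roots are unique. *)
theory Submission
  imports Defs
begin

section \<open>Bounded operators on a real Hilbert space\<close>

text \<open>The space is treated as a real Hilbert space under the real part \<open>rin\<close> of
  \<open>qinner\<close>. A bounded real linear map is right linear iff it commutes with every
  \<open>u \<mapsto> u *\<^sub>Q q\<close>, so constructions that carry commutation along yield
  right linear maps with no quaternionic argument of their own. Bounded numerators over a fixed
  injective denominator turn a question about domains into an equation \<open>N u = R w\<close>, and
  both sides can be smoothed by polynomials in \<open>R\<close>. The obstacle is the kernel of b,
  where the polar decomposition says nothing about j. The map u \<mapsto> u i is not right linear,
  and a left multiplication by i depends on the choice of a real subspace; it commutes with R and a
  only if that subspace is invariant under both. Eigenvectors may be missing, so the subspace comes
  from Zorn's lemma. Adjoining a vector then means adjoining its whole orbit under a commutative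
  algebra of symmetric maps, and it is symmetry and commutativity that keep the inner product real
  on the orbit.\<close>

definition commutes :: "('b \<Rightarrow> 'b) \<Rightarrow> ('b \<Rightarrow> 'b) \<Rightarrow> bool" where
  "commutes f g \<longleftrightarrow> (\<forall>x. f (g x) = g (f x))"

lemma commutesD: "commutes f g \<Longrightarrow> f (g x) = g (f x)"
  by (simp add: commutes_def)

lemma commutes_sym: "commutes f g \<Longrightarrow> commutes g f"
  by (simp add: commutes_def)

section \<open>Geometry of a real Hilbert space\<close>

locale real_hilbert =
  fixes ip :: "'b::banach \<Rightarrow> 'b \<Rightarrow> real" (infixl "\<odot>" 70)
  assumes ip_add_left: "(x + y) \<odot> z = x \<odot> z + y \<odot> z"
    and ip_scaleR_left: "(r *\<^sub>R x) \<odot> y = r * (x \<odot> y)"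
    and ip_commute: "x \<odot> y = y \<odot> x"
    and ip_self: "x \<odot> x = (norm x)\<^sup>2"
begin

lemma ip_add_right: "x \<odot> (y + z) = x \<odot> y + x \<odot> z"
  by (metis ip_add_left ip_commute)

lemma ip_scaleR_right: "x \<odot> (r *\<^sub>R y) = r * (x \<odot> y)"
  by (metis ip_scaleR_left ip_commute)

lemma ip_diff_left: "(x - y) \<odot> z = x \<odot> z - y \<odot> z"
  using ip_add_left[of "x - y" y z] by simp

lemma ip_diff_right: "x \<odot> (y - z) = x \<odot> y - x \<odot> z"
  by (metis ip_diff_left ip_commute)

lemma cauchy_schwarz: "\<bar>x \<odot> y\<bar> \<le> norm x * norm y"
proof (cases "y = 0")
  case True
  then show ?thesis
    using ip_scaleR_right[of x 0 0] by simp
next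
  case False
  let ?c = "(norm y)\<^sup>2" and ?s = "x \<odot> y"
  \<comment> \<open>Up to the factor \<open>?c\<close> this vector is the residual of
    \<open>x\<close> after projection onto the line of \<open>y\<close>; the scaling avoids a
    division.\<close>
  have "0 \<le> (?c *\<^sub>R x - ?s *\<^sub>R y) \<odot> (?c *\<^sub>R x - ?s *\<^sub>R y)"
    by (simp add: ip_self)
  also have "\<dots> = ?c * ?c * (x \<odot> x) - ?c * ?s * ?s - ?s * ?c * (y \<odot> x) + ?s * ?s * (y \<odot> y)"
    by (simp add: ip_diff_left ip_diff_right ip_scaleR_left ip_scaleR_right algebra_simps)
  also have "\<dots> = ?c * ((norm x * norm y)\<^sup>2 - ?s\<^sup>2)"
    by (simp add: ip_self ip_commute[of y x] power2_eq_square algebra_simps)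
  finally have "?s\<^sup>2 \<le> (norm x * norm y)\<^sup>2"
    using False by (simp add: zero_le_mult_iff)
  then show ?thesis
    by (metis abs_le_square_iff abs_mult abs_norm_cancel)
qed

sublocale ip: bounded_bilinear ip
proof
  show "\<exists>K. \<forall>a b. norm (a \<odot> b) \<le> norm a * norm b * K"
    using cauchy_schwarz by (intro exI[of _ 1]) simp
qed (auto simp: ip_add_left ip_add_right ip_scaleR_left ip_scaleR_right)

lemmas ip_simps = ip.add_left ip.add_right ip.diff_left ip.diff_right ip_scaleR_left
  ip_scaleR_right ip.minus_left ip.minus_right

lemma norm_diff_square: "(norm (x - y))\<^sup>2 = (norm x)\<^sup>2 - 2 * (x \<odot> y) + (norm y)\<^sup>2"
  by (simp add: ip_self[symmetric] ip_simps ip_commute[of y x])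

lemma norm_add_square: "(norm (x + y))\<^sup>2 = (norm x)\<^sup>2 + 2 * (x \<odot> y) + (norm y)\<^sup>2"
  by (simp add: ip_self[symmetric] ip_simps ip_commute[of y x])

lemma ip_eq_0D: "(\<And>y. x \<odot> y = 0) \<Longrightarrow> x = 0"
  using ip_self[of x] by simp

lemma ip_eqD: "(\<And>y. x \<odot> y = z \<odot> y) \<Longrightarrow> x = z"
  using ip_eq_0D[of "x - z"] by (simp add: ip_simps)

text \<open>First-order condition at a minimum: the term linear in \<open>t\<close> must vanish. The
  choice t = c/(k+1) shows it; the added 1 keeps the denominator positive when k = 0.\<close>

lemma linear_le_square_imp_zero:
  fixes c k :: real
  assumes "\<And>t. 2 * t * c \<le> t\<^sup>2 * k" and "0 \<le> k"
  shows "c = 0"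
proof -
  have "2 * (c / (k + 1)) * c \<le> (c / (k + 1))\<^sup>2 * k"
    using assms(1) .
  also have "\<dots> \<le> (c / (k + 1))\<^sup>2 * (k + 1)"
    by (simp add: mult_left_mono)
  also have "\<dots> = (c / (k + 1)) * c"
    using \<open>0 \<le> k\<close> by (simp add: power2_eq_square)
  finally have "c * c / (k + 1) \<le> 0"
    by simp
  then show ?thesis
    using \<open>0 \<le> k\<close> by (simp add: divide_le_0_iff) (metis mult_eq_0_iff order_antisym zero_le_square)
qed

text \<open>A minimizing sequence is Cauchy by the parallelogram law, because midpoints stay in
  \<open>V\<close>; varying its limit along \<open>w\<close> then gives orthogonality.\<close>

theorem projection:
  assumes "subspace V" and "closed V"
  shows "\<exists>y\<in>V. \<forall>v\<in>V. (x - y) \<odot> v = 0"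
proof -
  define \<delta> where "\<delta> = (INF v\<in>V. (norm (x - v))\<^sup>2)"
  have "V \<noteq> {}"
    using subspace_0[OF \<open>subspace V\<close>] by blast
  have bdd: "bdd_below ((\<lambda>v. (norm (x - v))\<^sup>2) ` V)"
    by (rule bdd_belowI[of _ 0]) auto
  have \<delta>_le: "\<delta> \<le> (norm (x - v))\<^sup>2" if "v \<in> V" for v
    unfolding \<delta>_def using bdd that by (rule cINF_lower)
  have "\<exists>v\<in>V. (norm (x - v))\<^sup>2 < \<delta> + inverse (real (Suc n))" for n
    using cINF_less_iff[OF \<open>V \<noteq> {}\<close> bdd, of "\<delta> + inverse (real (Suc n))"]
    unfolding \<delta>_def by simp
  then obtain v where v: "v n \<in> V" "(norm (x - v n))\<^sup>2 < \<delta> + inverse (real (Suc n))" for n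
    by metis
  have par: "(norm (v n - v m))\<^sup>2 \<le> 2 * inverse (real (Suc n)) + 2 * inverse (real (Suc m))" for n m
  proof -
    have "(1/2) *\<^sub>R (v n + v m) \<in> V"
      using v(1) \<open>subspace V\<close> by (intro subspace_scale subspace_add)
    then have "4 * \<delta> \<le> 4 * (norm (x - (1/2) *\<^sub>R (v n + v m)))\<^sup>2"
      using \<delta>_le by simp
    also have "\<dots> = (norm ((x - v n) + (x - v m)))\<^sup>2"
      by (simp add: ip_self[symmetric] ip_simps algebra_simps)
    also have "\<dots> = 2 * (norm (x - v n))\<^sup>2 + 2 * (norm (x - v m))\<^sup>2 - (norm ((x - v m) - (x - v n)))\<^sup>2"
      by (simp only: norm_diff_square[of "x - v m" "x - v n"] norm_add_square[of "x - v n" "x - v m"]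
          ip_commute[of "x - v m" "x - v n"])
    finally show ?thesis
      using v(2)[of n] v(2)[of m] by simp
  qed
  have "Cauchy v"
  proof (rule metric_CauchyI)
    fix e :: real
    assume "e > 0"
    then obtain N where N: "inverse (real (Suc N)) < e\<^sup>2 / 4"
      using reals_Archimedean[of "e\<^sup>2/4"] by auto
    have "dist (v m) (v n) < e" if "m \<ge> N" "n \<ge> N" for m n
    proof -
      have "inverse (real (Suc m)) \<le> inverse (real (Suc N))" "inverse (real (Suc n)) \<le> inverse (real (Suc N))"
        using that by (auto intro!: le_imp_inverse_le)
      then have "(norm (v m - v n))\<^sup>2 < e\<^sup>2"
        using par[of m n] N by linarith
      then show ?thesis
        using \<open>e > 0\<close> by (simp add: dist_norm power2_less_imp_less)
    qed
    then show "\<exists>M. \<forall>m\<ge>M. \<forall>n\<ge>M. dist (v m) (v n) < e"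
      by blast
  qed
  then obtain y where y: "v \<longlonglongrightarrow> y"
    using Cauchy_convergent_iff convergent_def by blast
  have "y \<in> V"
    using \<open>closed V\<close> v(1) y closed_sequentially by blast
  have "(\<lambda>n. (norm (x - v n))\<^sup>2) \<longlonglongrightarrow> (norm (x - y))\<^sup>2"
    by (intro tendsto_intros y)
  moreover have "(\<lambda>n. \<delta> + inverse (real (Suc n))) \<longlonglongrightarrow> \<delta> + 0"
    by (intro tendsto_intros LIMSEQ_inverse_real_of_nat)
  ultimately have y_le: "(norm (x - y))\<^sup>2 \<le> \<delta>"
    using v(2) less_imp_le by (intro LIMSEQ_le[of _ _ "\<lambda>n. \<delta> + inverse (real (Suc n))"]) auto
  have "(x - y) \<odot> w = 0" if "w \<in> V" for w
  proof (rule linear_le_square_imp_zero)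
    fix t :: real
    have "y + t *\<^sub>R w \<in> V"
      using that \<open>y \<in> V\<close> \<open>subspace V\<close> by (intro subspace_scale subspace_add)
    then have "(norm (x - y))\<^sup>2 \<le> (norm ((x - y) - t *\<^sub>R w))\<^sup>2"
      using \<delta>_le y_le by (metis diff_diff_eq order_trans)
    then show "2 * t * ((x - y) \<odot> w) \<le> t\<^sup>2 * (norm w)\<^sup>2"
      by (simp add: norm_diff_square ip_simps power_mult_distrib)
  qed simp
  then show ?thesis
    using \<open>y \<in> V\<close> by blast
qed

section \<open>Symmetric and skew maps, orthogonal projections\<close>

definition symmetric :: "('b \<Rightarrow> 'b) \<Rightarrow> bool" where
  "symmetric f \<longleftrightarrow> (\<forall>x y. f x \<odot> y = x \<odot> f y)"

definition skew :: "('b \<Rightarrow> 'b) \<Rightarrow> bool" where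
  "skew f \<longleftrightarrow> (\<forall>x y. f x \<odot> y = - (x \<odot> f y))"

lemma symmetricD: "symmetric f \<Longrightarrow> f x \<odot> y = x \<odot> f y"
  by (simp add: symmetric_def)

lemma skewD: "skew f \<Longrightarrow> f x \<odot> y = - (x \<odot> f y)"
  by (simp add: skew_def)

text \<open>A zero of a nonnegative quadratic form is a minimum, so the derivative of the form
  vanishes there in every direction.\<close>

lemma nonneg_symmetric_eq_0:
  assumes "linear p" and "symmetric p" and nonneg: "\<And>x. 0 \<le> x \<odot> p x" and "w \<odot> p w = 0"
  shows "p w = 0"
proof (rule ip_eq_0D)
  fix v
  have "- (p w \<odot> v) = 0"
  proof (rule linear_le_square_imp_zero)
    fix t :: real
    have "0 \<le> (w + t *\<^sub>R v) \<odot> p (w + t *\<^sub>R v)"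
      by (rule nonneg)
    also have "\<dots> = 2 * t * (p w \<odot> v) + t\<^sup>2 * (v \<odot> p v)"
      using \<open>w \<odot> p w = 0\<close> symmetricD[OF \<open>symmetric p\<close>, of w v]
      by (simp add: linear_add[OF \<open>linear p\<close>] linear_scale[OF \<open>linear p\<close>] ip_simps
          ip_commute[of v "p w"] power2_eq_square algebra_simps)
    finally show "2 * t * - (p w \<odot> v) \<le> t\<^sup>2 * (v \<odot> p v)"
      by simp
  qed (rule nonneg)
  then show "p w \<odot> v = 0"
    by simp
qed

text \<open>The last clause, uniqueness of the foot of the perpendicular, reduces each identity for
  \<open>p\<close> to inner products against \<open>V\<close>; additivity and homogeneity of
  \<open>p\<close> are obtained from it.\<close>

theorem orthogonal_projection:
  assumes "subspace V" and "closed V"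
  obtains p where "bounded_linear p" "symmetric p" "\<And>x. p x \<in> V" "\<And>x. x \<in> V \<Longrightarrow> p x = x"
    "\<And>x v. v \<in> V \<Longrightarrow> p x \<odot> v = x \<odot> v"
    "\<And>x y. y \<in> V \<Longrightarrow> \<forall>v\<in>V. y \<odot> v = x \<odot> v \<Longrightarrow> p x = y"
proof -
  obtain p where p: "p x \<in> V" "\<And>v. v \<in> V \<Longrightarrow> (x - p x) \<odot> v = 0" for x
    using projection[OF assms] by metis
  have ip_p: "p x \<odot> v = x \<odot> v" if "v \<in> V" for x v
    using p(2)[OF that, of x] by (simp add: ip_simps)
  have unique: "p x = y" if "y \<in> V" "\<forall>v\<in>V. y \<odot> v = x \<odot> v" for x y
  proof -
    have "p x - y \<in> V"
      using p(1) that(1) assms(1) by (simp add: subspace_diff)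
    then have "(p x - y) \<odot> (p x - y) = 0"
      using that(2) ip_p by (simp add: ip.diff_left)
    then show ?thesis
      by (simp add: ip_self)
  qed
  have "bounded_linear p"
  proof (rule bounded_linear_intro[of _ 1])
    show "p (x + y) = p x + p y" for x y
      by (rule unique) (auto simp: p(1) ip_p ip_simps assms(1) subspace_add)
    show "p (r *\<^sub>R x) = r *\<^sub>R p x" for r x
      by (rule unique) (auto simp: p(1) ip_p ip_simps assms(1) subspace_scale)
    show "norm (p x) \<le> norm x * 1" for x
    proof -
      have "(norm (p x))\<^sup>2 = x \<odot> p x"
        using ip_p[OF p(1)] by (simp add: ip_self[symmetric])
      also have "\<dots> \<le> norm x * norm (p x)"
        using cauchy_schwarz[of x "p x"] by linarith
      finally show ?thesis
        by (cases "p x = 0") (auto simp: power2_eq_square)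
    qed
  qed
  moreover have "symmetric p"
    unfolding symmetric_def by (metis ip_p p(1) ip_commute)
  ultimately show thesis
    using that p(1) ip_p unique by (metis (no_types, lifting))
qed

text \<open>For symmetric \<open>f\<close>, invariance of \<open>V\<close> passes to the orthogonal
  complement, so \<open>f\<close> respects the splitting.\<close>

lemma orthogonal_projection_commutes:
  assumes "subspace V" and "symmetric p" "\<And>x. p x \<in> V"
    and p_unique: "\<And>x y. y \<in> V \<Longrightarrow> \<forall>v\<in>V. y \<odot> v = x \<odot> v \<Longrightarrow> p x = y"
    and ip_p: "\<And>x v. v \<in> V \<Longrightarrow> p x \<odot> v = x \<odot> v"
    and "symmetric f" and "\<And>v. v \<in> V \<Longrightarrow> f v \<in> V"
  shows "commutes f p"
  unfolding commutes_def
proof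
  fix x
  have "f (p x) \<odot> v = f x \<odot> v" if "v \<in> V" for v
    using ip_p[OF assms(7)[OF that], of x] by (simp add: symmetricD[OF assms(6)])
  then show "f (p x) = p (f x)"
    by (intro p_unique[symmetric] ballI assms)
qed

subsection \<open>The positive square root\<close>

text \<open>The scalar sequence is the special case $X = 1$ of the operator iteration
  $Y_{n+1} = (X + Y_n^2)/2$, which it majorizes.\<close>

primrec sqrt_iter_bound :: "nat \<Rightarrow> real" where
  "sqrt_iter_bound 0 = 0"
| "sqrt_iter_bound (Suc n) = (1 + (sqrt_iter_bound n)\<^sup>2) / 2"

primrec sqrt_iter :: "('b \<Rightarrow>\<^sub>L 'b) \<Rightarrow> nat \<Rightarrow> ('b \<Rightarrow>\<^sub>L 'b)" where
  "sqrt_iter X 0 = 0"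
| "sqrt_iter X (Suc n) = (1/2) *\<^sub>R (X + (sqrt_iter X n o\<^sub>L sqrt_iter X n))"

section \<open>Convergence of the square root iteration\<close>

lemma sqrt_iter_bound_range: "0 \<le> sqrt_iter_bound n \<and> sqrt_iter_bound n \<le> 1"
  by (induction n) (auto simp: power_le_one)

lemma incseq_sqrt_iter_bound: "incseq sqrt_iter_bound"
proof (rule incseq_SucI)
  fix n
  have "0 \<le> (1 - sqrt_iter_bound n)\<^sup>2"
    by simp
  then show "sqrt_iter_bound n \<le> sqrt_iter_bound (Suc n)"
    by (simp add: power2_eq_square algebra_simps)
qed

lemma sqrt_iter_commutes:
  assumes "linear f" and "commutes f (blinfun_apply X)"
  shows "commutes f (blinfun_apply (sqrt_iter X n))"
  using assms
  by (induction n)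
    (auto simp: commutes_def blinfun.add_left blinfun.scaleR_left linear_add linear_scale linear_0)

lemma sqrt_iter_norm:
  assumes "norm X \<le> 1"
  shows "norm (sqrt_iter X n) \<le> sqrt_iter_bound n"
proof (induction n)
  case (Suc n)
  have "norm (X + (sqrt_iter X n o\<^sub>L sqrt_iter X n))
      \<le> 1 + norm (sqrt_iter X n) * norm (sqrt_iter X n)"
    using assms norm_blinfun_compose[of "sqrt_iter X n" "sqrt_iter X n"]
    by (intro order_trans[OF norm_triangle_ineq] add_mono) auto
  also have "\<dots> \<le> 1 + (sqrt_iter_bound n)\<^sup>2"
    using Suc by (simp add: power2_eq_square mult_mono')
  finally show ?case
    by simp
qed simp

text \<open>Successive iterates commute, so the difference of their squares factors as (Y + Z)(Y -
  Z). The scalar recursion satisfies the same factorization as an equality, which makes it a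
  majorant.\<close>

lemma sqrt_iter_diff_Suc:
  assumes "norm X \<le> 1"
  shows "norm (sqrt_iter X (Suc n) - sqrt_iter X n) \<le> sqrt_iter_bound (Suc n) - sqrt_iter_bound n"
proof (induction n)
  case 0
  then show ?case
    using assms by simp
next
  case (Suc n)
  let ?Y = "sqrt_iter X (Suc n)" and ?Z = "sqrt_iter X n"
  let ?y = "sqrt_iter_bound (Suc n)" and ?z = "sqrt_iter_bound n"
  have "commutes (sqrt_iter X m) X" for m
    by (rule commutes_sym, rule sqrt_iter_commutes)
      (auto simp: bounded_linear.linear[OF blinfun.bounded_linear_right] commutes_def)
  then have YZ: "?Y o\<^sub>L ?Z = ?Z o\<^sub>L ?Y"
    using sqrt_iter_commutes[of "blinfun_apply ?Y" X n]
    by (intro blinfun_eqI) (simp add: bounded_linear.linear[OF blinfun.bounded_linear_right] commutes_def del: sqrt_iter.simps)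
  have "sqrt_iter X (Suc (Suc n)) - ?Y = (1/2) *\<^sub>R ((?Y o\<^sub>L ?Y) - (?Z o\<^sub>L ?Z))"
    using arg_cong2[OF sqrt_iter.simps(2)[of X "Suc n"] sqrt_iter.simps(2)[of X n], of minus]
    by (simp only: scaleR_diff_right[symmetric] add_diff_cancel_left)
  also have "(?Y o\<^sub>L ?Y) - (?Z o\<^sub>L ?Z) = (?Y + ?Z) o\<^sub>L (?Y - ?Z)"
    by (simp only: bounded_bilinear.add_left[OF bounded_bilinear_blinfun_compose]
        bounded_bilinear.diff_right[OF bounded_bilinear_blinfun_compose] YZ) simp
  finally have "norm (sqrt_iter X (Suc (Suc n)) - ?Y) = (1/2) * norm ((?Y + ?Z) o\<^sub>L (?Y - ?Z))"
    by (simp del: sqrt_iter.simps)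
  also have "\<dots> \<le> (1/2) * (norm (?Y + ?Z) * norm (?Y - ?Z))"
    using norm_blinfun_compose[of "?Y + ?Z" "?Y - ?Z"] by linarith
  also have "\<dots> \<le> (1/2) * ((?y + ?z) * (?y - ?z))"
  proof (intro mult_left_mono mult_mono)
    show "norm (?Y + ?Z) \<le> ?y + ?z"
      using sqrt_iter_norm[OF assms] by (intro norm_triangle_mono)
    show "norm (?Y - ?Z) \<le> ?y - ?z"
      by (rule Suc)
    show "0 \<le> ?y + ?z"
      using sqrt_iter_bound_range[of n] sqrt_iter_bound_range[of "Suc n"] by linarith
  qed auto
  also have "\<dots> = sqrt_iter_bound (Suc (Suc n)) - ?y"
    by (simp only: sqrt_iter_bound.simps(2)[of "Suc n"] sqrt_iter_bound.simps(2)[of n])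
      (simp add: power2_eq_square field_simps)
  finally show ?case .
qed

lemma sqrt_iter_diff:
  assumes "norm X \<le> 1" and "m \<le> n"
  shows "norm (sqrt_iter X n - sqrt_iter X m) \<le> sqrt_iter_bound n - sqrt_iter_bound m"
  using \<open>m \<le> n\<close>
proof (induction rule: dec_induct)
  case (step k)
  have "norm (sqrt_iter X (Suc k) - sqrt_iter X m)
      \<le> norm (sqrt_iter X (Suc k) - sqrt_iter X k) + norm (sqrt_iter X k - sqrt_iter X m)"
    using norm_triangle_ineq[of "sqrt_iter X (Suc k) - sqrt_iter X k" "sqrt_iter X k - sqrt_iter X m"]
    by (simp del: sqrt_iter.simps)
  then show ?case
    using step.IH sqrt_iter_diff_Suc[OF assms(1), of k] by linarith
qed simp

text \<open>The bounded increasing scalar sequence is Cauchy and dominates the operator increments,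
  so the iterates converge in norm.\<close>

lemma convergent_sqrt_iter:
  assumes "norm X \<le> 1"
  shows "convergent (sqrt_iter X)"
proof -
  have "convergent sqrt_iter_bound"
    using incseq_sqrt_iter_bound sqrt_iter_bound_range incseq_convergent[of sqrt_iter_bound 1]
    unfolding convergent_def by metis
  then have cau: "Cauchy sqrt_iter_bound"
    by (rule convergent_Cauchy)
  have "Cauchy (sqrt_iter X)"
  proof (rule metric_CauchyI)
    fix e :: real
    assume "e > 0"
    then obtain M where M: "\<And>m n. m \<ge> M \<Longrightarrow> n \<ge> M \<Longrightarrow> dist (sqrt_iter_bound m) (sqrt_iter_bound n) < e"
      using metric_CauchyD[OF cau] by blast
    have le: "dist (sqrt_iter X m) (sqrt_iter X n) < e" if "m \<ge> n" "n \<ge> M" for m n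
      using sqrt_iter_diff[OF assms \<open>m \<ge> n\<close>] M[of m n] that
      by (simp add: dist_norm)
    have "dist (sqrt_iter X m) (sqrt_iter X n) < e" if "m \<ge> M" "n \<ge> M" for m n
      using le[of m n] le[of n m] that by (cases "m \<ge> n") (auto simp: dist_commute)
    then show "\<exists>M. \<forall>m\<ge>M. \<forall>n\<ge>M. dist (sqrt_iter X m) (sqrt_iter X n) < e"
      by blast
  qed
  then show ?thesis
    by (simp add: Cauchy_convergent_iff)
qed

text \<open>With X = 1 - S the limit Y satisfies 2Y = X + Y^2, that is (1 - Y)^2 = 1 - X = S, and b
  = 1 - Y. The bound on \<open>x - S x\<close> says norm X \<le> 1, which starts the majorization;
  it reappears for b as norm Y \<le> 1, the form in which \<open>approximate_inverse\<close> takes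
  it.\<close>

theorem positive_sqrt:
  assumes S: "bounded_linear S" and "symmetric S" and contr: "\<And>x. norm (x - S x) \<le> norm x"
  obtains b where "bounded_linear b" "symmetric b" "\<And>x. 0 \<le> x \<odot> b x" "\<And>x. b (b x) = S x"
    "\<And>x. norm (x - b x) \<le> norm x"
    "\<And>f. bounded_linear f \<Longrightarrow> commutes f S \<Longrightarrow> commutes f b"
proof -
  define X where "X = Blinfun (\<lambda>x. x - S x)"
  have "bounded_linear (\<lambda>x. x - S x)"
    using S by (intro bounded_linear_sub bounded_linear_ident)
  then have X: "blinfun_apply X = (\<lambda>x. x - S x)"
    unfolding X_def by (rule bounded_linear_Blinfun_apply)
  have nX: "norm X \<le> 1"
    using contr by (intro norm_blinfun_bound) (auto simp: X)
  obtain Y where Y: "sqrt_iter X \<longlonglongrightarrow> Y"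
    using convergent_sqrt_iter[OF nX] by (auto simp: convergent_def)
  have Yx: "(\<lambda>n. sqrt_iter X n x) \<longlonglongrightarrow> Y x" for x
    by (intro tendsto_intros Y)
  have "(\<lambda>n. sqrt_iter X (Suc n)) \<longlonglongrightarrow> (1/2) *\<^sub>R (X + (Y o\<^sub>L Y))"
    unfolding sqrt_iter.simps
    by (intro tendsto_intros bounded_bilinear.tendsto[OF bounded_bilinear_blinfun_compose] Y)
  then have fix_Y: "Y = (1/2) *\<^sub>R (X + (Y o\<^sub>L Y))"
    using LIMSEQ_unique LIMSEQ_Suc[OF Y] by blast
  have "norm (sqrt_iter X n) \<le> 1" for n
    using sqrt_iter_norm[OF nX, of n] sqrt_iter_bound_range[of n] by linarith
  then have nY: "norm Y \<le> 1"
    using Lim_norm_ubound[OF _ Y, of 1] by simp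
  have comm: "commutes f (blinfun_apply Y)" if "bounded_linear f" "commutes f S" for f
  proof -
    have "commutes f X"
      using that(2) linear_diff[OF bounded_linear.linear[OF that(1)]] by (simp add: commutes_def X)
    then have "f (sqrt_iter X n x) = sqrt_iter X n (f x)" for n x
      using sqrt_iter_commutes bounded_linear.linear[OF that(1)] by (simp add: commutes_def)
    moreover have "(\<lambda>n. f (sqrt_iter X n x)) \<longlonglongrightarrow> f (Y x)" for x
      using Yx by (rule bounded_linear.tendsto[OF that(1)])
    ultimately show ?thesis
      using Yx LIMSEQ_unique unfolding commutes_def by fastforce
  qed
  have "symmetric (sqrt_iter X n)" for n
  proof (induction n)
    case (Suc n)
    then show ?case
      using \<open>symmetric S\<close>
      by (simp add: symmetric_def X blinfun.add_left blinfun.scaleR_left ip_simps)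
  qed (simp add: symmetric_def ip.zero_left ip.zero_right)
  then have "symmetric Y"
    using LIMSEQ_unique[OF ip.tendsto[OF Yx tendsto_const]] ip.tendsto[OF tendsto_const Yx]
    by (simp add: symmetric_def)
  have nYx: "norm (Y x) \<le> norm x" for x
    using norm_blinfun[of Y x] nY mult_right_mono[OF nY norm_ge_zero[of x]] by linarith
  show thesis
  proof (rule that[of "\<lambda>x. x - Y x"])
    show "bounded_linear (\<lambda>x. x - Y x)"
      by (intro bounded_linear_sub bounded_linear_ident blinfun.bounded_linear_right)
    show "symmetric (\<lambda>x. x - Y x)"
      using \<open>symmetric Y\<close> by (simp add: symmetric_def ip_simps)
    show "0 \<le> x \<odot> (x - Y x)" for x
    proof -
      have "x \<odot> Y x \<le> norm x * norm x"
        using cauchy_schwarz[of x "Y x"] mult_left_mono[OF nYx[of x] norm_ge_zero[of x]] by linarith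
      then show ?thesis
        by (simp add: ip_simps ip_self power2_eq_square)
    qed
    show "(x - Y x) - Y (x - Y x) = S x" for x
    proof -
      have "Y x = (1/2) *\<^sub>R (X x + Y (Y x))"
        by (subst fix_Y) (simp add: blinfun.add_left blinfun.scaleR_left)
      then have "2 *\<^sub>R Y x = 2 *\<^sub>R ((1/2) *\<^sub>R (X x + Y (Y x)))"
        by (rule arg_cong)
      then have "Y x + Y x = (x - S x) + Y (Y x)"
        by (simp add: X scaleR_2)
      then show ?thesis
        by (simp add: blinfun.diff_right algebra_simps)
    qed
    show "norm (x - (x - Y x)) \<le> norm x" for x
      using nYx by simp
    show "commutes f (\<lambda>x. x - Y x)" if "bounded_linear f" "commutes f S" for f
      using comm[OF that] linear_diff[OF bounded_linear.linear[OF that(1)]] by (simp add: commutes_def)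
  qed
qed

text \<open>Any root commutes with its square \<open>?S\<close>, hence with the root
  \<open>b\<close> built by \<open>positive_sqrt\<close>. So w = r u - b u satisfies (r + b) w = r^2
  u - b^2 u = 0; both nonnegative forms vanish at w, whence r w = b w = 0 and w is orthogonal to
  itself.\<close>

lemma positive_sqrt_unique:
  assumes p: "bounded_linear p" "symmetric p" "\<And>x. 0 \<le> x \<odot> p x" "\<And>x. norm (p x) \<le> norm x"
    and q: "bounded_linear q" "symmetric q" "\<And>x. 0 \<le> x \<odot> q x"
    and pq: "\<And>x. p (p x) = q (q x)"
  shows "p = q"
proof -
  let ?S = "\<lambda>x. p (p x)"
  have S: "bounded_linear ?S"
    using p(1) by (rule bounded_linear_compose) (rule p(1))
  have symS: "symmetric ?S"
    using p(2) by (simp add: symmetric_def)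
  have contr: "norm (x - ?S x) \<le> norm x" for x
  proof (rule power2_le_imp_le)
    have "x \<odot> ?S x = (norm (p x))\<^sup>2"
      using p(2) by (simp add: symmetric_def ip_self[symmetric])
    moreover have "(norm (?S x))\<^sup>2 \<le> (norm (p x))\<^sup>2"
      using p(4) by (simp add: power_mono)
    ultimately show "(norm (x - ?S x))\<^sup>2 \<le> (norm x)\<^sup>2"
      using zero_le_power2[of "norm (p x)"] unfolding norm_diff_square by linarith
  qed simp
  obtain b where b: "bounded_linear b" "symmetric b" "\<And>x. 0 \<le> x \<odot> b x" "\<And>x. b (b x) = ?S x"
    "\<And>x. norm (x - b x) \<le> norm x"
    "\<And>f. bounded_linear f \<Longrightarrow> commutes f ?S \<Longrightarrow> commutes f b"
    by (rule positive_sqrt[OF S symS contr], rule that)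
  have eq_b: "r = b" if r: "bounded_linear r" "symmetric r" "\<And>x. 0 \<le> x \<odot> r x" "\<And>x. r (r x) = ?S x" for r
  proof
    fix u
    interpret r: bounded_linear r by fact
    interpret b: bounded_linear b by fact
    have "commutes r ?S"
      by (simp add: commutes_def r(4)[symmetric])
    then have rb: "r (b x) = b (r x)" for x
      by (intro commutesD b(6) r(1))
    define w where "w = r u - b u"
    have "r w + b w = 0"
      by (simp add: w_def r.diff b.diff r(4) b(4) rb)
    then have "w \<odot> r w + w \<odot> b w = 0"
      by (metis ip.add_right ip.zero_right)
    then have "w \<odot> r w = 0" "w \<odot> b w = 0"
      using r(3)[of w] b(3)[of w] by linarith+
    then have "r w = 0" "b w = 0"
      using nonneg_symmetric_eq_0[OF r.linear_axioms r(2,3)]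
        nonneg_symmetric_eq_0[OF b.linear_axioms b(2,3)] by simp_all
    moreover have "w \<odot> w = u \<odot> r w - u \<odot> b w"
    proof -
      have "w \<odot> w = r u \<odot> w - b u \<odot> w"
        unfolding ip.diff_left[symmetric] by (simp add: w_def)
      then show ?thesis
        by (simp only: symmetricD[OF r(2)] symmetricD[OF b(2)])
    qed
    ultimately show "r u = b u"
      by (simp add: ip_self w_def ip.zero_right)
  qed
  show ?thesis
    using eq_b[OF p(1-3) refl] eq_b[OF q pq[symmetric]] by (rule trans[OF _ sym])
qed

subsection \<open>Approximate inverses and the polar decomposition\<close>

text \<open>Neumann series for b = 1 - C: the identity b G_n x = x - C^(2n) x telescopes. Only even
  powers are used because symmetry of C turns the inner product of C^(2m) x and C^(2n) x into the
  squared norm of C^(m+n) x, which decreases in m + n; this makes the even powers Cauchy.\<close>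

theorem approximate_inverse:
  assumes b: "bounded_linear b" and "symmetric b" and b_le: "\<And>x. norm (b x) \<le> norm x"
    and contr: "\<And>x. norm (x - b x) \<le> norm x"
  obtains G :: "nat \<Rightarrow> 'b \<Rightarrow> 'b" where "\<And>n. bounded_linear (G n)" "\<And>n. symmetric (G n)"
    "\<And>n f. linear f \<Longrightarrow> commutes f b \<Longrightarrow> commutes f (G n)"
    "\<And>x. \<exists>y. b y = 0 \<and> (\<lambda>n. b (G n x)) \<longlonglongrightarrow> x - y"
proof -
  interpret b: bounded_linear b by fact
  define C where "C x = x - b x" for x
  define G where "G n x = (\<Sum>k<2 * n. (C ^^ k) x)" for n :: nat and x
  have C: "bounded_linear C"
    unfolding C_def by (intro bounded_linear_sub bounded_linear_ident b)
  have Ck: "bounded_linear (C ^^ k)" for k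
  proof (induction k)
    case (Suc k)
    then show ?case
      using bounded_linear_compose[OF C] by (simp add: comp_def)
  qed (simp add: id_def bounded_linear_ident)
  have sum_Ck: "b (\<Sum>k<m. (C ^^ k) x) = x - (C ^^ m) x" for m x
    by (induction m) (auto simp: b.zero b.add C_def)
  have sym_Ck: "(C ^^ k) x \<odot> y = x \<odot> (C ^^ k) y" for k x y
  proof (induction k arbitrary: x y)
    case (Suc k)
    have "(C ^^ Suc k) x \<odot> y = (C ^^ k) x \<odot> C y"
      using \<open>symmetric b\<close> by (simp add: C_def symmetric_def ip_simps)
    then show ?case
      by (simp add: Suc funpow_swap1)
  qed simp
  have lim: "\<exists>y. b y = 0 \<and> (\<lambda>n. b (G n x)) \<longlonglongrightarrow> x - y" for x
  proof -
    define c where "c n = (norm ((C ^^ n) x))\<^sup>2" for n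
    have "decseq c"
      using contr by (intro decseq_SucI) (simp add: c_def C_def power_mono)
    moreover have "0 \<le> c n" for n
      by (simp add: c_def)
    ultimately obtain l where l: "c \<longlonglongrightarrow> l"
      using decseq_convergent[of c 0] by metis
    have shift: "(C ^^ i) x \<odot> (C ^^ j) x = x \<odot> (C ^^ (i + j)) x" for i j
      by (simp add: sym_Ck funpow_add)
    have cc: "(C ^^ (2 * m)) x \<odot> (C ^^ (2 * n)) x = c (m + n)" for m n
      by (simp add: c_def ip_self[symmetric] shift) (simp add: mult_2 add_ac)
    have "Cauchy (\<lambda>n. (C ^^ (2 * n)) x)"
    proof (rule metric_CauchyI)
      fix e :: real
      assume "e > 0"
      then obtain M where M: "\<And>k. k \<ge> M \<Longrightarrow> \<bar>c k - l\<bar> < e\<^sup>2 / 4"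
        using LIMSEQ_D[OF l, of "e\<^sup>2 / 4"] by (auto simp: real_norm_def)
      have "dist ((C ^^ (2 * m)) x) ((C ^^ (2 * n)) x) < e" if "m \<ge> M" "n \<ge> M" for m n
      proof -
        have "(norm ((C ^^ (2 * m)) x - (C ^^ (2 * n)) x))\<^sup>2 = c (2 * m) - 2 * c (m + n) + c (2 * n)"
          by (simp add: norm_diff_square cc) (simp add: c_def)
        also have "\<dots> < e\<^sup>2"
          using M[of "2 * m"] M[of "m + n"] M[of "2 * n"] that by linarith
        finally show ?thesis
          using \<open>e > 0\<close> by (simp add: dist_norm power2_less_imp_less)
      qed
      then show "\<exists>M. \<forall>m\<ge>M. \<forall>n\<ge>M. dist ((C ^^ (2 * m)) x) ((C ^^ (2 * n)) x) < e"
        by blast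
    qed
    then obtain y where y: "(\<lambda>n. (C ^^ (2 * n)) x) \<longlonglongrightarrow> y"
      using Cauchy_convergent_iff convergent_def by blast
    have "(\<lambda>n. C (C ((C ^^ (2 * n)) x))) \<longlonglongrightarrow> C (C y)"
      by (intro bounded_linear.tendsto[OF C] y)
    moreover have "(\<lambda>n. C (C ((C ^^ (2 * n)) x))) \<longlonglongrightarrow> y"
      using LIMSEQ_Suc[OF y] by simp
    ultimately have "C (C y) = y"
      by (rule LIMSEQ_unique)
    \<comment> \<open>The limit is fixed by C^2, which reads b b y = 2 b y; as b does not increase
      norms, b y = 0.\<close>
    then have "b y + b y = b (b y)"
      by (simp add: C_def b.diff algebra_simps)
    then have "norm (2 *\<^sub>R b y) \<le> norm (b y)"
      using b_le[of "b y"] by (simp add: scaleR_2)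
    then have "b y = 0"
      by simp
    moreover have "(\<lambda>n. b (G n x)) \<longlonglongrightarrow> x - y"
      unfolding G_def sum_Ck by (intro tendsto_intros y)
    ultimately show ?thesis
      by blast
  qed
  show thesis
  proof (rule that[of G])
    show "bounded_linear (G n)" for n
      unfolding G_def by (intro bounded_linear_sum Ck)
    show "symmetric (G n)" for n
      by (simp add: symmetric_def G_def ip.sum_left ip.sum_right sym_Ck)
    show "commutes f (G n)" if "linear f" "commutes f b" for n f
    proof -
      have "f (C x) = C (f x)" for x
        using that by (simp add: C_def linear_diff commutes_def)
      then have "f ((C ^^ k) x) = (C ^^ k) (f x)" for k x
        by (induction k) auto
      then show ?thesis
        by (simp add: commutes_def G_def linear_sum[OF that(1)])
    qed
  qed (rule lim)
qed

text \<open>With b the root of -d^2, the vectors d x and b x have equal norms; hence d G_n x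
  converges together with b G_n x and defines j as a strong limit. What the approximate inverse of b
  leaves over gives the kernel projection P. Commutation with d survives each of these
  limits.\<close>

theorem skew_polar_decomposition:
  assumes d: "bounded_linear d" and "skew d" and d_le: "\<And>x. norm (d x) \<le> norm x"
  obtains b j P where "bounded_linear b" "symmetric b" "\<And>x. 0 \<le> x \<odot> b x"
    "\<And>x. norm (b x) = norm (d x)"
    "bounded_linear j" "skew j" "\<And>x. j (b x) = d x" "\<And>x. j (j x) = P x - x"
    "bounded_linear P" "symmetric P" "\<And>x. d (P x) = 0" "\<And>x. d x = 0 \<Longrightarrow> P x = x"
    "\<And>x. j (P x) = 0" "\<And>x. P (j x) = 0" "\<And>x. x - P x \<in> closure (range b)"
    "\<And>f. bounded_linear f \<Longrightarrow> commutes f d \<Longrightarrow> commutes f b \<and> commutes f j \<and> commutes f P"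
proof -
  interpret d: bounded_linear d by fact
  define S where "S x = - d (d x)" for x
  have S: "bounded_linear S"
    unfolding S_def by (intro bounded_linear_minus bounded_linear_compose[OF d d])
  have ip_S: "x \<odot> S y = d x \<odot> d y" for x y
    using \<open>skew d\<close> by (simp add: S_def skew_def ip_simps)
  have symS: "symmetric S"
    unfolding symmetric_def by (metis ip_S ip_commute)
  have contr: "norm (x - S x) \<le> norm x" for x
  proof (rule power2_le_imp_le)
    have "x \<odot> S x = (norm (d x))\<^sup>2"
      by (simp add: ip_S ip_self)
    moreover have "(norm (S x))\<^sup>2 \<le> (norm (d x))\<^sup>2"
      using d_le[of "d x"] by (simp add: S_def power_mono)
    ultimately show "(norm (x - S x))\<^sup>2 \<le> (norm x)\<^sup>2"
      using zero_le_power2[of "norm (d x)"] unfolding norm_diff_square by linarith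
  qed simp
  obtain b where b: "bounded_linear b" "symmetric b" "\<And>x. 0 \<le> x \<odot> b x" "\<And>x. b (b x) = S x"
    "\<And>x. norm (x - b x) \<le> norm x"
    "\<And>f. bounded_linear f \<Longrightarrow> commutes f S \<Longrightarrow> commutes f b"
    by (rule positive_sqrt[OF S symS contr], rule that)
  interpret b: bounded_linear b by fact
  have norm_b: "norm (b x) = norm (d x)" for x
  proof -
    have "(norm (b x))\<^sup>2 = (norm (d x))\<^sup>2"
      by (simp only: ip_self[symmetric] symmetricD[OF b(2)] b(4) ip_S)
    then show ?thesis
      by simp
  qed
  have b_0: "b x = 0 \<longleftrightarrow> d x = 0" for x
    using norm_b[of x] by (metis norm_eq_zero)
  have b_le: "norm (b x) \<le> norm x" for x
    by (simp add: norm_b d_le)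
  obtain G where G: "\<And>n. bounded_linear (G n)" "\<And>n. symmetric (G n)"
    "\<And>n f. linear f \<Longrightarrow> commutes f b \<Longrightarrow> commutes f (G n)"
    "\<And>x. \<exists>y. b y = 0 \<and> (\<lambda>n. b (G n x)) \<longlonglongrightarrow> x - y"
    by (rule approximate_inverse[OF b(1,2) b_le b(5)], rule that)
  obtain P where P: "b (P x) = 0" "(\<lambda>n. b (G n x)) \<longlonglongrightarrow> x - P x" for x
    using G(4) by metis
  have comm_b: "commutes f b" if "bounded_linear f" "commutes f d" for f
    using that linear_neg[OF bounded_linear.linear[OF that(1)]]
    by (intro b(6)) (auto simp: commutes_def S_def)
  have comm_G: "f (G n x) = G n (f x)" if "bounded_linear f" "commutes f d" for f n x
    using G(3)[OF bounded_linear.linear] comm_b that by (auto simp: commutes_def)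
  have comm_dd: "commutes d d"
    by (simp add: commutes_def)
  have comm_bd: "commutes b d"
    by (intro commutes_sym[of d b] comm_b d comm_dd)
  have bG: "b (G n x) = G n (b x)" for n x
    by (intro comm_G b(1) comm_bd)
  have dG: "d (G n x) = G n (d x)" for n x
    by (intro comm_G d comm_dd)
  have G0: "G n 0 = 0" for n
    using G(1) by (rule bounded_linear.linear[THEN linear_0])
  have P_id: "P x = x" if "d x = 0" for x
  proof -
    have "b x = 0"
      using that by (simp add: b_0)
    then have "(\<lambda>n. 0) \<longlonglongrightarrow> x - P x"
      using P(2)[of x] by (simp add: bG G0)
    then show ?thesis
      using LIMSEQ_unique[OF tendsto_const] by fastforce
  qed
  have dP: "d (P x) = 0" for x
    using P(1) by (simp add: b_0)
  have P_eqI: "P x = y" if "(\<lambda>n. b (G n x)) \<longlonglongrightarrow> x - y" for x y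
    using LIMSEQ_unique[OF that P(2)] by simp
  have sym_P: "symmetric P"
    unfolding symmetric_def
  proof (intro allI)
    fix x y
    have "(\<lambda>n. b (G n x) \<odot> y) \<longlonglongrightarrow> (x - P x) \<odot> y"
      by (intro ip.tendsto P(2) tendsto_const)
    moreover have "(\<lambda>n. b (G n x) \<odot> y) \<longlonglongrightarrow> x \<odot> (y - P y)"
      unfolding symmetricD[OF b(2)] symmetricD[OF G(2)] bG[symmetric]
      by (intro ip.tendsto P(2) tendsto_const)
    ultimately have "(x - P x) \<odot> y = x \<odot> (y - P y)"
      by (rule LIMSEQ_unique)
    then show "P x \<odot> y = x \<odot> P y"
      by (simp add: ip_simps)
  qed
  have norm_P: "norm (P x) \<le> norm x" for x
  proof -
    have "(norm (P x))\<^sup>2 = x \<odot> P x"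
      using symmetricD[OF sym_P, of x "P x"] P_id[OF dP] by (simp add: ip_self[symmetric])
    also have "\<dots> \<le> norm x * norm (P x)"
      using cauchy_schwarz[of x "P x"] by linarith
    finally show ?thesis
      by (cases "P x = 0") (auto simp: power2_eq_square)
  qed
  have P_lin: "bounded_linear P"
  proof (rule bounded_linear_intro[of _ 1])
    fix x y :: 'b and r :: real
    have "(\<lambda>n. b (G n x) + b (G n y)) \<longlonglongrightarrow> (x - P x) + (y - P y)"
      by (intro tendsto_intros P(2))
    then show "P (x + y) = P x + P y"
      by (intro P_eqI)
        (simp add: b.add[symmetric] linear_add[OF bounded_linear.linear[OF G(1)]] algebra_simps)
    have "(\<lambda>n. r *\<^sub>R b (G n x)) \<longlonglongrightarrow> r *\<^sub>R (x - P x)"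
      by (intro tendsto_intros P(2))
    then show "P (r *\<^sub>R x) = r *\<^sub>R P x"
      by (intro P_eqI)
        (simp add: b.scaleR[symmetric] linear_scale[OF bounded_linear.linear[OF G(1)]]
          scaleR_diff_right)
    show "norm (P x) \<le> norm x * 1"
      by (simp add: norm_P)
  qed
  have comm_P: "commutes f P" if f: "bounded_linear f" "commutes f d" for f
    unfolding commutes_def
  proof
    fix x
    have "(\<lambda>n. f (b (G n x))) \<longlonglongrightarrow> f (x - P x)"
      by (intro bounded_linear.tendsto[OF f(1)] P(2))
    moreover have "f (b (G n x)) = b (G n (f x))" for n
      using comm_b[OF f] comm_G[OF f] by (simp add: commutes_def)
    ultimately have "P (f x) = f (P x)"
      by (intro P_eqI) (simp add: linear_diff[OF bounded_linear.linear[OF f(1)]])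
    then show "f (P x) = P (f x)"
      by simp
  qed
  have "convergent (\<lambda>n. d (G n x))" for x
  proof -
    have "dist (d (G m x)) (d (G n x)) = dist (b (G m x)) (b (G n x))" for m n
      by (simp add: dist_norm d.diff[symmetric] b.diff[symmetric] norm_b)
    moreover have "Cauchy (\<lambda>n. b (G n x))"
      using P(2) by (rule LIMSEQ_imp_Cauchy)
    ultimately have "Cauchy (\<lambda>n. d (G n x))"
      by (simp add: Cauchy_def)
    then show ?thesis
      by (simp add: Cauchy_convergent_iff)
  qed
  then obtain j where j: "(\<lambda>n. d (G n x)) \<longlonglongrightarrow> j x" for x
    unfolding convergent_def by metis
  have j_eqI: "j x = y" if "(\<lambda>n. d (G n x)) \<longlonglongrightarrow> y" for x y
    using LIMSEQ_unique[OF j that] .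
  have norm_j: "norm (j x) = norm (x - P x)" for x
  proof (rule LIMSEQ_unique)
    show "(\<lambda>n. norm (d (G n x))) \<longlonglongrightarrow> norm (j x)"
      by (intro tendsto_norm j)
    show "(\<lambda>n. norm (d (G n x))) \<longlonglongrightarrow> norm (x - P x)"
      unfolding norm_b[symmetric] by (intro tendsto_norm P(2))
  qed
  have j_lin: "bounded_linear j"
  proof (rule bounded_linear_intro[of _ 2])
    fix x y :: 'b and r :: real
    have "(\<lambda>n. d (G n x) + d (G n y)) \<longlonglongrightarrow> j x + j y"
      by (intro tendsto_intros j)
    then show "j (x + y) = j x + j y"
      by (intro j_eqI) (simp add: d.add[symmetric] linear_add[OF bounded_linear.linear[OF G(1)]])
    have "(\<lambda>n. r *\<^sub>R d (G n x)) \<longlonglongrightarrow> r *\<^sub>R j x"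
      by (intro tendsto_intros j)
    then show "j (r *\<^sub>R x) = r *\<^sub>R j x"
      by (intro j_eqI)
        (simp add: d.scaleR[symmetric] linear_scale[OF bounded_linear.linear[OF G(1)]])
    show "norm (j x) \<le> norm x * 2"
      using norm_triangle_ineq4[of x "P x"] norm_P[of x] by (simp add: norm_j)
  qed
  have comm_j: "commutes f j" if f: "bounded_linear f" "commutes f d" for f
    unfolding commutes_def
  proof
    fix x
    have "(\<lambda>n. f (d (G n x))) \<longlonglongrightarrow> f (j x)"
      by (intro bounded_linear.tendsto[OF f(1)] j)
    moreover have "f (d (G n x)) = d (G n (f x))" for n
      using f(2) comm_G[OF f] by (simp add: commutes_def)
    ultimately have "j (f x) = f (j x)"
      by (intro j_eqI) simp
    then show "f (j x) = j (f x)"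
      by simp
  qed
  have skew_j: "skew j"
    unfolding skew_def
  proof (intro allI)
    fix x y
    have "(\<lambda>n. d (G n x) \<odot> y) \<longlonglongrightarrow> j x \<odot> y"
      by (intro ip.tendsto j tendsto_const)
    moreover have "(\<lambda>n. d (G n x) \<odot> y) \<longlonglongrightarrow> - (x \<odot> j y)"
      unfolding skewD[OF \<open>skew d\<close>] symmetricD[OF G(2)] dG[symmetric]
      by (intro tendsto_minus ip.tendsto j tendsto_const)
    ultimately show "j x \<odot> y = - (x \<odot> j y)"
      by (rule LIMSEQ_unique)
  qed
  have jb: "j (b x) = d x" for x
  proof (rule j_eqI)
    have "d (G n (b x)) = b (G n (d x))" for n
      using comm_bd by (simp add: dG bG commutes_def)
    moreover have "P (d x) = 0"
      using comm_P[OF d comm_dd] dP by (simp add: commutes_def)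
    ultimately show "(\<lambda>n. d (G n (b x))) \<longlonglongrightarrow> d x"
      using P(2)[of "d x"] by simp
  qed
  have jP: "j (P x) = 0" for x
    by (rule j_eqI) (simp add: dG dP G0)
  have comm_jd: "commutes j d"
    by (intro commutes_sym[of d j] comm_j d comm_dd)
  have Pj: "P (j x) = 0" for x
    using comm_P[OF j_lin comm_jd] jP by (simp add: commutes_def)
  have jj: "j (j x) = P x - x" for x
  proof -
    \<comment> \<open>The defect w lies in the kernel of b, since b b j j x = d d x, so P fixes it;
      but P w = 0 as well.\<close>
    define w where "w = j (j x) - (P x - x)"
    have bj: "b (j y) = j (b y)" for y
      using comm_j[OF b(1) comm_bd] by (simp add: commutes_def)
    have "b (b w) = 0"
      unfolding w_def b.diff bj jb by (simp add: P(1) b.zero b(4) S_def bj jb)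
    then have "b w = 0"
      using symmetricD[OF b(2), of w "b w"] by (simp add: ip_self ip.zero_right)
    then have "w = P w"
      using P_id b_0 by simp
    also have "P w = 0"
      using P_id[OF dP] by (simp add: w_def linear_diff[OF bounded_linear.linear[OF P_lin]] Pj)
    finally show ?thesis
      by (simp add: w_def)
  qed
  show thesis
  proof (rule that[of b j P])
    show "x - P x \<in> closure (range b)" for x
      unfolding closure_sequential by (intro exI[of _ "\<lambda>n. b (G n x)"] conjI P(2)) simp
    show "commutes f b \<and> commutes f j \<and> commutes f P" if "bounded_linear f" "commutes f d" for f
      using comm_b comm_j comm_P that by simp
  qed (fact b(1) b(2) b(3) norm_b j_lin skew_j jb jj P_lin sym_P dP P_id jP Pj)+
qed

end

section \<open>Operators on a quaternionic Hilbert space\<close>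

subsection \<open>The underlying real Hilbert space\<close>

definition rin :: "'a::quaternionic_hilbert_space \<Rightarrow> 'a \<Rightarrow> real" (infixl "\<bullet>\<^sub>r" 70) where
  "u \<bullet>\<^sub>r v = qRe (qinner u v)"

section \<open>Right scalar multiplication and the quaternionic inner product\<close>

lemma scaleQ_zero_right [simp]: "u *\<^sub>Q 0 = (0 :: 'a::quaternionic_hilbert_space)"
  using scaleQ_add_right[of u 0 0] by simp

lemma scaleQ_zero_left [simp]: "0 *\<^sub>Q p = (0 :: 'a::quaternionic_hilbert_space)"
  using scaleQ_add_left[of 0 0 p] by simp

lemma scaleQ_minus_left: "(- u) *\<^sub>Q p = - (u *\<^sub>Q p :: 'a::quaternionic_hilbert_space)"
  using scaleQ_add_left[of u "- u" p] by (simp add: eq_neg_iff_add_eq_0 add.commute)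

lemma scaleQ_minus_right: "u *\<^sub>Q (- p) = - (u *\<^sub>Q p :: 'a::quaternionic_hilbert_space)"
  using scaleQ_add_right[of u p "- p"] by (simp add: eq_neg_iff_add_eq_0 add.commute)

lemma scaleQ_diff_left: "(u - v) *\<^sub>Q p = u *\<^sub>Q p - (v *\<^sub>Q p :: 'a::quaternionic_hilbert_space)"
  using scaleQ_add_left[of u "- v" p] by (simp add: scaleQ_minus_left)

lemma quat_of_real_commute: "q * of_real r = of_real r * (q :: quat)"
  by (simp add: quat_eq_iff times_quat_def of_real_quat)

lemma scaleR_scaleQ_assoc: "(r *\<^sub>R u) *\<^sub>Q p = r *\<^sub>R (u *\<^sub>Q p :: 'a::quaternionic_hilbert_space)"
  by (simp add: scaleR_scaleQ scaleQ_scaleQ quat_of_real_commute)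

lemma scaleQ_of_real: "u *\<^sub>Q of_real r = r *\<^sub>R (u :: 'a::quaternionic_hilbert_space)"
  by (simp add: scaleR_scaleQ)

lemma qinner_scaleQ_right: "qinner u (v *\<^sub>Q p) = qinner u v * p"
  using qinner_right[of u v p 0 0] by simp

lemma qinner_add_right: "qinner u (v + w) = qinner u v + qinner u w"
  using qinner_right[of u v 1 w 1] by (simp add: scaleQ_one)

lemma qinner_scaleQ_left: "qinner (u *\<^sub>Q p) v = qcnj p * qinner u v"
proof -
  have "qinner (u *\<^sub>Q p) v = qcnj (qinner v u * p)"
    by (subst qinner_commute) (simp add: qinner_scaleQ_right)
  also have "\<dots> = qcnj p * qcnj (qinner v u)"
    by (simp add: quat_eq_iff qcnj_def times_quat_def algebra_simps)
  finally show ?thesis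
    by (simp add: qinner_commute[of u v])
qed

interpretation rin: real_hilbert "rin :: 'a::quaternionic_hilbert_space \<Rightarrow> 'a \<Rightarrow> real"
proof
  have comm: "v \<bullet>\<^sub>r u = u \<bullet>\<^sub>r v" for u v :: 'a
    unfolding rin_def by (subst qinner_commute) (simp add: qcnj_def)
  have add: "u \<bullet>\<^sub>r (v + w) = u \<bullet>\<^sub>r v + u \<bullet>\<^sub>r w" for u v w :: 'a
    by (simp add: rin_def qinner_add_right plus_quat_def)
  fix x y z :: 'a and r :: real
  show "x \<bullet>\<^sub>r y = y \<bullet>\<^sub>r x"
    by (rule comm)
  show "(x + y) \<bullet>\<^sub>r z = x \<bullet>\<^sub>r z + y \<bullet>\<^sub>r z"
    by (simp add: comm[of z, symmetric] add)
  have "z \<bullet>\<^sub>r (r *\<^sub>R x) = r * (z \<bullet>\<^sub>r x)"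
    by (simp add: rin_def scaleR_scaleQ qinner_scaleQ_right of_real_quat times_quat_def)
  then show "(r *\<^sub>R x) \<bullet>\<^sub>r y = r * (x \<bullet>\<^sub>r y)"
    by (simp add: rin_def scaleR_scaleQ qinner_scaleQ_left of_real_quat times_quat_def qcnj_def)
  show "x \<bullet>\<^sub>r x = (norm x)\<^sup>2"
    using qinner_self_nonneg[of x] by (auto simp: rin_def norm_eq_sqrt_qinner of_real_quat)
qed

lemma rin_scaleQ_left: "(u *\<^sub>Q p) \<bullet>\<^sub>r v = u \<bullet>\<^sub>r (v *\<^sub>Q qcnj p)"
  by (simp add: rin_def qinner_scaleQ_left qinner_scaleQ_right times_quat_def qcnj_def algebra_simps)

lemma quat_eqI_qRe:
  assumes "\<And>p. qRe (x * p) = qRe (y * p)"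
  shows "x = y"
  using assms[of 1] assms[of "Quat 0 1 0 0"] assms[of "Quat 0 0 1 0"] assms[of "Quat 0 0 0 1"]
  by (simp add: quat_eq_iff times_quat_def one_quat_def)

text \<open>Passage from \<open>rin\<close> back to \<open>qinner\<close>: up to sign, the imaginary
  components of a quaternion are the real parts of its products with the units.\<close>

lemma qinner_eqI:
  assumes "\<And>p. u \<bullet>\<^sub>r (v *\<^sub>Q p) = w \<bullet>\<^sub>r (x *\<^sub>Q p)"
  shows "qinner u v = qinner w x"
  using assms by (intro quat_eqI_qRe) (simp add: rin_def qinner_scaleQ_right)

lemma qcnj_of_real_mult: "qcnj p * (of_real r * p) = of_real (r * (norm p)\<^sup>2)"
  unfolding power2_norm_eq_inner
  by (simp add: quat_eq_iff times_quat_def of_real_quat qcnj_def inner_quat_def algebra_simps)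

lemma bounded_linear_scaleQ: "bounded_linear (\<lambda>u :: 'a::quaternionic_hilbert_space. u *\<^sub>Q p)"
proof (rule bounded_linear_intro[of _ "norm p"])
  fix x :: 'a
  have q: "qinner x x = of_real ((norm x)\<^sup>2)"
    using qinner_self_nonneg[of x] by (auto simp: norm_eq_sqrt_qinner of_real_quat)
  have "qinner (x *\<^sub>Q p) (x *\<^sub>Q p) = qcnj p * (of_real ((norm x)\<^sup>2) * p)"
    by (simp only: qinner_scaleQ_left qinner_scaleQ_right mult.assoc q)
  also have "\<dots> = of_real ((norm x)\<^sup>2 * (norm p)\<^sup>2)"
    by (rule qcnj_of_real_mult)
  finally have "(norm (x *\<^sub>Q p))\<^sup>2 = (norm x)\<^sup>2 * (norm p)\<^sup>2"
    by (simp only: rin.ip_self[symmetric] rin_def) (simp add: of_real_quat)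
  then have "(norm (x *\<^sub>Q p))\<^sup>2 = (norm x * norm p)\<^sup>2"
    by (simp only: power_mult_distrib)
  then show "norm (x *\<^sub>Q p) \<le> norm x * norm p"
    by (rule power2_le_imp_le[OF eq_refl]) simp
qed (auto simp: scaleQ_add_left scaleR_scaleQ_assoc)

definition right_linear :: "('a::quaternionic_hilbert_space \<Rightarrow> 'a) \<Rightarrow> bool" where
  "right_linear f \<longleftrightarrow> bounded_linear f \<and> (\<forall>u q. f (u *\<^sub>Q q) = f u *\<^sub>Q q)"

lemma right_linearD:
  assumes "right_linear f"
  shows "bounded_linear f" "f (u *\<^sub>Q q) = f u *\<^sub>Q q"
  using assms by (auto simp: right_linear_def)

text \<open>In this form right linearity is delivered by the commutation clauses of the real
  constructions, applied to right multiplications.\<close>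

lemma right_linear_iff_commutes:
  "right_linear f \<longleftrightarrow> bounded_linear f \<and> (\<forall>q. commutes (\<lambda>u. u *\<^sub>Q q) f)"
  by (auto simp: right_linear_def commutes_def)

subsection \<open>Adjoints\<close>

lemma qlinear_operI:
  assumes "T 0 = Some 0"
    and "\<And>u v w x. T u = Some w \<Longrightarrow> T v = Some x \<Longrightarrow> T (u + v) = Some (w + x)"
    and "\<And>u w q. T u = Some w \<Longrightarrow> T (u *\<^sub>Q q) = Some (w *\<^sub>Q q)"
  shows "qlinear_oper T"
  unfolding qlinear_oper_def qsubspace_def using assms by fastforce

lemma qlinear_oper_add:
  "qlinear_oper T \<Longrightarrow> T u = Some w \<Longrightarrow> T v = Some x \<Longrightarrow> T (u + v) = Some (w + x)"
  unfolding qlinear_oper_def qsubspace_def by (metis domD domI option.sel)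

lemma qlinear_oper_scaleQ:
  "qlinear_oper T \<Longrightarrow> T u = Some w \<Longrightarrow> T (u *\<^sub>Q q) = Some (w *\<^sub>Q q)"
  unfolding qlinear_oper_def qsubspace_def by (metis domD domI option.sel)

lemma qlinear_oper_scaleR:
  "qlinear_oper T \<Longrightarrow> T u = Some w \<Longrightarrow> T (r *\<^sub>R u) = Some (r *\<^sub>R w)"
  by (simp add: scaleR_scaleQ qlinear_oper_scaleQ)

lemma qlinear_oper_0:
  assumes "qlinear_oper T"
  shows "T 0 = Some 0"
proof -
  obtain w where "T 0 = Some w"
    using assms unfolding qlinear_oper_def qsubspace_def by blast
  then show ?thesis
    using qlinear_oper_scaleQ[OF assms, of 0 w 0] by simp
qed

lemma qlinear_oper_diff:
  assumes "qlinear_oper T" "T u = Some w" "T v = Some x"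
  shows "T (u - v) = Some (w - x)"
  using qlinear_oper_add[OF assms(1,2) qlinear_oper_scaleR[OF assms(1,3), of "- 1"]] by simp

lemma dense_rin_eqI:
  fixes w w' :: "'a::quaternionic_hilbert_space"
  assumes "closure D = UNIV" and "\<And>v. v \<in> D \<Longrightarrow> w \<bullet>\<^sub>r v = w' \<bullet>\<^sub>r v"
  shows "w = w'"
proof (rule rin.ip_eqD)
  fix y
  obtain v where v: "\<And>n. v n \<in> D" "v \<longlonglongrightarrow> y"
    using assms(1) closure_sequential by blast
  have "(\<lambda>n. w \<bullet>\<^sub>r v n) \<longlonglongrightarrow> w \<bullet>\<^sub>r y"
    by (intro rin.ip.tendsto tendsto_const v)
  moreover have "(\<lambda>n. w \<bullet>\<^sub>r v n) \<longlonglongrightarrow> w' \<bullet>\<^sub>r y"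
    unfolding assms(2)[OF v(1)] by (intro rin.ip.tendsto tendsto_const v)
  ultimately show "w \<bullet>\<^sub>r y = w' \<bullet>\<^sub>r y"
    by (rule LIMSEQ_unique)
qed

text \<open>The real part is enough because \<open>dom T\<close> is closed under right
  multiplication; density makes the vector behind \<open>THE\<close> unique.\<close>

lemma adjoint_iff:
  assumes "qlinear_oper T" and "densely_defined T"
  shows "(T\<^sup>\<star>) u = Some w \<longleftrightarrow> (\<forall>v s. T v = Some s \<longrightarrow> u \<bullet>\<^sub>r s = w \<bullet>\<^sub>r v)"
    (is "_ \<longleftrightarrow> ?C w")
proof -
  have iff: "(\<forall>v\<in>dom T. qinner u (the (T v)) = qinner w v) \<longleftrightarrow>
      (\<forall>v s. T v = Some s \<longrightarrow> u \<bullet>\<^sub>r s = w \<bullet>\<^sub>r v)" for w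
  proof
    assume L: "\<forall>v\<in>dom T. qinner u (the (T v)) = qinner w v"
    then show "\<forall>v s. T v = Some s \<longrightarrow> u \<bullet>\<^sub>r s = w \<bullet>\<^sub>r v"
      by (metis domI option.sel rin_def)
  next
    assume R: "\<forall>v s. T v = Some s \<longrightarrow> u \<bullet>\<^sub>r s = w \<bullet>\<^sub>r v"
    show "\<forall>v\<in>dom T. qinner u (the (T v)) = qinner w v"
    proof
      fix v
      assume "v \<in> dom T"
      then obtain s where "T v = Some s"
        by blast
      then have "u \<bullet>\<^sub>r (s *\<^sub>Q p) = w \<bullet>\<^sub>r (v *\<^sub>Q p)" for p
        using R qlinear_oper_scaleQ[OF assms(1)] by blast
      then show "qinner u (the (T v)) = qinner w v"
        unfolding \<open>T v = Some s\<close> option.sel by (rule qinner_eqI)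
    qed
  qed
  have unique: "w = w'" if "\<forall>v s. T v = Some s \<longrightarrow> u \<bullet>\<^sub>r s = w \<bullet>\<^sub>r v"
    "\<forall>v s. T v = Some s \<longrightarrow> u \<bullet>\<^sub>r s = w' \<bullet>\<^sub>r v" for w w'
  proof (rule dense_rin_eqI)
    show "closure (dom T) = UNIV"
      using assms(2) by (simp add: densely_defined_def)
    show "w \<bullet>\<^sub>r v = w' \<bullet>\<^sub>r v" if "v \<in> dom T" for v
      using that \<open>\<forall>v s. T v = Some s \<longrightarrow> u \<bullet>\<^sub>r s = w \<bullet>\<^sub>r v\<close>
        \<open>\<forall>v s. T v = Some s \<longrightarrow> u \<bullet>\<^sub>r s = w' \<bullet>\<^sub>r v\<close> by force
  qed
  show ?thesis
  proof (cases "\<exists>w. ?C w")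
    case True
    then obtain w' where w': "?C w'"
      by blast
    have "(THE w. ?C w) = w'"
      using w' unique by (intro the_equality)
    then have "(T\<^sup>\<star>) u = Some w'"
      using True by (simp add: oper_adjoint_def iff)
    then show ?thesis
      using w' unique by auto
  next
    case False
    then have "(T\<^sup>\<star>) u = None"
      unfolding oper_adjoint_def iff by (rule if_not_P)
    then show ?thesis
      using False by auto
  qed
qed

lemma adjointD:
  assumes "qlinear_oper T" and "densely_defined T" and "(T\<^sup>\<star>) u = Some w" and "T v = Some s"
  shows "u \<bullet>\<^sub>r s = w \<bullet>\<^sub>r v"
  using assms adjoint_iff by blast

lemma qlinear_oper_adjoint:
  assumes "qlinear_oper T" and "densely_defined T"
  shows "qlinear_oper (T\<^sup>\<star>)"
proof (rule qlinear_operI)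
  show "(T\<^sup>\<star>) (u *\<^sub>Q q) = Some (w *\<^sub>Q q)" if "(T\<^sup>\<star>) u = Some w" for u w q
    using adjointD[OF assms that qlinear_oper_scaleQ[OF assms(1)]]
    by (auto simp: adjoint_iff[OF assms] rin_scaleQ_left)
qed (auto simp: adjoint_iff[OF assms] rin.ip.add_left rin.ip.zero_left)

subsection \<open>Quotients of commuting bounded operators\<close>

text \<open>The operator $R^{-1}N$ with its natural domain, for injective \<open>R\<close>.\<close>

definition oper_quotient ::
  "('a::quaternionic_hilbert_space \<Rightarrow> 'a) \<Rightarrow> ('a \<Rightarrow> 'a) \<Rightarrow> 'a oper" where
  "oper_quotient R N = (\<lambda>u. if \<exists>w. N u = R w then Some (THE w. N u = R w) else None)"

section \<open>Quotients with injective denominator: cores, closures, adjoints\<close>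

lemma oper_quotient_iff:
  assumes "inj R"
  shows "oper_quotient R N u = Some w \<longleftrightarrow> N u = R w"
proof -
  have "(THE w. N u = R w) = w" if "N u = R w" for w
    using that injD[OF assms] by (intro the_equality) auto
  then show ?thesis
    unfolding oper_quotient_def using injD[OF assms] by (cases "\<exists>w. N u = R w") auto
qed

lemma oper_eqI:
  assumes "\<And>u w. T u = Some w \<longleftrightarrow> S u = Some w"
  shows "T = S"
proof
  fix u
  show "T u = S u"
    using assms[of u "the (T u)"] assms[of u "the (S u)"]
    by (cases "T u"; cases "S u") auto
qed

lemma graph_eqD: "Map.graph S = Map.graph Q \<Longrightarrow> S = Q"
  by (rule oper_eqI) (auto simp: Map.graph_def set_eq_iff)

lemma closure_graph_eqD:
  assumes "closure (Map.graph S) = Map.graph Q"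
  shows "closable_oper S" and "oper_closure S = Q"
proof -
  show "closable_oper S"
    unfolding closable_oper_def using assms by metis
  have "Q' = Q" if "Map.graph Q' = Map.graph Q" for Q'
    using that by (rule graph_eqD)
  then show "oper_closure S = Q"
    unfolding oper_closure_def assms by (intro the_equality) auto
qed

text \<open>For a symmetric map the two norm bounds together place the spectrum in [0, 1]; they are
  stated as norm bounds because the square root and the Neumann series use them in that
  form.\<close>

locale injective_contraction =
  fixes R :: "'a::quaternionic_hilbert_space \<Rightarrow> 'a"
  assumes right_linear: "right_linear R"
    and symmetric: "rin.symmetric R"
    and inj: "inj R"
    and norm_le: "norm (R x) \<le> norm x"
    and contraction: "norm (x - R x) \<le> norm x"
begin

lemma bounded_linear: "bounded_linear R"
  using right_linear by (rule right_linearD)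

sublocale bounded_linear R
  by (rule bounded_linear)

lemma eq_0D: "R x = 0 \<Longrightarrow> x = 0"
  using inj zero by (metis injD)

text \<open>Injectivity annihilates the kernel vector left over by
  \<open>approximate_inverse\<close>. The vectors \<open>R (G n x)\<close> lie in the range of
  \<open>R\<close>, where quotients are known explicitly, so this provides the smoothing in the
  density arguments for quotients.\<close>

lemma approximate_identity:
  obtains G :: "nat \<Rightarrow> 'a \<Rightarrow> 'a" where
    "\<And>n f x. linear f \<Longrightarrow> commutes f R \<Longrightarrow> f (G n x) = G n (f x)"
    "\<And>x. (\<lambda>n. R (G n x)) \<longlonglongrightarrow> x"
proof -
  obtain G :: "nat \<Rightarrow> 'a \<Rightarrow> 'a" where G: "\<And>n. bounded_linear (G n)" "\<And>n. rin.symmetric (G n)"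
    "\<And>n f. linear f \<Longrightarrow> commutes f R \<Longrightarrow> commutes f (G n)"
    "\<And>x. \<exists>y. R y = 0 \<and> (\<lambda>n. R (G n x)) \<longlonglongrightarrow> x - y"
    by (rule rin.approximate_inverse[OF bounded_linear symmetric norm_le contraction], rule that)
  have "(\<lambda>n. R (G n x)) \<longlonglongrightarrow> x" for x
    using G(4)[of x] eq_0D by fastforce
  then show thesis
    using that[of G] G(3) by (simp add: commutes_def)
qed

lemma closure_range: "closure (range R) = UNIV"
proof -
  obtain G :: "nat \<Rightarrow> 'a \<Rightarrow> 'a" where "\<And>n f x. linear f \<Longrightarrow> commutes f R \<Longrightarrow> f (G n x) = G n (f x)"
      and G: "\<And>x. (\<lambda>n. R (G n x)) \<longlonglongrightarrow> x"
    by (rule approximate_identity, rule that)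
  have "x \<in> closure (range R)" for x
    unfolding closure_sequential by (intro exI[of _ "\<lambda>n. R (G n x)"] conjI G) simp
  then show ?thesis
    by blast
qed

lemmas quotient_iff = oper_quotient_iff[OF inj]

lemma quotient_R: "commutes N R \<Longrightarrow> oper_quotient R N (R x) = Some (N x)"
  by (simp add: quotient_iff commutes_def)

lemma qlinear_oper_quotient: "right_linear N \<Longrightarrow> qlinear_oper (oper_quotient R N)"
  by (rule qlinear_operI)
    (auto simp: quotient_iff right_linearD add linear_add linear_0 right_linearD[OF right_linear]
      bounded_linear.linear zero)

lemma densely_defined_quotient:
  assumes "commutes N R"
  shows "densely_defined (oper_quotient R N)"
proof -
  have "range R \<subseteq> dom (oper_quotient R N)"
    using quotient_R[OF assms] by auto
  then show ?thesis
    using closure_range closure_mono unfolding densely_defined_def by blast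
qed

lemma closed_graph_quotient:
  assumes "bounded_linear N"
  shows "closed (Map.graph (oper_quotient R N))"
proof -
  have "Map.graph (oper_quotient R N) = {z. N (fst z) = R (snd z)}"
    by (auto simp: Map.graph_def quotient_iff)
  also have "closed \<dots>"
    by (intro closed_Collect_eq bounded_linear.continuous_on[OF assms] continuous_on
        continuous_intros)
  finally show ?thesis .
qed

text \<open>The range of \<open>R\<close> is a core: if N u = R w, then N (G n u) = R (G n w), so
  the pairs (R (G n u), N (G n u)) tend to (u, w). Any operator between the restriction to this core
  and the full quotient thus has the quotient as its closure.\<close>

lemma closure_graph_eq_quotient:
  assumes N: "bounded_linear N" "commutes N R"
    and sub: "\<And>u w. S u = Some w \<Longrightarrow> N u = R w"
    and core: "\<And>x. S (R x) = Some (N x)"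
  shows "closure (Map.graph S) = Map.graph (oper_quotient R N)"
proof
  show "closure (Map.graph S) \<subseteq> Map.graph (oper_quotient R N)"
    using sub by (intro closure_minimal closed_graph_quotient N)
      (auto simp: Map.graph_def quotient_iff)
  show "Map.graph (oper_quotient R N) \<subseteq> closure (Map.graph S)"
  proof
    fix z
    assume "z \<in> Map.graph (oper_quotient R N)"
    then obtain u w where z: "z = (u, w)" "N u = R w"
      by (auto simp: Map.graph_def quotient_iff)
    obtain G :: "nat \<Rightarrow> 'a \<Rightarrow> 'a" where G:
      "\<And>n f x. linear f \<Longrightarrow> commutes f R \<Longrightarrow> f (G n x) = G n (f x)"
      "\<And>x. (\<lambda>n. R (G n x)) \<longlonglongrightarrow> x"
      by (rule approximate_identity, rule that)
    have "N (G n u) = R (G n w)" for n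
      using G(1)[OF bounded_linear.linear[OF N(1)] N(2)] z(2) G(1)[OF linear_axioms]
      by (simp add: commutes_def)
    then have "(\<lambda>n. (R (G n u), N (G n u))) \<longlonglongrightarrow> (u, w)"
      using G(2) by (auto intro!: tendsto_Pair)
    then show "z \<in> closure (Map.graph S)"
      unfolding closure_sequential z using core
      by (intro exI[of _ "\<lambda>n. (R (G n u), N (G n u))"]) (auto intro: in_graphI)
  qed
qed

lemma closed_oper_eq_quotient:
  assumes N: "bounded_linear N" "commutes N R"
    and sub: "\<And>u w. S u = Some w \<Longrightarrow> N u = R w"
    and core: "\<And>x. S (R x) = Some (N x)" and "closed_oper S"
  shows "S = oper_quotient R N"
  using closure_graph_eq_quotient[OF assms(1-4)] \<open>closed_oper S\<close>
  by (intro graph_eqD) (simp add: closed_oper_def)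

text \<open>Testing on v = R x gives N' y = R w. For the converse, y and w are smoothed to R (G n y)
  and R (G n w), for which N and R can be moved across the inner product before n tends to
  infinity.\<close>

lemma adjoint_quotient:
  assumes N: "right_linear N" "commutes N R" and N': "bounded_linear N'" "commutes N' R"
    and adj: "\<And>x y. N x \<bullet>\<^sub>r y = x \<bullet>\<^sub>r N' y"
  shows "(oper_quotient R N)\<^sup>\<star> = oper_quotient R N'"
proof (rule oper_eqI)
  fix y w
  have "((oper_quotient R N)\<^sup>\<star>) y = Some w \<longleftrightarrow> (\<forall>v s. N v = R s \<longrightarrow> y \<bullet>\<^sub>r s = w \<bullet>\<^sub>r v)"
    by (simp add: adjoint_iff qlinear_oper_quotient densely_defined_quotient N quotient_iff)
  also have "\<dots> \<longleftrightarrow> N' y = R w"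
  proof
    assume L: "\<forall>v s. N v = R s \<longrightarrow> y \<bullet>\<^sub>r s = w \<bullet>\<^sub>r v"
    show "N' y = R w"
    proof (rule rin.ip_eqD)
      fix x
      have "y \<bullet>\<^sub>r N x = w \<bullet>\<^sub>r R x"
        using L N(2) by (simp add: commutes_def)
      then show "N' y \<bullet>\<^sub>r x = R w \<bullet>\<^sub>r x"
        by (metis adj rin.ip_commute rin.symmetricD[OF symmetric])
    qed
  next
    assume R: "N' y = R w"
    obtain G :: "nat \<Rightarrow> 'a \<Rightarrow> 'a" where G:
      "\<And>n f x. linear f \<Longrightarrow> commutes f R \<Longrightarrow> f (G n x) = G n (f x)"
      "\<And>x. (\<lambda>n. R (G n x)) \<longlonglongrightarrow> x"
      by (rule approximate_identity, rule that)
    show "\<forall>v s. N v = R s \<longrightarrow> y \<bullet>\<^sub>r s = w \<bullet>\<^sub>r v"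
    proof (intro allI impI)
      fix v s
      assume vs: "N v = R s"
      have GR: "R (G n x) = G n (R x)" for n x
        using G(1)[OF linear_axioms] by (simp add: commutes_def)
      have "R (G n y) \<bullet>\<^sub>r s = R (G n w) \<bullet>\<^sub>r v" for n
      proof -
        have "R (G n y) \<bullet>\<^sub>r s = N v \<bullet>\<^sub>r G n y"
          by (simp add: rin.symmetricD[OF symmetric] vs rin.ip_commute)
        also have "\<dots> = v \<bullet>\<^sub>r G n (N' y)"
          using G(1)[OF bounded_linear.linear[OF N'(1)] N'(2)] by (simp add: adj)
        finally show ?thesis
          by (simp add: R GR rin.ip_commute)
      qed
      moreover have "(\<lambda>n. R (G n y) \<bullet>\<^sub>r s) \<longlonglongrightarrow> y \<bullet>\<^sub>r s" "(\<lambda>n. R (G n w) \<bullet>\<^sub>r v) \<longlonglongrightarrow> w \<bullet>\<^sub>r v"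
        by (intro rin.ip.tendsto G(2) tendsto_const)+
      ultimately show "y \<bullet>\<^sub>r s = w \<bullet>\<^sub>r v"
        using LIMSEQ_unique by fastforce
    qed
  qed
  finally show "((oper_quotient R N)\<^sup>\<star>) y = Some w \<longleftrightarrow> oper_quotient R N' y = Some w"
    by (simp add: quotient_iff)
qed

text \<open>N (G n u) converges, so equality of norms makes N' (G n u) Cauchy; its limit is the
  value of the other quotient at u. For a normal operator this yields equal domains of T and its
  adjoint.\<close>

lemma dom_quotient_subset:
  assumes N: "bounded_linear N" "commutes N R" and N': "bounded_linear N'" "commutes N' R"
    and norm_eq: "\<And>x. norm (N' x) = norm (N x)"
  shows "dom (oper_quotient R N) \<subseteq> dom (oper_quotient R N')"
proof
  interpret N: bounded_linear N by fact
  interpret N': bounded_linear N' by fact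
  fix u
  assume "u \<in> dom (oper_quotient R N)"
  then obtain w where w: "N u = R w"
    by (auto simp: quotient_iff)
  obtain G :: "nat \<Rightarrow> 'a \<Rightarrow> 'a" where G:
    "\<And>n f x. linear f \<Longrightarrow> commutes f R \<Longrightarrow> f (G n x) = G n (f x)"
    "\<And>x. (\<lambda>n. R (G n x)) \<longlonglongrightarrow> x"
    by (rule approximate_identity, rule that)
  have "N (G n u) = R (G n w)" for n
    using G(1)[OF N.linear_axioms N(2)] w G(1)[OF linear_axioms] by (simp add: commutes_def)
  then have "(\<lambda>n. N (G n u)) \<longlonglongrightarrow> w"
    using G(2) by simp
  then have "Cauchy (\<lambda>n. N (G n u))"
    by (rule LIMSEQ_imp_Cauchy)
  moreover have "dist (N' (G m u)) (N' (G n u)) = dist (N (G m u)) (N (G n u))" for m n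
    by (simp add: dist_norm N.diff[symmetric] N'.diff[symmetric] norm_eq)
  ultimately have "Cauchy (\<lambda>n. N' (G n u))"
    by (simp add: Cauchy_def)
  then obtain w' where "(\<lambda>n. N' (G n u)) \<longlonglongrightarrow> w'"
    using Cauchy_convergent_iff convergent_def by blast
  then have "(\<lambda>n. R (N' (G n u))) \<longlonglongrightarrow> R w'"
    by (rule tendsto)
  moreover have "(\<lambda>n. R (N' (G n u))) \<longlonglongrightarrow> N' u"
    using N'.tendsto[OF G(2)[of u]] N'(2) by (simp add: commutes_def)
  ultimately have "N' u = R w'"
    using LIMSEQ_unique by blast
  then show "u \<in> dom (oper_quotient R N')"
    by (auto simp: quotient_iff dom_def)
qed

end

subsection \<open>Normal operators as quotients\<close>

text \<open>The real Hilbert space in which graphs live; projecting onto a closed graph is what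
  inverts 1 + T*T.\<close>

interpretation graph_space: real_hilbert
  "\<lambda>x y :: 'a::quaternionic_hilbert_space \<times> 'a. fst x \<bullet>\<^sub>r fst y + snd x \<bullet>\<^sub>r snd y"
  by unfold_locales
    (auto simp: rin.ip_simps algebra_simps rin.ip_commute rin.ip_self norm_prod_def)

section \<open>Bounded data of a closed normal operator\<close>

lemma subspace_graph:
  assumes "qlinear_oper T"
  shows "subspace (Map.graph T)"
  unfolding subspace_def Map.graph_def
  using qlinear_oper_0[OF assms] qlinear_oper_add[OF assms] qlinear_oper_scaleR[OF assms]
  by (auto simp: zero_prod_def)

lemma normal_oper_commute:
  assumes "normal_oper T"
  shows "(\<exists>s. T u = Some s \<and> (T\<^sup>\<star>) s = Some w) \<longleftrightarrow> (\<exists>s. (T\<^sup>\<star>) u = Some s \<and> T s = Some w)"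
proof -
  have "(T\<^sup>\<star> \<circ>\<^sub>m T) u = Some w \<longleftrightarrow> (T \<circ>\<^sub>m T\<^sup>\<star>) u = Some w"
    using assms by (simp add: normal_oper_def)
  then show ?thesis
    by (auto simp: map_comp_Some_iff)
qed

text \<open>The bounded data are \<open>R = (1 + T\<^sup>\<star>T)\<^sup>-\<^sup>1\<close>, \<open>N = TR\<close> and \<open>N' = T\<^sup>\<star>R\<close>.\<close>

theorem normal_oper_quotient:
  fixes T :: "'a::quaternionic_hilbert_space oper"
  assumes lin: "qlinear_oper T" and dense: "densely_defined T" and closed: "closed_oper T"
    and normal: "normal_oper T"
  obtains R N N' where "injective_contraction R" "right_linear N" "right_linear N'"
    "commutes N R" "commutes N' R" "commutes N N'" "\<And>x y. N x \<bullet>\<^sub>r y = x \<bullet>\<^sub>r N' y"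
    "\<And>x. norm (N x) \<le> norm x" "\<And>x. norm (N' x) = norm (N x)"
    "\<And>x. N' (N x) = R (x - R x)"
    "T = oper_quotient R N" "T\<^sup>\<star> = oper_quotient R N'"
proof -
  note adj = adjointD[OF lin dense]
  note lin' = qlinear_oper_adjoint[OF lin dense]
  \<comment> \<open>Project (x, 0) onto the graph: the foot is (u, T u), and orthogonality of the
    residual (x - u, - T u) to the graph says that T* maps T u to x - u.\<close>
  have "\<exists>u t. T u = Some t \<and> (T\<^sup>\<star>) t = Some (x - u)" for x
  proof -
    obtain u t where ut: "T u = Some t"
      "\<And>v s. T v = Some s \<Longrightarrow> (x - u) \<bullet>\<^sub>r v + (0 - t) \<bullet>\<^sub>r s = 0"
      using graph_space.projection[OF subspace_graph[OF lin] closed[unfolded closed_oper_def],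
          of "(x, 0)"]
      by (fastforce simp: Map.graph_def)
    have "(T\<^sup>\<star>) t = Some (x - u)"
      unfolding adjoint_iff[OF lin dense]
    proof (intro allI impI)
      fix v s
      assume "T v = Some s"
      from ut(2)[OF this] show "t \<bullet>\<^sub>r s = (x - u) \<bullet>\<^sub>r v"
        by (simp add: rin.ip_simps)
    qed
    with ut(1) show ?thesis
      by blast
  qed
  then obtain R N where RN: "T (R x) = Some (N x)" "(T\<^sup>\<star>) (N x) = Some (x - R x)" for x
    by metis
  \<comment> \<open>Normality rewrites T*T R x = x - R x as T T* R x, which gives N' = T*R together
    with its image under T.\<close>
  then have "\<exists>s. (T\<^sup>\<star>) (R x) = Some s \<and> T s = Some (x - R x)" for x
    using normal_oper_commute[OF normal] by blast
  then obtain N' where RN': "(T\<^sup>\<star>) (R x) = Some (N' x)" "T (N' x) = Some (x - R x)" for x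
    by metis
  \<comment> \<open>Injectivity of 1 + T*T: for the difference of two solutions, the adjoint
    relation makes a sum of two squared norms vanish.\<close>
  have unique: "R x = u \<and> N x = t" if "T u = Some t" "(T\<^sup>\<star>) t = Some (x - u)" for x u t
  proof -
    have T: "T (u - R x) = Some (t - N x)"
      by (intro qlinear_oper_diff lin RN that)
    have "(T\<^sup>\<star>) (t - N x) = Some ((x - u) - (x - R x))"
      by (intro qlinear_oper_diff lin' RN that)
    from adj[OF this T] have "(norm (t - N x))\<^sup>2 + (norm (u - R x))\<^sup>2 = 0"
      by (simp add: rin.ip_self[symmetric] rin.ip_simps)
    then show ?thesis
      by (simp add: add_nonneg_eq_0_iff)
  qed
  have unique': "N' x = w" if "(T\<^sup>\<star>) (R x) = Some w" for x w
    using RN'(1)[of x] that by simp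
  \<comment> \<open>From x = R x + T*T R x, where the inner product of the summands is the squared
    norm of N x.\<close>
  have norm_sq: "(norm x)\<^sup>2 = (norm (R x))\<^sup>2 + 2 * (norm (N x))\<^sup>2 + (norm (x - R x))\<^sup>2" for x
  proof -
    have "(x - R x) \<bullet>\<^sub>r R x = (norm (N x))\<^sup>2"
      using adj[OF RN(2) RN(1), of x x] by (simp add: rin.ip_self)
    then show ?thesis
      using rin.norm_add_square[of "x - R x" "R x"] by simp
  qed
  have norm_R: "norm (R x) \<le> norm x" and norm_xR: "norm (x - R x) \<le> norm x"
    and norm_N: "norm (N x) \<le> norm x" for x
  proof -
    note sq = zero_le_power2[of "norm (R x)"] zero_le_power2[of "norm (N x)"]
      zero_le_power2[of "norm (x - R x)"]
    show "norm (R x) \<le> norm x"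
      by (rule power2_le_imp_le) (use norm_sq[of x] sq in linarith, simp)
    show "norm (x - R x) \<le> norm x"
      by (rule power2_le_imp_le) (use norm_sq[of x] sq in linarith, simp)
    show "norm (N x) \<le> norm x"
      by (rule power2_le_imp_le) (use norm_sq[of x] sq in linarith, simp)
  qed
  have norm_N': "norm (N' x) = norm (N x)" for x
  proof -
    have "(norm (N' x))\<^sup>2 = (x - R x) \<bullet>\<^sub>r R x"
      using adj[OF RN'(1) RN'(2), of x x] by (simp add: rin.ip_self rin.ip_commute)
    also have "\<dots> = (norm (N x))\<^sup>2"
      using adj[OF RN(2) RN(1), of x x] by (simp add: rin.ip_self)
    finally show ?thesis
      by simp
  qed
  have add: "R (x + y) = R x + R y \<and> N (x + y) = N x + N y" for x y
  proof (rule unique)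
    show "T (R x + R y) = Some (N x + N y)"
      by (intro qlinear_oper_add lin RN)
    show "(T\<^sup>\<star>) (N x + N y) = Some (x + y - (R x + R y))"
      using qlinear_oper_add[OF lin' RN(2) RN(2), of x y] by (simp add: algebra_simps)
  qed
  have scale: "R (x *\<^sub>Q q) = R x *\<^sub>Q q \<and> N (x *\<^sub>Q q) = N x *\<^sub>Q q" for x q
  proof (rule unique)
    show "T (R x *\<^sub>Q q) = Some (N x *\<^sub>Q q)"
      by (intro qlinear_oper_scaleQ lin RN)
    show "(T\<^sup>\<star>) (N x *\<^sub>Q q) = Some (x *\<^sub>Q q - (R x *\<^sub>Q q))"
      using qlinear_oper_scaleQ[OF lin' RN(2), of x q] by (simp add: scaleQ_diff_left)
  qed
  have right_linearI: "right_linear f" if "\<And>x y. f (x + y) = f x + f y"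
    "\<And>x q. f (x *\<^sub>Q q) = f x *\<^sub>Q q" "\<And>x. norm (f x) \<le> norm x" for f :: "'a \<Rightarrow> 'a"
    unfolding right_linear_def
    using that by (auto simp: scaleR_scaleQ intro!: bounded_linear_intro[of _ 1])
  have R: "right_linear R" and N: "right_linear N"
    using add scale norm_R norm_N by (auto intro!: right_linearI)
  have N': "right_linear N'"
  proof (rule right_linearI)
    show "N' (x + y) = N' x + N' y" for x y
      using qlinear_oper_add[OF lin' RN'(1) RN'(1)] add by (intro unique') simp
    show "N' (x *\<^sub>Q q) = N' x *\<^sub>Q q" for x q
      using qlinear_oper_scaleQ[OF lin' RN'(1)] scale by (intro unique') simp
    show "norm (N' x) \<le> norm x" for x
      using norm_N norm_N' by simp
  qed
  have sym_R: "rin.symmetric R"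
    unfolding rin.symmetric_def
  proof (intro allI)
    \<comment> \<open>The right-hand side is visibly symmetric in x and y.\<close>
    have eq: "R x \<bullet>\<^sub>r y = R x \<bullet>\<^sub>r R y + N x \<bullet>\<^sub>r N y" for x y
    proof -
      have "R x \<bullet>\<^sub>r (y - R y) = N x \<bullet>\<^sub>r N y"
        using adj[OF RN(2) RN(1), of y x] by (simp add: rin.ip_commute)
      then show ?thesis
        by (simp add: rin.ip_simps)
    qed
    show "R x \<bullet>\<^sub>r y = x \<bullet>\<^sub>r R y" for x y
      using eq[of x y] eq[of y x] by (simp add: rin.ip_commute)
  qed
  have "inj R"
  proof (rule injI)
    fix x y
    assume eq: "R x = R y"
    have "Some (N x) = Some (N y)"
      by (simp only: RN(1)[symmetric] eq)
    then have "Some (x - R x) = Some (y - R y)"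
      by (simp only: RN(2)[symmetric] option.inject)
    then show "x = y"
      by (simp add: eq)
  qed
  then interpret R: injective_contraction R
    using R sym_R norm_R norm_xR by unfold_locales auto
  \<comment> \<open>Since u - R u = T* N u, the value w - N u of T there is T T* N u, which is T*T N
    u by normality; so (1 + T*T) N u = w.\<close>
  have RT: "N u = R w" if "T u = Some w" for u w
  proof -
    have "T (u - R u) = Some (w - N u)"
      by (intro qlinear_oper_diff lin RN that)
    with RN(2) have "\<exists>s. (T\<^sup>\<star>) (N u) = Some s \<and> T s = Some (w - N u)"
      by (intro exI conjI)
    then obtain s where "T (N u) = Some s" "(T\<^sup>\<star>) s = Some (w - N u)"
      unfolding normal_oper_commute[OF normal, symmetric] by (elim exE conjE)
    then show ?thesis
      by (rule unique[THEN conjunct1, symmetric])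
  qed
  \<comment> \<open>Here T N' u = u - R u, so the value of T* there shows (1 + T*T) N' u =
    w.\<close>
  have RT': "N' u = R w" if "(T\<^sup>\<star>) u = Some w" for u w
  proof -
    have "(T\<^sup>\<star>) (u - R u) = Some (w - N' u)"
      by (intro qlinear_oper_diff lin' RN' that)
    then show ?thesis
      using unique[OF RN'(2)] by simp
  qed
  have comm_N: "commutes N R" and comm_N': "commutes N' R"
    using RT[OF RN(1)] RT'[OF RN'(1)] by (auto simp: commutes_def)
  have N'N: "N' (N x) = R (x - R x)" and NN': "N (N' x) = R (x - R x)" for x
    using RT'[OF RN(2)] RT[OF RN'(2)] by auto
  \<comment> \<open>Split y into R y and y - R y: the adjoint relation applies to each part, and the
    left factors R x and x - R x add up to x.\<close>
  have adj_N: "N x \<bullet>\<^sub>r y = x \<bullet>\<^sub>r N' y" for x y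
  proof -
    have "N x \<bullet>\<^sub>r R y = R x \<bullet>\<^sub>r N' y"
      using adj[OF RN'(1) RN(1), of y x] by (simp add: rin.ip_commute)
    moreover have "N x \<bullet>\<^sub>r (y - R y) = (x - R x) \<bullet>\<^sub>r N' y"
      by (rule adj[OF RN(2) RN'(2)])
    ultimately show ?thesis
      by (simp add: rin.ip_simps)
  qed
  have T_eq: "T = oper_quotient R N"
    by (intro R.closed_oper_eq_quotient right_linearD(1)[OF N] comm_N RT RN closed)
  moreover have "T\<^sup>\<star> = oper_quotient R N'"
    unfolding T_eq by (intro R.adjoint_quotient N comm_N right_linearD(1)[OF N'] comm_N' adj_N)
  moreover have "commutes N N'"
    by (simp add: commutes_def N'N NN')
  ultimately show thesis
    by (intro that[of R N N'] R.injective_contraction_axioms N N' comm_N comm_N' adj_N norm_N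
        norm_N' N'N)
qed

subsection \<open>Uniqueness of positive square roots\<close>

lemma closed_oper_adjoint:
  assumes "qlinear_oper T" and "densely_defined T"
  shows "closed_oper (T\<^sup>\<star>)"
proof -
  have "Map.graph (T\<^sup>\<star>) = (\<Inter>(v, s) \<in> Map.graph T. {z. fst z \<bullet>\<^sub>r s = snd z \<bullet>\<^sub>r v})"
    by (auto simp: Map.graph_def adjoint_iff[OF assms])
  also have "closed \<dots>"
    by (intro closed_INT ballI)
      (auto intro!: closed_Collect_eq rin.ip.continuous_on continuous_intros)
  finally show ?thesis
    by (simp add: closed_oper_def)
qed

lemma positive_operD:
  assumes "positive_oper P" and "P u = Some w"
  shows "0 \<le> u \<bullet>\<^sub>r w"
proof -
  have "qinner u (the (P u)) \<in> of_real ` {0..}"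
    using assms unfolding positive_oper_def by blast
  then show ?thesis
    using assms(2) by (auto simp: rin_def of_real_quat)
qed

text \<open>Self-adjointness already makes \<open>qinner u w\<close> equal to its conjugate, hence
  real, so only the sign of the real part remains.\<close>

lemma positive_operI:
  assumes lin: "qlinear_oper P" and sa: "self_adjoint_oper P"
    and nonneg: "\<And>u w. P u = Some w \<Longrightarrow> 0 \<le> u \<bullet>\<^sub>r w"
  shows "positive_oper P"
  unfolding positive_oper_def
proof
  fix u
  assume "u \<in> dom P"
  then obtain w where w: "P u = Some w"
    by blast
  have adj: "(P\<^sup>\<star>) u = Some w" and dense: "densely_defined P"
    using sa w by (auto simp: self_adjoint_oper_def)
  have "qinner u w = qinner w u"
  proof (rule qinner_eqI)
    show "u \<bullet>\<^sub>r (w *\<^sub>Q p) = w \<bullet>\<^sub>r (u *\<^sub>Q p)" for p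
      by (intro adjointD[OF lin dense adj] qlinear_oper_scaleQ lin w)
  qed
  then have "qinner u w = qcnj (qinner u w)"
    using qinner_commute[of u w] by simp
  then have "qinner u w = of_real (u \<bullet>\<^sub>r w)"
    by (simp add: quat_eq_iff qcnj_def of_real_quat rin_def)
  then show "qinner u (the (P u)) \<in> of_real ` {0..}"
    using nonneg[OF w] w by auto
qed

text \<open>The denominator (1 + S^2)^(-1) depends only on the square of S, and for positive
  self-adjoint S the numerator N = S R is the positive square root of R (1 - R). Uniqueness of
  bounded roots therefore gives equal numerators over equal denominators.\<close>

theorem positive_root_unique:
  fixes P Q :: "'a::quaternionic_hilbert_space oper"
  assumes P: "qlinear_oper P" "positive_oper P" "self_adjoint_oper P"
    and Q: "qlinear_oper Q" "positive_oper Q" "self_adjoint_oper Q"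
    and PQ: "P \<circ>\<^sub>m P = Q \<circ>\<^sub>m Q"
  shows "P = Q"
proof -
  have root: "\<exists>R N. injective_contraction R \<and> bounded_linear N \<and> rin.symmetric N \<and>
      (\<forall>x. 0 \<le> x \<bullet>\<^sub>r N x) \<and> (\<forall>x. norm (N x) \<le> norm x) \<and> (\<forall>x. N (N x) = R (x - R x)) \<and>
      (\<forall>x. (S \<circ>\<^sub>m S) (R x) = Some (x - R x)) \<and> S = oper_quotient R N"
    if S: "qlinear_oper S" "positive_oper S" "self_adjoint_oper S" for S :: "'a oper"
  proof -
    have S': "densely_defined S" "S\<^sup>\<star> = S"
      using S(3) by (auto simp: self_adjoint_oper_def)
    then have "closed_oper S" and "normal_oper S"
      using closed_oper_adjoint[OF S(1)] by (auto simp: normal_oper_def)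
    obtain R N N' where N: "injective_contraction R" "right_linear N" "right_linear N'"
      "commutes N R" "commutes N' R" "commutes N N'" "\<And>x y. N x \<bullet>\<^sub>r y = x \<bullet>\<^sub>r N' y"
      "\<And>x. norm (N x) \<le> norm x" "\<And>x. norm (N' x) = norm (N x)"
      "\<And>x. N' (N x) = R (x - R x)" "S = oper_quotient R N" "S\<^sup>\<star> = oper_quotient R N'"
      by (rule normal_oper_quotient[OF S(1) S'(1) \<open>closed_oper S\<close> \<open>normal_oper S\<close>], rule that)
    interpret injective_contraction R
      by fact
    have SR: "S (R x) = Some (N x)" for x
      unfolding N(11) by (rule quotient_R) fact
    have "(S\<^sup>\<star>) (R x) = Some (N' x)" for x
      unfolding N(12) by (rule quotient_R) fact
    then have "N' x = N x" for x
      using SR[of x] by (simp add: S'(2))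
    have SN: "S (N x) = Some (x - R x)" for x
      using N(10)[of x] \<open>\<And>x. N' x = N x\<close> unfolding N(11) by (simp add: quotient_iff)
    have "0 \<le> x \<bullet>\<^sub>r N x" for x
    proof -
      \<comment> \<open>Split x = R x + S N x: positivity of S makes both R x paired with S R x and
        N x paired with S N x nonnegative.\<close>
      have "0 \<le> R x \<bullet>\<^sub>r N x + N x \<bullet>\<^sub>r (x - R x)"
        by (intro add_nonneg_nonneg positive_operD[OF S(2)] SR SN)
      then show ?thesis
        by (simp add: rin.ip_simps rin.ip_commute)
    qed
    moreover have "rin.symmetric N"
      using N(7) by (simp add: rin.symmetric_def \<open>\<And>x. N' x = N x\<close>)
    moreover have "N (N x) = R (x - R x)" for x
      using N(10)[of x] by (simp add: \<open>\<And>x. N' x = N x\<close>)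
    moreover have "(S \<circ>\<^sub>m S) (R x) = Some (x - R x)" for x
      by (simp add: map_comp_Some_iff SR SN)
    ultimately show ?thesis
      using N(1) right_linearD(1)[OF N(2)] N(8,11) by blast
  qed
  obtain R N where N: "injective_contraction R" "bounded_linear N" "rin.symmetric N"
    "\<And>x. 0 \<le> x \<bullet>\<^sub>r N x" "\<And>x. norm (N x) \<le> norm x" "\<And>x. N (N x) = R (x - R x)"
    "\<And>x. (P \<circ>\<^sub>m P) (R x) = Some (x - R x)" "P = oper_quotient R N"
    using root[OF P] by (elim exE conjE) (rule that, (assumption | erule spec)+)
  obtain R' N' where N': "injective_contraction R'" "bounded_linear N'" "rin.symmetric N'"
    "\<And>x. 0 \<le> x \<bullet>\<^sub>r N' x" "\<And>x. norm (N' x) \<le> norm x" "\<And>x. N' (N' x) = R' (x - R' x)"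
    "\<And>x. (Q \<circ>\<^sub>m Q) (R' x) = Some (x - R' x)" "Q = oper_quotient R' N'"
    using root[OF Q] by (elim exE conjE) (rule that, (assumption | erule spec)+)
  \<comment> \<open>Both solve u + P P u = x, and 1 + P P is injective for self-adjoint P.\<close>
  have "R x = R' x" for x
  proof -
    obtain s where s: "P (R x) = Some s" "P s = Some (x - R x)"
      using N(7)[of x] by (auto simp: map_comp_Some_iff)
    obtain t where t: "P (R' x) = Some t" "P t = Some (x - R' x)"
      using N'(7)[of x] unfolding PQ[symmetric] by (auto simp: map_comp_Some_iff)
    have 1: "P (R x - R' x) = Some (s - t)"
      by (intro qlinear_oper_diff P(1) s t)
    have "P (s - t) = Some ((x - R x) - (x - R' x))"
      by (intro qlinear_oper_diff P(1) s t)
    then have "(P\<^sup>\<star>) (s - t) = Some ((x - R x) - (x - R' x))"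
      using P(3) by (simp only: self_adjoint_oper_def)
    from adjointD[OF P(1) _ this 1] P(3)
    have "(norm (s - t))\<^sup>2 + (norm (R x - R' x))\<^sup>2 = 0"
      by (simp add: self_adjoint_oper_def rin.ip_self[symmetric] rin.ip_simps)
    then show ?thesis
      by (simp add: add_nonneg_eq_0_iff)
  qed
  then have "R = R'"
    by auto
  moreover have "N = N'"
    using \<open>R = R'\<close> by (intro rin.positive_sqrt_unique[OF N(2-5) N'(2-4)]) (simp add: N(6) N'(6))
  ultimately show ?thesis
    using N(8) N'(8) by simp
qed

section \<open>Imaginary units commuting with symmetric operators\<close>

text \<open>Test maps \<open>g\<close> are arbitrary bounded real linear maps. For a commuting
  family of symmetric maps this is a commutative real algebra, and closure under sums and products
  follows from the commutation condition without expanding polynomials.\<close>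

definition bicommutant :: "('a::quaternionic_hilbert_space \<Rightarrow> 'a) set \<Rightarrow> ('a \<Rightarrow> 'a) set" where
  "bicommutant \<S> = {f. right_linear f \<and> rin.symmetric f \<and>
     (\<forall>g. bounded_linear g \<longrightarrow> (\<forall>s\<in>\<S>. commutes g s) \<longrightarrow> commutes g f)}"

text \<open>A real form of the range of \<open>P\<close>: the last condition says that the quaternionic
  inner product is real on \<open>M\<close>.\<close>

definition real_form ::
  "('a::quaternionic_hilbert_space \<Rightarrow> 'a) set \<Rightarrow> ('a \<Rightarrow> 'a) \<Rightarrow> 'a set \<Rightarrow> bool" where
  "real_form \<A> P M \<longleftrightarrow> subspace M \<and> (\<forall>m\<in>M. P m = m) \<and> (\<forall>f\<in>\<A>. \<forall>m\<in>M. f m \<in> M) \<and>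
     (\<forall>m\<in>M. \<forall>n\<in>M. \<forall>p. qRe p = 0 \<longrightarrow> m \<bullet>\<^sub>r (n *\<^sub>Q p) = 0)"

lemma real_formD:
  assumes "real_form \<A> P M"
  shows "subspace M" "m \<in> M \<Longrightarrow> P m = m" "f \<in> \<A> \<Longrightarrow> m \<in> M \<Longrightarrow> f m \<in> M"
    "m \<in> M \<Longrightarrow> n \<in> M \<Longrightarrow> qRe p = 0 \<Longrightarrow> m \<bullet>\<^sub>r (n *\<^sub>Q p) = 0"
  using assms unfolding real_form_def by blast+

lemma real_form_closure:
  assumes M: "real_form \<A> P M" and P: "bounded_linear P"
    and \<A>: "\<And>f. f \<in> \<A> \<Longrightarrow> bounded_linear f"
  shows "real_form \<A> P (closure M)"
  unfolding real_form_def
proof (intro conjI ballI allI impI)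
  note D = real_formD[OF M]
  show "subspace (closure M)"
    unfolding subspace_def
  proof (intro conjI ballI allI)
    show "0 \<in> closure M"
      using subspace_0[OF D(1)] closure_subset by blast
    fix x y and r :: real
    assume "x \<in> closure M"
    then obtain u where u: "\<And>n. u n \<in> M" "u \<longlonglongrightarrow> x"
      unfolding closure_sequential by blast
    show "r *\<^sub>R x \<in> closure M"
      unfolding closure_sequential
      by (intro exI[of _ "\<lambda>n. r *\<^sub>R u n"] conjI allI subspace_scale D(1) u tendsto_intros)
    assume "y \<in> closure M"
    then obtain v where v: "\<And>n. v n \<in> M" "v \<longlonglongrightarrow> y"
      unfolding closure_sequential by blast
    show "x + y \<in> closure M"
      unfolding closure_sequential
      by (intro exI[of _ "\<lambda>n. u n + v n"] conjI allI subspace_add D(1) u v tendsto_intros)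
  qed
next
  note D = real_formD[OF M]
  fix x
  assume "x \<in> closure M"
  then obtain u where u: "\<And>n. u n \<in> M" "u \<longlonglongrightarrow> x"
    unfolding closure_sequential by blast
  have "u \<longlonglongrightarrow> P x"
    using bounded_linear.tendsto[OF P u(2)] by (simp add: D(2) u(1))
  then show "P x = x"
    using u(2) by (rule LIMSEQ_unique)
  show "f x \<in> closure M" if "f \<in> \<A>" for f
    unfolding closure_sequential
    by (intro exI[of _ "\<lambda>n. f (u n)"] conjI allI D(3)[OF that u(1)]
        bounded_linear.tendsto[OF \<A>[OF that] u(2)])
  fix y p
  assume "y \<in> closure M" "qRe p = 0"
  then obtain v where v: "\<And>n. v n \<in> M" "v \<longlonglongrightarrow> y"
    unfolding closure_sequential by blast
  have "(\<lambda>n. u n \<bullet>\<^sub>r (v n *\<^sub>Q p)) \<longlonglongrightarrow> x \<bullet>\<^sub>r (y *\<^sub>Q p)"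
    by (rule rin.ip.tendsto[OF u(2) bounded_linear.tendsto[OF bounded_linear_scaleQ v(2)]])
  moreover have "(\<lambda>n. u n \<bullet>\<^sub>r (v n *\<^sub>Q p)) \<longlonglongrightarrow> 0"
    unfolding D(4)[OF u(1) v(1) \<open>qRe p = 0\<close>] by (rule tendsto_const)
  ultimately show "x \<bullet>\<^sub>r (y *\<^sub>Q p) = 0"
    by (rule LIMSEQ_unique)
qed

lemma real_form_Union:
  assumes "\<C> \<noteq> {}" and chain: "subset.chain {M. real_form \<A> P M} \<C>"
  shows "real_form \<A> P (\<Union>\<C>)"
proof -
  have C: "real_form \<A> P M" if "M \<in> \<C>" for M
    using that chain by (auto simp: subset.chain_def)
  have two: "\<exists>M\<in>\<C>. m \<in> M \<and> n \<in> M" if mn: "m \<in> \<Union>\<C>" "n \<in> \<Union>\<C>" for m n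
  proof -
    obtain X Y where XY: "X \<in> \<C>" "m \<in> X" "Y \<in> \<C>" "n \<in> Y"
      using mn by blast
    then have "X \<subseteq> Y \<or> Y \<subseteq> X"
      using chain by (auto simp: subset_chain_def)
    then show ?thesis
      using XY by auto
  qed
  show ?thesis
    unfolding real_form_def subspace_def
  proof (intro conjI ballI allI impI)
    show "0 \<in> \<Union>\<C>"
      using assms(1) C real_formD(1) subspace_0 by blast
  next
    fix m n
    assume "m \<in> \<Union>\<C>" "n \<in> \<Union>\<C>"
    then obtain M where M: "M \<in> \<C>" "m \<in> M" "n \<in> M"
      using two by blast
    then show "m + n \<in> \<Union>\<C>"
      using subspace_add[OF real_formD(1)[OF C]] by blast
    show "m \<bullet>\<^sub>r (n *\<^sub>Q p) = 0" if "qRe p = 0" for p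
      using real_formD(4)[OF C[OF M(1)] M(2,3) that] .
  next
    fix m
    assume "m \<in> \<Union>\<C>"
    then obtain M where M: "M \<in> \<C>" "m \<in> M"
      by blast
    show "r *\<^sub>R m \<in> \<Union>\<C>" for r :: real
      using M subspace_scale[OF real_formD(1)[OF C]] by blast
    show "P m = m"
      using real_formD(2)[OF C[OF M(1)] M(2)] .
    show "f m \<in> \<Union>\<C>" if "f \<in> \<A>" for f
      using M real_formD(3)[OF C that] by blast
  qed
qed

text \<open>In the application \<open>\<S>\<close> consists of \<open>R\<close> and
  \<open>re\<close>, and \<open>P\<close> is the orthogonal projection onto the kernel of
  \<open>im\<close>.\<close>

locale commuting_symmetric =
  fixes \<S> :: "('a::quaternionic_hilbert_space \<Rightarrow> 'a) set" and P :: "'a \<Rightarrow> 'a"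
  assumes S_symmetric: "s \<in> \<S> \<Longrightarrow> right_linear s \<and> rin.symmetric s"
    and S_commutes: "s \<in> \<S> \<Longrightarrow> t \<in> \<S> \<Longrightarrow> commutes s t"
    and P_right_linear: "right_linear P" and P_symmetric: "rin.symmetric P"
    and P_idem: "P (P x) = P x" and P_commutes: "s \<in> \<S> \<Longrightarrow> commutes P s"
begin

lemma bicommutantD:
  assumes "f \<in> bicommutant \<S>"
  shows "right_linear f" "rin.symmetric f" "bounded_linear f" "linear f"
    "f (u *\<^sub>Q p) = f u *\<^sub>Q p" "f x \<bullet>\<^sub>r y = x \<bullet>\<^sub>r f y"
    "bounded_linear g \<Longrightarrow> (\<And>s. s \<in> \<S> \<Longrightarrow> commutes g s) \<Longrightarrow> commutes g f"
  using assms unfolding bicommutant_def right_linear_def rin.symmetric_def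
  by (auto simp: bounded_linear.linear)

lemma S_subset_bicommutant: "\<S> \<subseteq> bicommutant \<S>"
  using S_symmetric by (auto simp: bicommutant_def)

text \<open>Members of \<open>\<S>\<close> commute with each other, so they may test
  \<open>h\<close>; then \<open>h\<close> commutes with all of \<open>\<S>\<close> and may itself
  test \<open>f\<close>.\<close>

lemma bicommutant_commutes:
  assumes "f \<in> bicommutant \<S>" "h \<in> bicommutant \<S>"
  shows "commutes h f"
proof (rule bicommutantD(7)[OF assms(1)])
  show "bounded_linear h"
    using assms(2) by (rule bicommutantD)
  show "commutes h s" if "s \<in> \<S>" for s
    using S_symmetric[OF that] S_commutes[OF that]
    by (intro commutes_sym[OF bicommutantD(7)[OF assms(2)]]) (auto simp: right_linear_def)
qed

lemma P_bicommutant: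
  assumes "f \<in> bicommutant \<S>"
  shows "P (f x) = f (P x)"
  using bicommutantD(7)[OF assms right_linearD(1)[OF P_right_linear] P_commutes]
  by (simp add: commutes_def)

lemma zero_bicommutant: "(\<lambda>x. 0) \<in> bicommutant \<S>"
  by (auto simp: bicommutant_def right_linear_def rin.symmetric_def commutes_def
      rin.ip.zero_left rin.ip.zero_right linear_0 bounded_linear.linear)

lemma id_bicommutant: "(\<lambda>x. x) \<in> bicommutant \<S>"
  by (auto simp: bicommutant_def right_linear_def rin.symmetric_def commutes_def)

lemma add_bicommutant:
  assumes "f \<in> bicommutant \<S>" "h \<in> bicommutant \<S>"
  shows "(\<lambda>x. f x + h x) \<in> bicommutant \<S>"
  using assms
  by (auto simp: bicommutant_def right_linear_def rin.symmetric_def commutes_def rin.ip_simps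
      linear_add bounded_linear.linear scaleQ_add_left intro!: bounded_linear_add)

lemma scaleR_bicommutant:
  assumes "f \<in> bicommutant \<S>"
  shows "(\<lambda>x. r *\<^sub>R f x) \<in> bicommutant \<S>"
  using assms
  by (auto simp: bicommutant_def right_linear_def rin.symmetric_def commutes_def rin.ip_simps
      linear_scale bounded_linear.linear scaleR_scaleQ_assoc
      intro!: bounded_linear_scaleR_right[THEN bounded_linear_compose])

lemma compose_bicommutant:
  assumes "f \<in> bicommutant \<S>" "h \<in> bicommutant \<S>"
  shows "(\<lambda>x. f (h x)) \<in> bicommutant \<S>"
proof -
  have "f (h x) = h (f x)" for x
    using bicommutant_commutes[OF assms(2,1)] by (simp add: commutes_def)
  then show ?thesis
    using assms
    by (auto simp: bicommutant_def right_linear_def rin.symmetric_def commutes_def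
        intro!: bounded_linear_compose[of h f])
qed

text \<open>Adjoining v alone could break invariance, so its whole orbit is adjoined. Products on
  the orbit stay real since f h is again symmetric, and cross terms vanish because the algebra maps
  \<open>M\<close> into itself.\<close>

lemma real_form_extend:
  assumes M: "real_form (bicommutant \<S>) P M" and v: "P v = v"
    and orth: "\<And>m p. m \<in> M \<Longrightarrow> m \<bullet>\<^sub>r (v *\<^sub>Q p) = 0"
  shows "real_form (bicommutant \<S>) P {m + f v | m f. m \<in> M \<and> f \<in> bicommutant \<S>}"
    (is "real_form _ _ ?M'")
proof -
  note D = real_formD[OF M]
  \<comment> \<open>Moving h and then p across the inner product replaces p by its conjugate - p, so
    the value equals its own negative.\<close>
  have sym_0: "v \<bullet>\<^sub>r (h v *\<^sub>Q p) = 0" if h: "h \<in> bicommutant \<S>" and p: "qRe p = 0" for h p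
  proof -
    have "v \<bullet>\<^sub>r (h v *\<^sub>Q p) = h v \<bullet>\<^sub>r (v *\<^sub>Q p)"
      by (simp add: bicommutantD(5,6)[OF h, symmetric])
    also have "\<dots> = v \<bullet>\<^sub>r (h v *\<^sub>Q qcnj p)"
      by (simp add: rin.ip_commute[of "h v"] rin_scaleQ_left)
    also have "qcnj p = - p"
      using p by (simp add: quat_eq_iff qcnj_def uminus_quat_def)
    finally show ?thesis
      by (simp add: scaleQ_minus_right rin.ip.minus_right)
  qed
  have orth': "m \<bullet>\<^sub>r (f v *\<^sub>Q p) = 0" if "m \<in> M" "f \<in> bicommutant \<S>" for m f p
    using orth[OF D(3)[OF that(2,1)]] by (simp add: bicommutantD(5,6)[OF that(2), symmetric])
  have memI: "m + f v \<in> ?M'" if "m \<in> M" "f \<in> bicommutant \<S>" for m f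
    using that by blast
  show ?thesis
    unfolding real_form_def subspace_def
  proof (intro conjI ballI allI impI)
    show "0 \<in> ?M'"
      using memI[OF subspace_0[OF D(1)] zero_bicommutant] by (simp only: add_0)
  next
    fix x y
    assume "x \<in> ?M'" "y \<in> ?M'"
    then obtain m f n h where xy: "x = m + f v" "y = n + h v" "m \<in> M" "n \<in> M"
      "f \<in> bicommutant \<S>" "h \<in> bicommutant \<S>"
      by blast
    have "x + y = (m + n) + (\<lambda>x. f x + h x) v"
      by (simp add: xy)
    then show "x + y \<in> ?M'"
      using memI[OF subspace_add[OF D(1) xy(3,4)] add_bicommutant[OF xy(5,6)]] by (simp only:)
    fix p :: quat
    assume p: "qRe p = 0"
    have "f v \<bullet>\<^sub>r (n *\<^sub>Q p) = 0"
      using orth'[OF xy(4,5), of "qcnj p"] by (simp add: rin.ip_commute[of "f v"] rin_scaleQ_left)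
    moreover have "f v \<bullet>\<^sub>r (h v *\<^sub>Q p) = 0"
      using sym_0[OF compose_bicommutant[OF xy(5,6)] p]
      by (simp add: bicommutantD(5,6)[OF xy(5)])
    ultimately show "x \<bullet>\<^sub>r (y *\<^sub>Q p) = 0"
      using D(4)[OF xy(3,4) p] orth'[OF xy(3,6)]
      by (simp add: xy(1,2) rin.ip_simps scaleQ_add_left)
  next
    fix x
    assume "x \<in> ?M'"
    then obtain m f where x: "x = m + f v" "m \<in> M" "f \<in> bicommutant \<S>"
      by blast
    show "r *\<^sub>R x \<in> ?M'" for r
    proof -
      have "r *\<^sub>R x = r *\<^sub>R m + (\<lambda>x. r *\<^sub>R f x) v"
        by (simp add: x scaleR_add_right)
      then show ?thesis
        using memI[OF subspace_scale[OF D(1) x(2)] scaleR_bicommutant[OF x(3)]] by (simp only:)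
    qed
    show "P x = x"
      using D(2)[OF x(2)] P_bicommutant[OF x(3)] v
      by (simp add: x linear_add[OF bounded_linear.linear[OF right_linearD(1)[OF P_right_linear]]])
    show "h x \<in> ?M'" if h: "h \<in> bicommutant \<S>" for h
    proof -
      have "h x = h m + (\<lambda>x. h (f x)) v"
        by (simp add: x linear_add[OF bicommutantD(4)[OF h]])
      then show ?thesis
        using memI[OF D(3)[OF h x(2)] compose_bicommutant[OF h x(3)]] by (simp only:)
    qed
  qed
qed

text \<open>A maximal real form is closed, since its closure is a real form too. It is total: a
  vector fixed by P and orthogonal to all right multiples of \<open>M\<close> would extend
  \<open>M\<close> by its orbit, hence lie in \<open>M\<close> and be orthogonal to itself.\<close>

theorem exists_total_real_form:
  obtains M where "real_form (bicommutant \<S>) P M" "closed M"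
    "\<And>v. P v = v \<Longrightarrow> \<forall>m\<in>M. \<forall>p. m \<bullet>\<^sub>r (v *\<^sub>Q p) = 0 \<Longrightarrow> v = 0"
proof -
  let ?F = "{M. real_form (bicommutant \<S>) P M}"
  have "P 0 = 0"
    using right_linearD(1)[OF P_right_linear] by (simp add: linear_0 bounded_linear.linear)
  then have "{0} \<in> ?F"
    using bicommutantD(4) by (auto simp: real_form_def subspace_def linear_0 rin.ip.zero_left)
  then have "\<exists>M\<in>?F. \<forall>X\<in>?F. M \<subseteq> X \<longrightarrow> X = M"
    using real_form_Union by (intro subset_Zorn_nonempty) auto
  then obtain M where M: "real_form (bicommutant \<S>) P M"
    and max: "\<And>X. real_form (bicommutant \<S>) P X \<Longrightarrow> M \<subseteq> X \<Longrightarrow> X = M"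
    by blast
  have "real_form (bicommutant \<S>) P (closure M)"
    using M right_linearD(1)[OF P_right_linear] bicommutantD(3) by (rule real_form_closure)
  then have "closure M = M"
    using closure_subset by (rule max)
  then have "closed M"
    by (simp add: closure_eq)
  moreover have "v = 0" if v: "P v = v" and orth: "\<forall>m\<in>M. \<forall>p. m \<bullet>\<^sub>r (v *\<^sub>Q p) = 0" for v
  proof -
    let ?M' = "{m + f v | m f. m \<in> M \<and> f \<in> bicommutant \<S>}"
    have "M \<subseteq> ?M'"
      using zero_bicommutant by force
    then have "?M' = M"
      by (intro max real_form_extend M v) (use orth in blast)
    moreover have "v \<in> ?M'"
      using subspace_0[OF real_formD(1)[OF M]] id_bicommutant
      by (intro CollectI exI[of _ 0] exI[of _ "\<lambda>x. x"]) simp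
    ultimately have "v \<in> M"
      by simp
    then have "v \<bullet>\<^sub>r (v *\<^sub>Q 1) = 0"
      using orth by blast
    then show "v = 0"
      by (simp add: scaleQ_one rin.ip_self)
  qed
  ultimately show thesis
    using that[of M] M by blast
qed

text \<open>If \<open>M\<close> is a total real form of the range of \<open>P\<close>, this range is
  \<open>M \<oplus> Mi \<oplus> Mj \<oplus> Mk\<close>, and \<open>L q\<close> below is the left multiplication \<open>m p \<mapsto> m (q p)\<close>.\<close>

theorem commuting_imaginary_unit:
  obtains j where "right_linear j" "rin.skew j" "\<And>x. j (j x) = - P x"
    "\<And>x. P (j x) = j x" "\<And>x. j (P x) = j x" "\<And>s. s \<in> \<S> \<Longrightarrow> commutes s j"
proof -
  obtain M where M: "real_form (bicommutant \<S>) P M" "closed M"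
    and total: "\<And>v. P v = v \<Longrightarrow> \<forall>m\<in>M. \<forall>p. m \<bullet>\<^sub>r (v *\<^sub>Q p) = 0 \<Longrightarrow> v = 0"
    by (rule exists_total_real_form, rule that)
  note D = real_formD[OF M(1)]
  obtain \<pi> where \<pi>: "bounded_linear \<pi>" "rin.symmetric \<pi>" "\<And>x. \<pi> x \<in> M" "\<And>x. x \<in> M \<Longrightarrow> \<pi> x = x"
    "\<And>x v. v \<in> M \<Longrightarrow> \<pi> x \<bullet>\<^sub>r v = x \<bullet>\<^sub>r v"
    "\<And>x y. y \<in> M \<Longrightarrow> \<forall>v\<in>M. y \<bullet>\<^sub>r v = x \<bullet>\<^sub>r v \<Longrightarrow> \<pi> x = y"
    by (rule rin.orthogonal_projection[OF D(1) M(2)], rule that)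
  interpret \<pi>: bounded_linear \<pi> by fact
  interpret P: bounded_linear P
    using P_right_linear by (rule right_linearD)
  define qi qj qk where "qi = Quat 0 1 0 0" and "qj = Quat 0 0 1 0" and "qk = Quat 0 0 0 1"
  note q_defs = qi_def qj_def qk_def
  \<comment> \<open>For x = m0 + m1 i + m2 j + m3 k with all components in \<open>M\<close>,
    projecting x, - x i, - x j and - x k returns m0, m1, m2, m3, because \<pi> maps m p to the real
    part of p times m. The four terms multiply these components by q, q i, q j, q k.\<close>
  define L where "L q x = \<pi> x *\<^sub>Q q + \<pi> (x *\<^sub>Q - qi) *\<^sub>Q (q * qi) + \<pi> (x *\<^sub>Q - qj) *\<^sub>Q (q * qj) +
    \<pi> (x *\<^sub>Q - qk) *\<^sub>Q (q * qk)" for q x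
  note quat_simps = quat_eq_iff times_quat_def plus_quat_def uminus_quat_def one_quat_def
    zero_quat_def of_real_quat qcnj_def q_defs scaleR_quat_def
  have L_lin: "bounded_linear (L q)" for q
    unfolding L_def
    by (intro bounded_linear_add bounded_linear_compose[OF bounded_linear_scaleQ]
        bounded_linear_compose[OF \<pi>(1)] bounded_linear_scaleQ \<pi>(1))
  have ip_M: "m \<bullet>\<^sub>r (n *\<^sub>Q p) = qRe p * (m \<bullet>\<^sub>r n)" if "m \<in> M" "n \<in> M" for m n p
  proof -
    have "p = of_real (qRe p) + (p - of_real (qRe p))"
      by simp
    moreover have "m \<bullet>\<^sub>r (n *\<^sub>Q (p - of_real (qRe p))) = 0"
      by (rule D(4)[OF that]) (simp add: minus_quat_def of_real_quat)
    ultimately show ?thesis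
      by (metis add.right_neutral rin.ip_add_right rin.ip_scaleR_right scaleQ_add_right scaleR_scaleQ)
  qed
  have \<pi>_M: "\<pi> (m *\<^sub>Q p) = qRe p *\<^sub>R m" if "m \<in> M" for m p
  proof (rule \<pi>(6))
    show "qRe p *\<^sub>R m \<in> M"
      by (intro subspace_scale D(1) that)
    show "\<forall>v\<in>M. (qRe p *\<^sub>R m) \<bullet>\<^sub>r v = (m *\<^sub>Q p) \<bullet>\<^sub>r v"
    proof
      fix v
      assume "v \<in> M"
      then show "(qRe p *\<^sub>R m) \<bullet>\<^sub>r v = (m *\<^sub>Q p) \<bullet>\<^sub>r v"
        using ip_M[OF _ that, of v p] by (simp add: rin.ip_scaleR_right rin.ip_commute[of _ v])
    qed
  qed
  have L_M: "L q (m *\<^sub>Q p) = m *\<^sub>Q (q * p)" if "m \<in> M" for q m p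
  proof -
    have "L q (m *\<^sub>Q p) = m *\<^sub>Q (of_real (qRe p) * q + of_real (qRe (p * - qi)) * (q * qi) +
        of_real (qRe (p * - qj)) * (q * qj) + of_real (qRe (p * - qk)) * (q * qk))"
      unfolding L_def scaleQ_scaleQ \<pi>_M[OF that]
      by (simp only: scaleR_scaleQ scaleQ_scaleQ scaleQ_add_right)
    also have "of_real (qRe p) * q + of_real (qRe (p * - qi)) * (q * qi) +
        of_real (qRe (p * - qj)) * (q * qj) + of_real (qRe (p * - qk)) * (q * qk) = q * p"
      by (simp add: quat_simps algebra_simps)
    finally show ?thesis .
  qed
  have P_M: "P (m *\<^sub>Q p) = m *\<^sub>Q p" if "m \<in> M" for m p
    using D(2)[OF that] by (simp add: right_linearD(2)[OF P_right_linear])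
  have PL: "P (L q x) = L q x" for q x
    by (simp add: L_def P.add P_M \<pi>(3))
  have \<pi>P: "\<pi> (P x) = \<pi> x" for x
    by (rule \<pi>(6)) (simp_all add: \<pi>(3,5) rin.symmetricD[OF P_symmetric] D(2))
  have LP: "L q (P x) = L q x" for q x
    by (simp add: L_def \<pi>P right_linearD(2)[OF P_right_linear, symmetric])
  \<comment> \<open>Expansion of the range of \<open>P\<close> over the real form: the difference is
    orthogonal to every right multiple of \<open>M\<close>, so totality makes it vanish.\<close>
  have L_1: "L 1 x = P x" for x
  proof -
    have "P x - L 1 x = 0"
    proof (rule total)
      show "P (P x - L 1 x) = P x - L 1 x"
        by (simp add: P.diff PL P_idem)
      show "\<forall>m\<in>M. \<forall>p. m \<bullet>\<^sub>r ((P x - L 1 x) *\<^sub>Q p) = 0"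
      proof (intro ballI allI)
        fix m p
        assume m: "m \<in> M"
        have P': "m \<bullet>\<^sub>r (P x *\<^sub>Q p) = m \<bullet>\<^sub>r (x *\<^sub>Q p)"
          using rin.symmetricD[OF P_symmetric, of m "x *\<^sub>Q p"] D(2)[OF m]
          by (simp add: right_linearD(2)[OF P_right_linear])
        have \<pi>': "m \<bullet>\<^sub>r (\<pi> y *\<^sub>Q r) = m \<bullet>\<^sub>r (y *\<^sub>Q of_real (qRe r))" for y r
          using ip_M[OF m \<pi>(3)] \<pi>(5)[OF m]
          by (simp add: scaleQ_of_real rin.ip_simps rin.ip_commute[of m])
        have "m \<bullet>\<^sub>r (L 1 x *\<^sub>Q p) = m \<bullet>\<^sub>r (x *\<^sub>Q (of_real (qRe p) + - qi * of_real (qRe (qi * p)) +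
            - qj * of_real (qRe (qj * p)) + - qk * of_real (qRe (qk * p))))"
          by (simp only: L_def mult_1_left scaleQ_add_left scaleQ_scaleQ rin.ip.add_right \<pi>'
              scaleQ_add_right)
        also have "of_real (qRe p) + - qi * of_real (qRe (qi * p)) +
            - qj * of_real (qRe (qj * p)) + - qk * of_real (qRe (qk * p)) = p"
          by (simp add: quat_simps)
        finally show "m \<bullet>\<^sub>r ((P x - L 1 x) *\<^sub>Q p) = 0"
          by (simp add: scaleQ_diff_left rin.ip_simps P')
      qed
    qed
    then show ?thesis
      by simp
  qed
  \<comment> \<open>Expanding P x over the real form reduces this to associativity of the quaternion
    product.\<close>
  have L_comp: "L q (P x *\<^sub>Q p) = L q x *\<^sub>Q p" for q x p
    unfolding L_1[of x, symmetric]
    unfolding L_def[of 1 x] L_def[of q x]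
    by (simp add: scaleQ_add_left scaleQ_scaleQ linear_add[OF bounded_linear.linear[OF L_lin]]
        L_M \<pi>(3) mult.assoc)
  have LL: "L q (L r x) = L (q * r) x" for q r x
    unfolding L_def[of r x] L_def[of "q * r" x]
    by (simp add: linear_add[OF bounded_linear.linear[OF L_lin]] L_M \<pi>(3) mult.assoc)
  show thesis
  proof (rule that[of "L qi"])
    show "right_linear (L qi)"
      unfolding right_linear_def
      using L_lin L_comp LP[of qi "u *\<^sub>Q q" for u q]
      by (simp add: right_linearD(2)[OF P_right_linear])
    show "L qi (L qi x) = - P x" for x
    proof -
      have "qi * qi = - 1"
        by (simp add: quat_simps)
      then have "L qi (L qi x) = - L 1 x"
        by (simp add: LL) (simp add: L_def scaleQ_minus_right)
      then show ?thesis
        by (simp add: L_1)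
    qed
    show "P (L qi x) = L qi x" "L qi (P x) = L qi x" for x
      by (rule PL, rule LP)
    show "commutes s (L qi)" if "s \<in> \<S>" for s
    proof -
      have s: "s \<in> bicommutant \<S>"
        using that S_subset_bicommutant by blast
      \<comment> \<open>A symmetric map leaving \<open>M\<close> invariant commutes with the
        projection; right linearity takes care of the remaining factors of L.\<close>
      have "commutes s \<pi>"
        by (rule rin.orthogonal_projection_commutes[OF D(1) \<pi>(2,3,6,5) bicommutantD(2)[OF s] D(3)[OF s]])
      then show ?thesis
        unfolding commutes_def L_def
        by (simp add: linear_add[OF bicommutantD(4)[OF s]] bicommutantD(5)[OF s])
    qed
    show "rin.skew (L qi)"
      unfolding rin.skew_def
    proof (intro allI)
      fix x y
      \<comment> \<open>With this rule, transposing \<open>L qi\<close> exchanges its first two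
        terms and its last two terms, each with a change of sign.\<close>
      have \<pi>': "(\<pi> (x *\<^sub>Q p) *\<^sub>Q q) \<bullet>\<^sub>r y = x \<bullet>\<^sub>r (\<pi> (y *\<^sub>Q qcnj q) *\<^sub>Q qcnj p)" for p q
        by (simp add: rin_scaleQ_left rin.symmetricD[OF \<pi>(2)])
      have q: "qi * qi = - 1" "qi * qj = qk" "qi * qk = - qj" "qcnj qi = - qi" "qcnj qj = - qj"
        "qcnj qk = - qk" "qcnj 1 = 1" "qcnj (- r) = - qcnj r" for r
        by (simp_all add: quat_simps)
      have "L qi x \<bullet>\<^sub>r y = (\<pi> (x *\<^sub>Q 1) *\<^sub>Q qi) \<bullet>\<^sub>r y + (\<pi> (x *\<^sub>Q - qi) *\<^sub>Q - 1) \<bullet>\<^sub>r y +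
          (\<pi> (x *\<^sub>Q - qj) *\<^sub>Q qk) \<bullet>\<^sub>r y + (\<pi> (x *\<^sub>Q - qk) *\<^sub>Q - qj) \<bullet>\<^sub>r y"
        by (simp add: L_def q rin.ip_simps scaleQ_one)
      also have "\<dots> = x \<bullet>\<^sub>r (\<pi> (y *\<^sub>Q - qi) + \<pi> (y *\<^sub>Q - 1) *\<^sub>Q qi + \<pi> (y *\<^sub>Q - qk) *\<^sub>Q qj +
          \<pi> (y *\<^sub>Q qj) *\<^sub>Q qk)"
        unfolding \<pi>' by (simp add: q rin.ip_simps scaleQ_one)
      also have "\<dots> = - (x \<bullet>\<^sub>r L qi y)"
        by (simp add: L_def q rin.ip_simps scaleQ_one scaleQ_minus_right scaleQ_minus_left \<pi>.neg)
      finally show "L qi x \<bullet>\<^sub>r y = - (x \<bullet>\<^sub>r L qi y)" .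
    qed
  qed
qed

end

section \<open>The Cartesian decomposition\<close>

lemma oper_add_Some_iff:
  "(T +\<^sub>o S) u = Some w \<longleftrightarrow> (\<exists>p q. T u = Some p \<and> S u = Some q \<and> w = p + q)"
  by (auto simp: oper_add_def)

lemma oper_diff_Some_iff:
  "(T -\<^sub>o S) u = Some w \<longleftrightarrow> (\<exists>p q. T u = Some p \<and> S u = Some q \<and> w = p - q)"
  by (auto simp: oper_diff_def)

lemma oper_uminus_Some_iff: "(-\<^sub>o T) u = Some w \<longleftrightarrow> T u = Some (- w)"
  by (auto simp: oper_uminus_def)

lemma oper_scale_Some_iff: "(T *\<^sub>o r) u = Some w \<longleftrightarrow> (\<exists>p. T u = Some p \<and> w = r *\<^sub>R p)"
  by (auto simp: oper_scale_def scaleQ_of_real)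

lemma Some_comp_iff: "((\<lambda>u. Some (j u)) \<circ>\<^sub>m B) u = Some w \<longleftrightarrow> (\<exists>s. B u = Some s \<and> w = j s)"
  by (auto simp: map_comp_Some_iff)

lemma comp_Some_iff: "(B \<circ>\<^sub>m (\<lambda>u. Some (j u))) u = B (j u)"
  by (simp add: map_comp_def)

lemma qlinear_total: "right_linear j \<Longrightarrow> qlinear_oper (\<lambda>u. Some (j u))"
  by (intro qlinear_operI)
    (auto simp: right_linear_def linear_0 linear_add bounded_linear.linear)

lemma densely_defined_total: "densely_defined (\<lambda>u. Some (j u))"
  by (simp add: densely_defined_def dom_def)

lemma imaginary_unit_operI:
  assumes j: "right_linear j" "rin.skew j" "\<And>u. j (j u) = - u"
  shows "bounded_oper (\<lambda>u. Some (j u))" "anti_self_adjoint_oper (\<lambda>u. Some (j u))"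
    "unitary_oper (\<lambda>u. Some (j u))"
proof -
  interpret j: bounded_linear j
    using j(1) by (rule right_linearD)
  show "bounded_oper (\<lambda>u. Some (j u))"
    unfolding bounded_oper_def using qlinear_total[OF j(1)] j.bounded
    by (auto simp: dom_def mult.commute)
  have adj: "(\<lambda>u. Some (j u))\<^sup>\<star> = (\<lambda>u. Some (- j u))"
  proof (rule oper_eqI)
    fix u w
    have "((\<lambda>u. Some (j u))\<^sup>\<star>) u = Some w \<longleftrightarrow> (\<forall>v. u \<bullet>\<^sub>r j v = w \<bullet>\<^sub>r v)"
      by (simp add: adjoint_iff[OF qlinear_total[OF j(1)] densely_defined_total])
    also have "\<dots> \<longleftrightarrow> (\<forall>v. (- j u) \<bullet>\<^sub>r v = w \<bullet>\<^sub>r v)"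
      by (simp add: rin.ip.minus_left rin.skewD[OF j(2)])
    also have "\<dots> \<longleftrightarrow> - j u = w"
      using rin.ip_eqD by blast
    finally show "((\<lambda>u. Some (j u))\<^sup>\<star>) u = Some w \<longleftrightarrow> Some (- j u) = Some w"
      by simp
  qed
  show "anti_self_adjoint_oper (\<lambda>u. Some (j u))"
    unfolding anti_self_adjoint_oper_def adj
    by (simp add: densely_defined_total oper_uminus_def)
  show "unitary_oper (\<lambda>u. Some (j u))"
    unfolding unitary_oper_def adj by (auto simp: map_comp_def dom_def j(3) j.neg)
qed

lemma imaginary_unit_operE:
  assumes "bounded_oper J" "anti_self_adjoint_oper J" "unitary_oper J"
  obtains j where "J = (\<lambda>u. Some (j u))" "right_linear j" "rin.skew j" "\<And>u. j (j u) = - u"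
proof -
  define j where "j u = the (J u)" for u
  have lin: "qlinear_oper J" and dom: "dom J = UNIV"
    using assms(1) by (auto simp: bounded_oper_def)
  have J: "J u = Some (j u)" for u
    using dom unfolding j_def by (metis UNIV_I domD option.sel)
  have adj: "(J\<^sup>\<star>) u = Some (- j u)" for u
    using assms(2) J by (simp add: anti_self_adjoint_oper_def oper_uminus_def)
  have "right_linear j"
    unfolding right_linear_def
  proof (intro conjI allI)
    show jq: "j (u *\<^sub>Q q) = j u *\<^sub>Q q" for u q
      using qlinear_oper_scaleQ[OF lin J, of u q] by (simp add: J)
    obtain K where "\<And>u. norm (the (J u)) \<le> K * norm u"
      using assms(1) by (auto simp: bounded_oper_def)
    then show "bounded_linear j"
      using qlinear_oper_add[OF lin J J] jq
      by (intro bounded_linear_intro[of j K]) (auto simp: J scaleR_scaleQ mult.commute)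
  qed
  moreover have "rin.skew j"
    unfolding rin.skew_def
  proof (intro allI)
    fix x y
    have "densely_defined J"
      using assms(2) by (simp add: anti_self_adjoint_oper_def)
    then show "j x \<bullet>\<^sub>r y = - (x \<bullet>\<^sub>r j y)"
      using adjointD[OF lin _ adj J, of x y] by (simp add: rin.ip.minus_left)
  qed
  moreover have "j (j u) = - u" for u
  proof -
    have "(J \<circ>\<^sub>m J\<^sup>\<star>) u = Some u"
      using assms(3) by (simp add: unitary_oper_def)
    then have "j (- j u) = u"
      by (simp add: map_comp_def adj J)
    then have "j (j (- j u)) = j u"
      by simp
    moreover have "j (- v) = - j v" for v
      using \<open>right_linear j\<close> by (simp add: right_linear_def linear_neg bounded_linear.linear)
    ultimately show ?thesis
      using \<open>j (- j u) = u\<close> by (metis minus_minus)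
  qed
  ultimately show thesis
    using J by (intro that[of j] ext)
qed

lemma oper_abs_eqI:
  assumes "qlinear_oper P" "positive_oper P" "self_adjoint_oper P" "P \<circ>\<^sub>m P = S\<^sup>\<star> \<circ>\<^sub>m S"
  shows "oper_abs S = P"
  unfolding oper_abs_def
proof (rule the_equality)
  show "qlinear_oper P \<and> densely_defined P \<and> positive_oper P \<and> self_adjoint_oper P \<and>
      P \<circ>\<^sub>m P = S\<^sup>\<star> \<circ>\<^sub>m S"
    using assms by (simp add: self_adjoint_oper_def)
  show "Q = P" if "qlinear_oper Q \<and> densely_defined Q \<and> positive_oper Q \<and> self_adjoint_oper Q \<and>
      Q \<circ>\<^sub>m Q = S\<^sup>\<star> \<circ>\<^sub>m S" for Q
    using that assms by (elim conjE) (rule positive_root_unique, simp_all)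
qed

section \<open>Positivity, products and commutation of quotients\<close>

context injective_contraction
begin

lemma neg_eqD: "- x = R y \<Longrightarrow> x = R (- y)"
  unfolding neg by (rule minus_equation_iff[THEN iffD1, symmetric])

text \<open>The root r of R commutes with b, so R x paired with b x equals r x paired with b r x.
  Smoothing carries the inequality over to every u with b u = R w.\<close>

lemma nonneg_quotient:
  assumes b: "bounded_linear b" "commutes b R" and nonneg: "\<And>x. 0 \<le> x \<bullet>\<^sub>r b x"
    and "b u = R w"
  shows "0 \<le> u \<bullet>\<^sub>r w"
proof -
  obtain r where r: "bounded_linear r" "rin.symmetric r" "\<And>x. 0 \<le> x \<bullet>\<^sub>r r x" "\<And>x. r (r x) = R x"
    "\<And>x. norm (x - r x) \<le> norm x"
    "\<And>f. bounded_linear f \<Longrightarrow> commutes f R \<Longrightarrow> commutes f r"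
    by (rule rin.positive_sqrt[OF bounded_linear symmetric contraction], rule that)
  have Rb: "0 \<le> R x \<bullet>\<^sub>r b x" for x
  proof -
    have "R x \<bullet>\<^sub>r b x = r x \<bullet>\<^sub>r b (r x)"
      by (simp only: r(4)[symmetric] rin.symmetricD[OF r(2)] commutesD[OF r(6)[OF b]])
    then show ?thesis
      using nonneg by simp
  qed
  obtain G :: "nat \<Rightarrow> 'a \<Rightarrow> 'a" where G: "\<And>n f x. linear f \<Longrightarrow> commutes f R \<Longrightarrow> f (G n x) = G n (f x)"
    "\<And>x. (\<lambda>n. R (G n x)) \<longlonglongrightarrow> x"
    by (rule approximate_identity, rule that)
  have "commutes R R"
    by (simp add: commutes_def)
  then have "b (G n u) = R (G n w)" for n
    by (simp only: G(1)[OF bounded_linear.linear[OF b(1)] b(2)] G(1)[OF linear_axioms] \<open>b u = R w\<close>)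
  then have "0 \<le> R (G n u) \<bullet>\<^sub>r R (G n w)" for n
    using Rb[of "G n u"] by simp
  then show ?thesis
    by (intro LIMSEQ_le_const[OF rin.ip.tendsto[OF G(2) G(2)]]) auto
qed

text \<open>Makes R^2 available as a denominator, namely that of the product of two
  quotients.\<close>

lemma compose_self: "injective_contraction (\<lambda>x. R (R x))"
proof
  show "right_linear (\<lambda>x. R (R x))"
    using right_linearD(2)[OF right_linear]
    by (auto simp: right_linear_def intro: bounded_linear_compose[OF bounded_linear bounded_linear])
  show "rin.symmetric (\<lambda>x. R (R x))"
    using symmetric by (simp add: rin.symmetric_def)
  show "inj (\<lambda>x. R (R x))"
    using inj_compose[OF inj inj] by (simp add: comp_def)
  show "norm (R (R x)) \<le> norm x" for x
    using norm_le[of x] norm_le[of "R x"] by linarith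
  show "norm (x - R (R x)) \<le> norm x" for x
  proof (rule power2_le_imp_le)
    have "x \<bullet>\<^sub>r R (R x) = (norm (R x))\<^sup>2"
      by (simp add: rin.symmetricD[OF symmetric, symmetric] rin.ip_self)
    moreover have "(norm (R (R x)))\<^sup>2 \<le> (norm (R x))\<^sup>2"
      using norm_le by (simp add: power_mono)
    ultimately show "(norm (x - R (R x)))\<^sup>2 \<le> (norm x)\<^sup>2"
      using zero_le_power2[of "norm (R x)"] unfolding rin.norm_diff_square by linarith
  qed simp
qed

text \<open>The range of R^2 lies in the domain of the product and serves as a core. For commuting a
  and b, both orders of the product then have the same closure.\<close>

lemma closure_compose_quotient:
  assumes a: "bounded_linear a" "commutes a R" and b: "bounded_linear b" "commutes b R"
  shows "closure (Map.graph (oper_quotient R a \<circ>\<^sub>m oper_quotient R b)) =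
    Map.graph (oper_quotient (\<lambda>x. R (R x)) (\<lambda>x. a (b x)))"
proof -
  interpret RR: injective_contraction "\<lambda>x. R (R x)"
    by (rule compose_self)
  show ?thesis
  proof (rule RR.closure_graph_eq_quotient)
    show "bounded_linear (\<lambda>x. a (b x))"
      by (rule bounded_linear_compose[OF a(1) b(1)])
    show "commutes (\<lambda>x. a (b x)) (\<lambda>x. R (R x))"
      using a(2) b(2) by (simp add: commutes_def)
    show "a (b u) = R (R w)"
      if "(oper_quotient R a \<circ>\<^sub>m oper_quotient R b) u = Some w" for u w
      using that a(2) by (auto simp: map_comp_Some_iff quotient_iff commutes_def)
    show "(oper_quotient R a \<circ>\<^sub>m oper_quotient R b) (R (R x)) = Some (a (b x))" for x
    proof -
      have "oper_quotient R b (R (R x)) = Some (R (b x))"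
        using b(2) by (simp add: quotient_iff commutes_def)
      moreover have "oper_quotient R a (R (b x)) = Some (a (b x))"
        by (rule quotient_R[OF a(2)])
      ultimately show ?thesis
        by (simp add: map_comp_Some_iff)
    qed
  qed
qed

text \<open>Since j has the inverse - j and commutes with a and R, the equation a (j u) = R w can be
  solved backwards; this makes the two domains equal.\<close>

lemma quotient_commutes_total:
  assumes "commutes a j" "commutes R j" and j: "\<And>u. j (j u) = - u" "linear j" and a: "linear a"
  shows "oper_quotient R a \<circ>\<^sub>m (\<lambda>u. Some (j u)) = (\<lambda>u. Some (j u)) \<circ>\<^sub>m oper_quotient R a"
proof (rule oper_eqI)
  fix u w
  have "a (j u) = R w \<longleftrightarrow> a u = R (- j w)"
  proof
    assume "a (j u) = R w"
    then have "j (j (a u)) = j (R w)"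
      using assms(1) by (simp add: commutes_def)
    then have "- a u = R (j w)"
      using assms(2) j(1) by (simp add: commutes_def)
    then show "a u = R (- j w)"
      by (rule neg_eqD)
  next
    assume "a u = R (- j w)"
    then have "j (a u) = R (- j (j w))"
      using assms(2) linear_neg[OF j(2)] by (simp add: commutes_def neg)
    then show "a (j u) = R w"
      using assms(1) j(1) by (simp add: commutes_def)
  qed
  moreover have "(\<exists>s. a u = R s \<and> w = j s) \<longleftrightarrow> a u = R (- j w)"
    using j(1) linear_neg[OF j(2)] by (metis minus_minus)
  ultimately show "(oper_quotient R a \<circ>\<^sub>m (\<lambda>u. Some (j u))) u = Some w \<longleftrightarrow>
      ((\<lambda>u. Some (j u)) \<circ>\<^sub>m oper_quotient R a) u = Some w"
    by (simp add: comp_Some_iff Some_comp_iff quotient_iff)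
qed

end

text \<open>The canonical form of a normal operator \<open>R\<^sup>-\<^sup>1N\<close> with adjoint \<open>R\<^sup>-\<^sup>1N'\<close>.\<close>

locale normal_quotient = injective_contraction R
  for R :: "'a::quaternionic_hilbert_space \<Rightarrow> 'a" +
  fixes N N' :: "'a \<Rightarrow> 'a"
  assumes N: "right_linear N" and N': "right_linear N'"
    and N_R: "commutes N R" and N'_R: "commutes N' R" and N_N': "commutes N N'"
    and adj: "N x \<bullet>\<^sub>r y = x \<bullet>\<^sub>r N' y"
    and norm_N: "norm (N x) \<le> norm x" and norm_N': "norm (N' x) = norm (N x)"
begin

text \<open>Numerators of the closures of half the sum and half the difference of T and its adjoint;
  \<open>im\<close> is skew, and the numerator of B comes from its polar decomposition.\<close>

definition re where "re x = (1/2) *\<^sub>R (N x + N' x)"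
definition im where "im x = (1/2) *\<^sub>R (N x - N' x)"

lemma N_eq: "N x = re x + im x" and N'_eq: "N' x = re x - im x"
proof -
  have "re x + im x = (1/2) *\<^sub>R (N x + N x)" "re x - im x = (1/2) *\<^sub>R (N' x + N' x)"
    unfolding re_def im_def scaleR_add_right[symmetric] scaleR_diff_right[symmetric] by simp_all
  then show "N x = re x + im x" "N' x = re x - im x"
    by (simp_all add: scaleR_2[symmetric])
qed

lemma right_linear_re: "right_linear re" and right_linear_im: "right_linear im"
  unfolding re_def im_def right_linear_def
  using right_linearD[OF N] right_linearD[OF N']
  by (auto simp: scaleR_scaleQ_assoc scaleQ_add_left scaleQ_diff_left
      intro!: bounded_linear_compose[OF bounded_linear_scaleR_right] bounded_linear_add bounded_linear_sub)

lemma commutes_re_im: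
  assumes "linear f" "commutes f N" "commutes f N'"
  shows "commutes f re" "commutes f im"
  using assms
  by (auto simp: commutes_def re_def im_def linear_scale linear_add linear_diff)

lemma re_R: "commutes re R" and im_R: "commutes im R"
  using commutes_re_im[OF linear_axioms] N_R N'_R by (auto intro: commutes_sym)

lemma re_im: "commutes re im"
proof -
  have "commutes N im" "commutes N' im"
    using commutes_re_im(2) N_N' right_linearD(1)[OF N] right_linearD(1)[OF N']
    by (auto simp: commutes_def bounded_linear.linear)
  then show ?thesis
    using commutes_re_im(1)[of im] right_linearD(1)[OF right_linear_im]
    by (auto simp: bounded_linear.linear intro: commutes_sym)
qed

lemma symmetric_re: "rin.symmetric re" and skew_im: "rin.skew im"
proof -
  have "N' x \<bullet>\<^sub>r y = x \<bullet>\<^sub>r N y" for x y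
    using adj[of y x] by (simp add: rin.ip_commute)
  then show "rin.symmetric re" "rin.skew im"
    by (simp_all add: rin.symmetric_def rin.skew_def re_def im_def rin.ip_simps adj field_simps)
qed

lemma norm_im: "norm (im x) \<le> norm x"
  using norm_triangle_ineq4[of "N x" "N' x"] norm_N[of x] norm_N'[of x] by (simp add: im_def)

lemma dom_eq: "dom (oper_quotient R N) = dom (oper_quotient R N')"
  using dom_quotient_subset[of N N'] dom_quotient_subset[of N' N]
    right_linearD(1)[OF N] right_linearD(1)[OF N'] N_R N'_R norm_N' by auto

text \<open>The forward direction carries the domain identity in T = A + JB: \<open>dom_eq\<close>
  supplies a value of the adjoint at u, so the half sum and the half difference both have values at
  u.\<close>

lemma quotient_N_iff:
  "oper_quotient R N u = Some w \<longleftrightarrow> (\<exists>p q. re u = R p \<and> im u = R q \<and> w = p + q)"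
proof
  assume w: "oper_quotient R N u = Some w"
  then obtain w' where "oper_quotient R N' u = Some w'"
    using dom_eq by (metis domD domI)
  then have "re u = R ((1/2) *\<^sub>R (w + w'))" "im u = R ((1/2) *\<^sub>R (w - w'))"
    using w by (simp_all add: quotient_iff re_def im_def scale add diff)
  moreover have "w = (1/2) *\<^sub>R (w + w') + (1/2) *\<^sub>R (w - w')"
    by (simp add: scaleR_add_right[symmetric] scaleR_2[symmetric])
  ultimately show "\<exists>p q. re u = R p \<and> im u = R q \<and> w = p + q"
    by blast
next
  assume "\<exists>p q. re u = R p \<and> im u = R q \<and> w = p + q"
  then show "oper_quotient R N u = Some w"
    by (auto simp: quotient_iff N_eq add)
qed

lemma closure_graph_half_sum:
  "closure (Map.graph ((oper_quotient R N +\<^sub>o oper_quotient R N') *\<^sub>o (1/2))) =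
    Map.graph (oper_quotient R re)"
  by (rule closure_graph_eq_quotient[OF right_linearD(1)[OF right_linear_re] re_R])
    (auto simp: oper_scale_Some_iff oper_add_Some_iff quotient_iff re_def scale add
      commutesD[OF N_R] commutesD[OF N'_R])

lemma closure_graph_half_diff:
  "closure (Map.graph ((oper_quotient R N -\<^sub>o oper_quotient R N') *\<^sub>o (1/2))) =
    Map.graph (oper_quotient R im)"
  by (rule closure_graph_eq_quotient[OF right_linearD(1)[OF right_linear_im] im_R])
    (auto simp: oper_scale_Some_iff oper_diff_Some_iff quotient_iff im_def scale diff
      commutesD[OF N_R] commutesD[OF N'_R])

text \<open>Stated without the factor 1/2, since the kernel of this closure occurs in the uniqueness
  of J.\<close>

lemma closure_graph_diff:
  "closure (Map.graph (oper_quotient R N -\<^sub>o oper_quotient R N')) =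
    Map.graph (oper_quotient R (\<lambda>x. 2 *\<^sub>R im x))"
proof (rule closure_graph_eq_quotient)
  show "bounded_linear (\<lambda>x. 2 *\<^sub>R im x)"
    by (intro bounded_linear_compose[OF bounded_linear_scaleR_right]
        right_linearD(1)[OF right_linear_im])
  show "commutes (\<lambda>x. 2 *\<^sub>R im x) R"
    using im_R by (simp add: commutes_def scale)
qed (auto simp: oper_diff_Some_iff quotient_iff im_def diff commutesD[OF N_R] commutesD[OF N'_R])

lemma self_adjoint_quotient:
  assumes "right_linear f" "commutes f R" "rin.symmetric f"
  shows "self_adjoint_oper (oper_quotient R f)"
  unfolding self_adjoint_oper_def
  using assms densely_defined_quotient adjoint_quotient[of f f] right_linearD(1)[OF assms(1)]
  by (auto simp: rin.symmetric_def)

lemma adjoint_quotient_im: "(oper_quotient R im)\<^sup>\<star> = -\<^sub>o oper_quotient R im"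
proof -
  have "(oper_quotient R im)\<^sup>\<star> = oper_quotient R (\<lambda>x. - im x)"
  proof (rule adjoint_quotient[OF right_linear_im im_R])
    show "bounded_linear (\<lambda>x. - im x)"
      by (intro bounded_linear_minus right_linearD(1)[OF right_linear_im])
    show "commutes (\<lambda>x. - im x) R"
      using im_R by (simp add: commutes_def neg)
    show "im x \<bullet>\<^sub>r y = x \<bullet>\<^sub>r - im y" for x y
      using skew_im by (simp add: rin.skew_def rin.ip.minus_right)
  qed
  also have "\<dots> = -\<^sub>o oper_quotient R im"
    by (rule oper_eqI) (auto simp: oper_uminus_Some_iff quotient_iff neg minus_equation_iff)
  finally show ?thesis .
qed

text \<open>The last condition puts the orthogonal complement of the kernel of \<open>im\<close>
  into the closure of the range of \<open>b\<close>, where the product JB determines J.\<close>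

definition polar :: "('a \<Rightarrow> 'a) \<Rightarrow> ('a \<Rightarrow> 'a) \<Rightarrow> bool" where
  "polar b j \<longleftrightarrow> right_linear b \<and> rin.symmetric b \<and> (\<forall>x. 0 \<le> x \<bullet>\<^sub>r b x) \<and> commutes b R \<and>
     commutes b re \<and> right_linear j \<and> rin.skew j \<and> (\<forall>x. j (j x) = - x) \<and>
     commutes j R \<and> commutes j re \<and> (\<forall>x. j (b x) = im x) \<and> (\<forall>x. b (j x) = im x) \<and>
     (\<forall>u. (\<forall>v. im v = 0 \<longrightarrow> u \<bullet>\<^sub>r v = 0) \<longrightarrow> u \<in> closure (range b))"

text \<open>On the orthogonal complement of the kernel of \<open>im\<close> the unit \<open>j\<close> is forced by the polar
  decomposition; on the kernel any imaginary unit commuting with \<open>R\<close> and \<open>re\<close> will do.\<close>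

lemma exists_polar:
  obtains b j where "polar b j"
proof -
  obtain b k P where b: "bounded_linear b" "rin.symmetric b" "\<And>x. 0 \<le> x \<bullet>\<^sub>r b x"
    "\<And>x. norm (b x) = norm (im x)"
    and k: "bounded_linear k" "rin.skew k" "\<And>x. k (b x) = im x" "\<And>x. k (k x) = P x - x"
    and P: "bounded_linear P" "rin.symmetric P" "\<And>x. im (P x) = 0" "\<And>x. im x = 0 \<Longrightarrow> P x = x"
    "\<And>x. k (P x) = 0" "\<And>x. P (k x) = 0" "\<And>x. x - P x \<in> closure (range b)"
    and comm: "\<And>f. bounded_linear f \<Longrightarrow> commutes f im \<Longrightarrow> commutes f b \<and> commutes f k \<and> commutes f P"
    by (rule rin.skew_polar_decomposition[OF right_linearD(1)[OF right_linear_im] skew_im norm_im],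
        rule that)
  interpret b: bounded_linear b by fact
  interpret k: bounded_linear k by fact
  \<comment> \<open>Right multiplications are bounded, real linear and commute with
    \<open>im\<close>, so \<open>comm\<close> makes b, k and P right linear.\<close>
  have "commutes (\<lambda>u. u *\<^sub>Q q) im" for q
    using right_linear_im by (simp add: right_linear_iff_commutes)
  note q = comm[OF bounded_linear_scaleQ this]
  have lin: "right_linear b" "right_linear k" "right_linear P"
    using b(1) k(1) P(1) q by (auto simp: right_linear_iff_commutes)
  note comm_R = comm[OF bounded_linear commutes_sym[OF im_R]]
    and comm_re = comm[OF right_linearD(1)[OF right_linear_re] re_im]
    and comm_im = comm[OF right_linearD(1)[OF right_linear_im]]
  have im_im: "commutes im im"
    by (simp add: commutes_def)
  have bP: "b (P x) = 0" for x
    using b(4)[of "P x"] P(3)[of x] by simp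
  have "commutes b im"
    using comm_im[OF im_im] by (auto intro: commutes_sym)
  note comm_b = comm[OF b(1) this]
  have Pb: "P (b x) = 0" for x
    using comm_b bP by (simp add: commutes_def)
  interpret commuting_symmetric "{R, re}" P
  proof
    show "right_linear s \<and> rin.symmetric s" if "s \<in> {R, re}" for s
      using that right_linear right_linear_re symmetric symmetric_re by auto
    show "commutes s t" if "s \<in> {R, re}" "t \<in> {R, re}" for s t
      using that re_R by (auto simp: commutes_def)
    show "P (P x) = P x" for x
      by (rule P(4)[OF P(3)])
    show "commutes P s" if "s \<in> {R, re}" for s
      using that comm_R comm_re by (auto intro: commutes_sym)
  qed (fact lin P(2))+
  obtain l where l: "right_linear l" "rin.skew l" "\<And>x. l (l x) = - P x"
    "\<And>x. P (l x) = l x" "\<And>x. l (P x) = l x" "\<And>s. s \<in> {R, re} \<Longrightarrow> commutes s l"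
    by (rule commuting_imaginary_unit, rule that)
  interpret l: bounded_linear l
    using l(1) by (rule right_linearD)
  \<comment> \<open>k vanishes on the range of P and l on the kernel of P, so the cross terms of (k
    + l)^2 drop out and (P - 1) - P = - 1 remains.\<close>
  have kl: "k (l x) = 0" and bl: "b (l x) = 0" for x
    using P(5)[of "l x"] bP[of "l x"] by (simp_all add: l(4))
  have lk: "l (k x) = 0" and lb: "l (b x) = 0" for x
    using l(5)[of "k x"] l(5)[of "b x"] by (simp_all add: P(6) Pb l.zero)
  have "polar b (\<lambda>x. k x + l x)"
    unfolding polar_def
  proof (intro conjI allI impI)
    show "right_linear (\<lambda>x. k x + l x)"
      using lin(2) l(1) by (auto simp: right_linear_def scaleQ_add_left intro: bounded_linear_add)
    show "rin.skew (\<lambda>x. k x + l x)"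
      using k(2) l(2) by (simp add: rin.skew_def rin.ip_simps)
    show "k (k x + l x) + l (k x + l x) = - x" for x
      by (simp add: k.add l.add kl lk k(4) l(3))
    show "commutes (\<lambda>x. k x + l x) R" "commutes (\<lambda>x. k x + l x) re"
      using comm_R comm_re l(6)[of R] l(6)[of re] right_linearD(1)[OF right_linear_re]
      by (auto simp: commutes_def add linear_add bounded_linear.linear)
    show "k (b x) + l (b x) = im x" for x
      by (simp add: k(3) lb)
    show "b (k x + l x) = im x" for x
      using comm_b by (simp add: b.add bl commutes_def k(3))
    show "commutes b R" "commutes b re"
      using comm_R comm_re by (auto intro: commutes_sym)
    show "u \<in> closure (range b)" if u: "\<forall>v. im v = 0 \<longrightarrow> u \<bullet>\<^sub>r v = 0" for u
    proof -
      have "P u \<bullet>\<^sub>r P u = u \<bullet>\<^sub>r P u"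
        using rin.symmetricD[OF P(2), of u "P u"] P(4)[OF P(3)] by simp
      also have "\<dots> = 0"
        using u P(3) by simp
      finally have "P u = 0"
        by (simp add: rin.ip_self)
      then show ?thesis
        using P(7)[of u] by simp
    qed
  qed (fact lin b)+
  then show thesis
    by (rule that)
qed

context
  fixes b j
  assumes polar: "polar b j"
begin

lemma polarD:
  shows "right_linear b" "rin.symmetric b" "\<And>x. 0 \<le> x \<bullet>\<^sub>r b x" "commutes b R" "commutes b re"
    "right_linear j" "rin.skew j" "\<And>x. j (j x) = - x" "commutes j R" "commutes j re"
    "\<And>x. j (b x) = im x" "\<And>x. b (j x) = im x"
    "\<And>u. \<forall>v. im v = 0 \<longrightarrow> u \<bullet>\<^sub>r v = 0 \<Longrightarrow> u \<in> closure (range b)"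
  using polar by (simp_all add: polar_def)

lemma j_R: "R (j x) = j (R x)"
  using polarD(9) by (simp add: commutes_def)

lemma j_neg: "j (- x) = - j x"
  using right_linearD(1)[OF polarD(6)] by (simp add: linear_neg bounded_linear.linear)

lemma polar_quotient: "(\<lambda>u. Some (j u)) \<circ>\<^sub>m oper_quotient R b = oper_quotient R im"
proof (rule oper_eqI)
  fix u w
  have "(\<exists>s. b u = R s \<and> w = j s) \<longleftrightarrow> im u = R w"
  proof
    assume "\<exists>s. b u = R s \<and> w = j s"
    then show "im u = R w"
      by (auto simp: polarD(11)[symmetric] j_R)
  next
    assume w: "im u = R w"
    have "j (j (b u)) = R (j w)"
      by (simp only: polarD(11) w j_R)
    then have "b u = R (- j w)"
      unfolding polarD(8) by (rule neg_eqD)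
    moreover have "w = j (- j w)"
      by (simp add: j_neg polarD(8))
    ultimately show "\<exists>s. b u = R s \<and> w = j s"
      by blast
  qed
  then show "((\<lambda>u. Some (j u)) \<circ>\<^sub>m oper_quotient R b) u = Some w \<longleftrightarrow> oper_quotient R im u = Some w"
    by (simp add: Some_comp_iff quotient_iff)
qed

lemma quotient_b:
  shows "qlinear_oper (oper_quotient R b)" "self_adjoint_oper (oper_quotient R b)"
    "positive_oper (oper_quotient R b)"
proof -
  show q: "qlinear_oper (oper_quotient R b)" and s: "self_adjoint_oper (oper_quotient R b)"
    by (intro qlinear_oper_quotient self_adjoint_quotient polarD)+
  show "positive_oper (oper_quotient R b)"
    by (rule positive_operI[OF q s],
        rule nonneg_quotient[OF right_linearD(1)[OF polarD(1)] polarD(4,3)])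
      (simp add: quotient_iff)
qed

text \<open>The intermediate vectors correspond by t = j s, and the sign in j^2 = - 1 cancels the
  one in the adjoint of the skew quotient. This identifies \<open>oper_quotient R b\<close> as the
  absolute value.\<close>

lemma quotient_b_square:
  "oper_quotient R b \<circ>\<^sub>m oper_quotient R b = (oper_quotient R im)\<^sup>\<star> \<circ>\<^sub>m oper_quotient R im"
proof (rule oper_eqI)
  fix u w
  have "(\<exists>s. b u = R s \<and> b s = R w) \<longleftrightarrow> (\<exists>t. im u = R t \<and> im t = R (- w))"
  proof
    assume "\<exists>s. b u = R s \<and> b s = R w"
    then obtain s where s: "b u = R s" "b s = R w"
      by blast
    have "im u = R (j s)"
      by (simp add: polarD(11)[symmetric] s j_R)
    moreover have "im (j s) = R (- w)"
    proof -
      have "im (j s) = b (j (j s))"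
        by (rule polarD(12)[symmetric])
      also have "\<dots> = - b s"
        unfolding polarD(8) using right_linearD(1)[OF polarD(1)]
        by (intro linear_neg bounded_linear.linear)
      finally show ?thesis
        by (simp add: s neg)
    qed
    ultimately show "\<exists>t. im u = R t \<and> im t = R (- w)"
      by blast
  next
    assume "\<exists>t. im u = R t \<and> im t = R (- w)"
    then obtain t where t: "im u = R t" "im t = R (- w)"
      by blast
    have "j (j (b u)) = R (j t)"
      by (simp only: polarD(11) t j_R)
    then have "b u = R (- j t)"
      unfolding polarD(8) by (rule neg_eqD)
    moreover have "b (- j t) = R w"
      using t(2) right_linearD(1)[OF polarD(1)]
      by (simp add: linear_neg bounded_linear.linear polarD(12) neg)
    ultimately show "\<exists>s. b u = R s \<and> b s = R w"
      by blast
  qed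
  then show "(oper_quotient R b \<circ>\<^sub>m oper_quotient R b) u = Some w \<longleftrightarrow>
      ((oper_quotient R im)\<^sup>\<star> \<circ>\<^sub>m oper_quotient R im) u = Some w"
    unfolding adjoint_quotient_im
    by (simp add: map_comp_Some_iff oper_uminus_Some_iff quotient_iff)
qed

lemma cartesian_decomposition_quotient:
  "cartesian_decomposition (oper_quotient R N) (oper_quotient R re) (oper_quotient R b)
     (\<lambda>u. Some (j u))"
proof -
  have "oper_quotient R N = oper_quotient R re +\<^sub>o oper_quotient R im"
    by (rule oper_eqI) (simp only: quotient_N_iff oper_add_Some_iff quotient_iff[of re] quotient_iff[of im])
  moreover have "oper_quotient R re \<circ>\<^sub>m (\<lambda>u. Some (j u)) = (\<lambda>u. Some (j u)) \<circ>\<^sub>m oper_quotient R re"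
    "oper_quotient R b \<circ>\<^sub>m (\<lambda>u. Some (j u)) = (\<lambda>u. Some (j u)) \<circ>\<^sub>m oper_quotient R b"
    using polarD(1,6) right_linear_re right_linearD(1)
    by (intro quotient_commutes_total polarD commutes_sym[OF polarD(9)]
        commutes_sym[OF polarD(10)] bounded_linear.linear; auto simp: commutes_def polarD(11,12))+
  moreover note AB = closure_graph_eqD[OF closure_compose_quotient[OF
        right_linearD(1)[OF right_linear_re] re_R right_linearD(1)[OF polarD(1)] polarD(4)]]
    and BA = closure_graph_eqD[OF closure_compose_quotient[OF
        right_linearD(1)[OF polarD(1)] polarD(4) right_linearD(1)[OF right_linear_re] re_R]]
  \<comment> \<open>Both closures have the denominator R^2, so equal numerators make them
    equal.\<close>
  moreover have "(\<lambda>x. re (b x)) = (\<lambda>x. b (re x))"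
    using polarD(5) by (simp add: commutes_def)
  ultimately show ?thesis
    unfolding cartesian_decomposition_def polar_quotient
    using imaginary_unit_operI[OF polarD(6,7,8)] quotient_b
      qlinear_oper_quotient[OF right_linear_re]
      self_adjoint_quotient[OF right_linear_re re_R symmetric_re]
    by (intro conjI) simp_all
qed

end

end

section \<open>Uniqueness of the decomposition\<close>

lemma self_adjoint_operD:
  assumes "qlinear_oper A" "self_adjoint_oper A" "A u = Some w" "A v = Some s"
  shows "u \<bullet>\<^sub>r s = w \<bullet>\<^sub>r v"
  using adjointD[OF assms(1) _ _ assms(4), of u w] assms(2,3) by (simp add: self_adjoint_oper_def)

lemma self_adjoint_operI:
  assumes "qlinear_oper A" "self_adjoint_oper A" "\<And>v s. A v = Some s \<Longrightarrow> u \<bullet>\<^sub>r s = w \<bullet>\<^sub>r v"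
  shows "A u = Some w"
proof -
  have dense: "densely_defined A"
    using assms(2) by (simp add: self_adjoint_oper_def)
  have "(A\<^sup>\<star>) u = Some w"
    unfolding adjoint_iff[OF assms(1) dense] using assms(3) by blast
  then show ?thesis
    using assms(2) by (simp add: self_adjoint_oper_def)
qed

context normal_quotient
begin

text \<open>On the range of \<open>R\<close> the values of A' and J'B' are forced by those of T and
  its adjoint. Symmetry extends this to inclusions into the quotients, and self-adjointness, which
  excludes proper symmetric extensions, turns the inclusions into equalities.\<close>

theorem cartesian_decomposition_unique:
  assumes polar: "polar b j"
    and cd: "cartesian_decomposition (oper_quotient R N) A' B' J'"
  shows "A' = oper_quotient R re" "B' = oper_quotient R b"
    "\<And>u. \<forall>v. im v = 0 \<longrightarrow> u \<bullet>\<^sub>r v = 0 \<Longrightarrow> J' u = Some (j u)"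
proof -
  let ?T = "oper_quotient R N" and ?A = "oper_quotient R re" and ?S = "oper_quotient R im"
  have A': "qlinear_oper A'" "self_adjoint_oper A'"
    and B': "qlinear_oper B'" "self_adjoint_oper B'" "positive_oper B'"
    and J': "bounded_oper J'" "anti_self_adjoint_oper J'" "unitary_oper J'"
    and T: "?T = A' +\<^sub>o (J' \<circ>\<^sub>m B')" and BJ: "B' \<circ>\<^sub>m J' = J' \<circ>\<^sub>m B'"
    using cd by (simp_all add: cartesian_decomposition_def)
  obtain j' where j': "J' = (\<lambda>u. Some (j' u))" "right_linear j'" "rin.skew j'" "\<And>u. j' (j' u) = - u"
    by (rule imaginary_unit_operE[OF J'], rule that)
  define S' where "S' = J' \<circ>\<^sub>m B'"
  note adjA = self_adjoint_operD[OF A'] and adjB = self_adjoint_operD[OF B'(1,2)]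
  have S'_iff: "S' u = Some w \<longleftrightarrow> (\<exists>s. B' u = Some s \<and> w = j' s)" for u w
    by (simp add: S'_def j'(1) Some_comp_iff)
  have B'j: "B' (j' u) = Some (j' w)" if "B' u = Some w" for u w
  proof -
    have "(B' \<circ>\<^sub>m J') u = Some (j' w)"
      unfolding BJ using that by (simp add: j'(1) Some_comp_iff)
    then show ?thesis
      by (simp add: j'(1) comp_Some_iff)
  qed
  \<comment> \<open>\<open>J'\<close> is skew, maps the domain of \<open>B'\<close> into itself and
    commutes with \<open>B'\<close>, so J'B' is skew on its domain.\<close>
  have S'_skew: "u \<bullet>\<^sub>r s = - (w \<bullet>\<^sub>r v)" if uv: "S' u = Some w" "S' v = Some s" for u v w s
  proof -
    obtain x y where xy: "B' u = Some x" "w = j' x" "B' v = Some y" "s = j' y"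
      using uv by (auto simp: S'_iff)
    have "j' u \<bullet>\<^sub>r y = j' x \<bullet>\<^sub>r v"
      by (rule adjB[OF B'j[OF xy(1)] xy(3)])
    then show ?thesis
      using rin.skewD[OF j'(3), of u y] by (simp add: xy)
  qed
  have T_star: "?T\<^sup>\<star> = oper_quotient R N'"
    by (rule adjoint_quotient[OF N N_R right_linearD(1)[OF N'] N'_R adj])
  have core: "A' (R x) = Some (re x) \<and> S' (R x) = Some (im x)" for x
  proof -
    have "(A' +\<^sub>o S') (R x) = Some (N x)"
      unfolding S'_def T[symmetric] by (rule quotient_R[OF N_R])
    then obtain p q where pq: "A' (R x) = Some p" "S' (R x) = Some q" "N x = p + q"
      by (auto simp: oper_add_Some_iff)
    \<comment> \<open>The adjoint flips the sign of the skew part; comparison with N' x then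
      separates p from q.\<close>
    have "(?T\<^sup>\<star>) (R x) = Some (p - q)"
      unfolding adjoint_iff[OF qlinear_oper_quotient[OF N] densely_defined_quotient[OF N_R]]
    proof (intro allI impI)
      fix v s
      assume "?T v = Some s"
      then obtain p' q' where pq': "A' v = Some p'" "S' v = Some q'" "s = p' + q'"
        by (auto simp: T S'_def oper_add_Some_iff)
      then show "R x \<bullet>\<^sub>r s = (p - q) \<bullet>\<^sub>r v"
        using adjA[OF pq(1) pq'(1)] S'_skew[OF pq(2) pq'(2)] by (simp add: rin.ip_simps)
    qed
    then have "N' x = p - q"
      unfolding T_star quotient_R[OF N'_R] by simp
    then have "re x = (1/2) *\<^sub>R (p + p)" "im x = (1/2) *\<^sub>R (q + q)"
      by (simp_all add: re_def im_def pq(3))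
    then show ?thesis
      using pq(1,2) by (simp add: scaleR_2[symmetric])
  qed
  have A: "qlinear_oper ?A" "self_adjoint_oper ?A"
    by (intro qlinear_oper_quotient self_adjoint_quotient right_linear_re re_R symmetric_re)+
  have A'_sub: "?A u = Some w" if "A' u = Some w" for u w
  proof -
    have "re u = R w"
    proof (rule rin.ip_eqD)
      fix x
      have "u \<bullet>\<^sub>r re x = w \<bullet>\<^sub>r R x"
        using that core by (intro adjA) auto
      then show "re u \<bullet>\<^sub>r x = R w \<bullet>\<^sub>r x"
        by (simp only: rin.symmetricD[OF symmetric_re] rin.symmetricD[OF symmetric])
    qed
    then show ?thesis
      by (simp add: quotient_iff)
  qed
  have A_sub: "A' u = Some w" if "?A u = Some w" for u w
    by (rule self_adjoint_operI[OF A']) (rule self_adjoint_operD[OF A that A'_sub])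
  show A'_eq: "A' = ?A"
    using A'_sub A_sub by (intro oper_eqI) blast
  have S'_sub: "?S u = Some w" if "S' u = Some w" for u w
  proof -
    have "im u = R w"
    proof (rule rin.ip_eqD)
      fix x
      have "u \<bullet>\<^sub>r im x = - (w \<bullet>\<^sub>r R x)"
        using that core by (intro S'_skew) auto
      then show "im u \<bullet>\<^sub>r x = R w \<bullet>\<^sub>r x"
        by (simp add: rin.skewD[OF skew_im] rin.symmetricD[OF symmetric])
    qed
    then show ?thesis
      by (simp add: quotient_iff)
  qed
  have S_skew: "u \<bullet>\<^sub>r s = - (w \<bullet>\<^sub>r v)" if "?S u = Some w" "?S v = Some s" for u v w s
  proof -
    have "(?S\<^sup>\<star>) u = Some (- w)"
      using that(1) by (simp add: adjoint_quotient_im oper_uminus_Some_iff)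
    from adjointD[OF qlinear_oper_quotient[OF right_linear_im] densely_defined_quotient[OF im_R]
        this that(2)]
    show ?thesis
      by (simp add: rin.ip.minus_left)
  qed
  have j'_neg: "j' (- x) = - j' x" for x
    using right_linearD(1)[OF j'(2)] by (simp add: linear_neg bounded_linear.linear)
  have S_sub: "S' u = Some w" if u: "?S u = Some w" for u w
  proof -
    \<comment> \<open>Maximality is available for the self-adjoint \<open>B'\<close> rather than for
      the skew product; the candidate value - j' w is solved from J'B' u = w.\<close>
    have "B' u = Some (- j' w)"
    proof (rule self_adjoint_operI[OF B'(1,2)])
      fix v s
      assume "B' v = Some s"
      then have "S' (j' v) = Some (j' (j' s))"
        using B'j S'_iff by blast
      then have "?S (j' v) = Some (- s)"
        using S'_sub j'(4) by metis
      from S_skew[OF u this] show "u \<bullet>\<^sub>r s = (- j' w) \<bullet>\<^sub>r v"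
        by (simp add: rin.ip_simps rin.skewD[OF j'(3)])
    qed
    then show ?thesis
      by (auto simp: S'_iff j'_neg j'(4))
  qed
  have S'_eq: "S' = ?S"
    using S'_sub S_sub by (intro oper_eqI) blast
  have B'_neg: "B' (- u) = Some (- w)" if "B' u = Some w" for u w
    using qlinear_oper_scaleR[OF B'(1) that, of "- 1"] by simp
  have "B' \<circ>\<^sub>m B' = ?S\<^sup>\<star> \<circ>\<^sub>m ?S"
  proof (rule oper_eqI)
    fix u w
    \<comment> \<open>Substitute y = j' x; the square of j' accounts for the sign.\<close>
    have "(\<exists>x. B' u = Some x \<and> B' x = Some w) \<longleftrightarrow> (\<exists>y. S' u = Some y \<and> S' y = Some (- w))"
    proof
      assume "\<exists>x. B' u = Some x \<and> B' x = Some w"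
      then obtain x where x: "B' u = Some x" "B' x = Some w"
        by blast
      have "S' (j' x) = Some (- w)"
        using B'j[OF x(2)] by (simp add: S'_iff j'(4))
      then show "\<exists>y. S' u = Some y \<and> S' y = Some (- w)"
        using x(1) by (auto simp: S'_iff)
    next
      assume "\<exists>y. S' u = Some y \<and> S' y = Some (- w)"
      then obtain x z where xz: "B' u = Some x" "B' (j' x) = Some z" "- w = j' z"
        by (auto simp: S'_iff)
      have "B' (- x) = Some (- w)"
        using B'j[OF xz(2)] by (simp add: j'(4) xz(3))
      then have "B' x = Some w"
        using B'_neg by fastforce
      then show "\<exists>x. B' u = Some x \<and> B' x = Some w"
        using xz(1) by blast
    qed
    then show "(B' \<circ>\<^sub>m B') u = Some w \<longleftrightarrow> (?S\<^sup>\<star> \<circ>\<^sub>m ?S) u = Some w"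
      by (simp add: adjoint_quotient_im S'_eq map_comp_Some_iff oper_uminus_Some_iff)
  qed
  then have "B' \<circ>\<^sub>m B' = oper_quotient R b \<circ>\<^sub>m oper_quotient R b"
    by (simp only: quotient_b_square[OF polar])
  then show B'_eq: "B' = oper_quotient R b"
    by (rule positive_root_unique[OF B'(1,3,2) quotient_b(1,3,2)[OF polar]])
  show "J' u = Some (j u)" if u: "\<forall>v. im v = 0 \<longrightarrow> u \<bullet>\<^sub>r v = 0" for u
  proof -
    note D = polarD[OF polar]
    \<comment> \<open>Both sides equal \<open>im x\<close>, the common value of J'B' and JB at R x;
      continuity then extends the equality to the closure of the range of b.\<close>
    have "j' (b x) = j (b x)" for x
    proof -
      have "S' (R x) = Some (j' (b x))"
        using quotient_R[OF D(4), of x] by (auto simp: S'_iff B'_eq)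
      then show ?thesis
        using core[of x] by (simp add: D(11))
    qed
    then have "range b \<subseteq> {u. j' u = j u}"
      by auto
    moreover have "closed {u. j' u = j u}"
      using right_linearD(1)[OF j'(2)] right_linearD(1)[OF D(6)]
      by (intro closed_Collect_eq linear_continuous_on)
    ultimately have "u \<in> {u. j' u = j u}"
      using D(13)[OF u] closure_minimal by blast
    then show ?thesis
      by (simp add: j'(1))
  qed
qed

end

theorem theoremJ:
  fixes T :: "'a::quaternionic_hilbert_space oper"
  assumes "qlinear_oper T" and "densely_defined T" and "closed_oper T" and "normal_oper T"
  shows "closable_oper ((T +\<^sub>o T\<^sup>\<star>) *\<^sub>o (1/2)) \<and>
    closable_oper ((T -\<^sub>o T\<^sup>\<star>) *\<^sub>o (1/2)) \<and>
    closable_oper (T -\<^sub>o T\<^sup>\<star>) \<and>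
    (\<exists>A B J. cartesian_decomposition T A B J \<and>
      A = oper_closure ((T +\<^sub>o T\<^sup>\<star>) *\<^sub>o (1/2)) \<and>
      B = oper_abs (oper_closure ((T -\<^sub>o T\<^sup>\<star>) *\<^sub>o (1/2))) \<and>
      (\<forall>A' B' J'. cartesian_decomposition T A' B' J' \<longrightarrow>
        A' = A \<and> B' = B \<and>
        (\<forall>u\<in>qorthogonal_complement (oper_kernel (oper_closure (T -\<^sub>o T\<^sup>\<star>))). J' u = J u)))"
proof -
  obtain R N N' where RN: "injective_contraction R" "right_linear N" "right_linear N'"
    "commutes N R" "commutes N' R" "commutes N N'" "\<And>x y. N x \<bullet>\<^sub>r y = x \<bullet>\<^sub>r N' y"
    "\<And>x. norm (N x) \<le> norm x" "\<And>x. norm (N' x) = norm (N x)"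
    "\<And>x. N' (N x) = R (x - R x)"
    and T: "T = oper_quotient R N" and T': "T\<^sup>\<star> = oper_quotient R N'"
    by (rule normal_oper_quotient[OF assms], rule that)
  interpret normal_quotient R N N'
    using RN by (intro normal_quotient.intro normal_quotient_axioms.intro)
  obtain b j where polar: "polar b j"
    by (rule exists_polar)
  note half_sum = closure_graph_eqD[OF closure_graph_half_sum, folded T T']
    and half_diff = closure_graph_eqD[OF closure_graph_half_diff, folded T T']
    and diff = closure_graph_eqD[OF closure_graph_diff, folded T T']
  \<comment> \<open>As R 0 = 0, a quotient takes the value 0 exactly on the kernel of its numerator,
    which is twice \<open>im\<close> here.\<close>
  have im_0: "oper_kernel (oper_closure (T -\<^sub>o T\<^sup>\<star>)) = {v. im v = 0}"
    by (simp add: diff(2) oper_kernel_def quotient_iff zero)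
  have abs: "oper_abs (oper_closure ((T -\<^sub>o T\<^sup>\<star>) *\<^sub>o (1/2))) = oper_quotient R b"
    unfolding half_diff(2)
    by (rule oper_abs_eqI) (simp_all add: quotient_b[OF polar] quotient_b_square[OF polar])
  show ?thesis
  proof (intro conjI exI allI impI half_sum(1) half_diff(1) diff(1))
    show "cartesian_decomposition T (oper_quotient R re) (oper_quotient R b) (\<lambda>u. Some (j u))"
      unfolding T by (rule cartesian_decomposition_quotient[OF polar])
    show "oper_quotient R re = oper_closure ((T +\<^sub>o T\<^sup>\<star>) *\<^sub>o (1/2))"
      by (rule half_sum(2)[symmetric])
    show "oper_quotient R b = oper_abs (oper_closure ((T -\<^sub>o T\<^sup>\<star>) *\<^sub>o (1/2)))"
      by (rule abs[symmetric])
    fix A' B' J'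
    assume "cartesian_decomposition T A' B' J'"
    note unique = cartesian_decomposition_unique[OF polar this[unfolded T]]
    show "A' = oper_quotient R re" "B' = oper_quotient R b"
      by (rule unique)+
    show "\<forall>u\<in>qorthogonal_complement (oper_kernel (oper_closure (T -\<^sub>o T\<^sup>\<star>))). J' u = Some (j u)"
      unfolding im_0 using unique(3)
      by (auto simp: qorthogonal_complement_def rin_def zero_quat_def)
  qed
qed

end
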